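(* Let $\beta>1$, let $\tau$ be the $\beta$-transformation, and assume that $1$ is eventually periodic under $\tau$. Let $\sigma:X\to X$ be the associated local homeomorphism, $\mathcal L=\mathcal L_\sigma$ the transfer operator, and let $M=\mathbb Z[t]I(0,1)=\{p(\mathcal L)1: p\in\mathbb Z[t]\}\subset C(X,\mathbb Z)$. Let the minimal polynomial $m$ of $\mathcal L$ on $M$ be $$m(\lambda)=\lambda^q-a_0\lambda^{q-1}-a_1\lambda^{q-2}-\cdots-a_{q-1}.$$ Then $DG(\tau)$ is isomorphic as a group to the stationary inductive limit given by right multiplication on $\mathbb Z^q$ by the matrix $$B_{\mathcal L}=\begin{pmatrix} 0&1&0&\cdots&0 \\ 0&0&1&\cdots&0 \\ \cdots&\cdots&\cdots&\cdots&\cdots \\ 0&0&0&\cdots&1 \\ {a_{q-1}}&a_{q-2}&a_{q-3}&\cdots&a_0 \end{pmatrix}.$$ The unique state $\omega$ on $DG(\tau)$ is given by Lebesgue measure. On the inductive limit, $\omega$ satisfies $$\omega([(z_0,\ldots,z_{q-1}),n])=\beta^{-n}\sum_iz_i\beta^i.$$ The order on $DG(\tau)$ is the strict order given by this state, and the range of this state is $\mathbb Z[\beta,\beta^{-1}]$.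
   Context: Let $I=[0,1]$. For $\beta>1$ the $\beta$-transformation is $\tau(x)=\beta x\bmod 1$ on $[0,1)$, with $\tau(1)=\lim_{x\to1^-}\tau(x)$. It is piecewise monotonic with associated partition $0=a'_0<a'_1<\dots$ consisting of the distinct points among $0,1/\beta,\dots,\lfloor\beta\rfloor/\beta,1$. On each partition interval $[a'_{i-1},a'_i]$ let $\tau_i$ be the continuous extension of $\tau|_{(a'_{i-1},a'_i)}$; values at discontinuities are ignored: $\widehat\tau(x)$ is the set of left and right limits of $\tau$ at $x$, $\widehat\tau(A)=\bigcup_i\tau_i(A\cap[a'_{i-1},a'_i])$, $\widehat\tau^{-1}(A)=\bigcup_i\{x\in[a'_{i-1},a'_i]:\tau_i(x)\in A\}$. The point $1$ is eventually periodic if its orbit under $\tau$ is finite. The generalized orbit of $x\in I$ is the smallest subset of $I$ containing $x$ that is forward and backward invariant under $\widehat\tau$. $I_1$ is the union of the generalized orbits of the partition points, and $I_0=I\setminus I_1$. $X$ is the totally ordered set obtained from $I$ by replacing each $x\in I_1\setminus\{0,1\}$ by two points $x^-<x^+$, with the order topology (homeomorphic to a compact subset of $\mathbb R$); $\pi:X\to I$ is the collapse map ($\pi(x^\pm)=x$), and $X_0=\pi^{-1}(I_0)$. The local homeomorphism associated with $\tau$ is the unique continuous map $\sigma:X\to X$ with $\pi\circ\sigma=\tau\circ\pi$ on $X_0$. Lebesgue measure is regarded as a measure on $X$ via $\pi$ (it lives on $X_0\cong I_0$, as $I_1$ is countable). $(\mathcal L f)(x)=\sum_{\sigma y=x}f(y)$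 for $f\in C(X,\mathbb Z)$. $I(0,1)$ denotes (the characteristic function of) all of $X$, i.e. the constant function $1$. $DG(\tau)$ is $C(X,\mathbb Z)$ modulo $f\sim g$ iff $\mathcal L^nf=\mathcal L^ng$ for some $n\ge0$, ordered by $[f]\ge0$ iff $\mathcal L^nf\ge0$ for some $n$, with order unit $[1]$. A state is a positive homomorphism $\omega:DG(\tau)\to\mathbb R$ with $\omega([1])=1$; the strict order given by $\omega$ is: $x\le y$ iff $\omega(x)<\omega(y)$ or $x=y$. The state given by Lebesgue measure is $[f]\mapsto\int f$. For an integer $q\times q$ matrix $B$, the stationary inductive limit of $\mathbb Z^q\xrightarrow{B}\mathbb Z^q$ consists of classes $[v,n]$, $v\in\mathbb Z^q$ (row vectors), $n\in\mathbb N$, with $[v_1,n_1]=[v_2,n_2]$ iff $v_1B^{n_2+k}=v_2B^{n_1+k}$ for some $k\ge0$. "On the inductive limit, $\omega$" means $\omega$ transported through the isomorphism. *)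

theory Defs
  imports
    "HOL-Analysis.Analysis"
    "HOL-Algebra.Group"
    "HOL-Computational_Algebra.Polynomial"
    "Jordan_Normal_Form.Matrix"
begin

section \<open>Piecewise monotonic maps of the unit interval\<close>

text \<open>A map \<open>\<tau>\<close> is always considered together with the finite set \<open>P\<close> of its partition points,
  where \<open>0 \<in> P\<close>, \<open>1 \<in> P\<close> and \<open>P \<subseteq> {0..1}\<close>.\<close>

definition partition_intervals :: "real set \<Rightarrow> (real \<times> real) set" where
  "partition_intervals P = {(a, b). a \<in> P \<and> b \<in> P \<and> a < b \<and> P \<inter> {a<..<b} = {}}"

text \<open>The continuous extension to \<open>{a..b}\<close> of the restriction of \<open>\<tau>\<close> to \<open>{a<..<b}\<close>.\<close>

definition branch :: "(real \<Rightarrow> real) \<Rightarrow> real \<Rightarrow> real \<Rightarrow> real \<Rightarrow> real" where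
  "branch \<tau> a b x = Lim (at x within {a<..<b}) \<tau>"

definition hat_image :: "(real \<Rightarrow> real) \<Rightarrow> real set \<Rightarrow> real set \<Rightarrow> real set" where
  "hat_image \<tau> P A = (\<Union>(a, b) \<in> partition_intervals P. branch \<tau> a b ` (A \<inter> {a..b}))"

definition hat_preimage :: "(real \<Rightarrow> real) \<Rightarrow> real set \<Rightarrow> real set \<Rightarrow> real set" where
  "hat_preimage \<tau> P A = (\<Union>(a, b) \<in> partition_intervals P. {x \<in> {a..b}. branch \<tau> a b x \<in> A})"

definition generalized_orbit :: "(real \<Rightarrow> real) \<Rightarrow> real set \<Rightarrow> real \<Rightarrow> real set" where
  "generalized_orbit \<tau> P x =
     \<Inter> {A. A \<subseteq> {0..1} \<and> x \<in> A \<and> hat_image \<tau> P A \<subseteq> A \<and> hat_preimage \<tau> P A \<subseteq> A}"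

definition I1 :: "(real \<Rightarrow> real) \<Rightarrow> real set \<Rightarrow> real set" where
  "I1 \<tau> P = (\<Union>p \<in> P. generalized_orbit \<tau> P p)"

definition I0 :: "(real \<Rightarrow> real) \<Rightarrow> real set \<Rightarrow> real set" where
  "I0 \<tau> P = {0..1} - I1 \<tau> P"


section \<open>The disconnected interval and the associated local homeomorphism\<close>

text \<open>A point of the split interval is a pair of a real number and a sign: an unsplit point \<open>x\<close> is
  \<open>(x, 0)\<close>, and the two copies \<open>x\<^sup>- < x\<^sup>+\<close> of a split point are \<open>(x, - 1)\<close> and \<open>(x, 1)\<close>. The
  order is lexicographic. (The topological type class instance on pairs is the product topology
  and is not used.) The collapse map \<open>\<pi>\<close> is \<^const>\<open>fst\<close>.\<close>

definition split_points :: "(real \<Rightarrow> real) \<Rightarrow> real set \<Rightarrow> (real \<times> int) set" where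
  "split_points \<tau> P =
     (\<lambda>x. (x, 0)) ` ({0..1} - (I1 \<tau> P - {0, 1})) \<union> (I1 \<tau> P - {0, 1}) \<times> {- 1, 1}"

definition split_less :: "real \<times> int \<Rightarrow> real \<times> int \<Rightarrow> bool" where
  "split_less u v \<longleftrightarrow> fst u < fst v \<or> fst u = fst v \<and> snd u < snd v"

definition split_interval :: "(real \<Rightarrow> real) \<Rightarrow> real set \<Rightarrow> (real \<times> int) topology" where
  "split_interval \<tau> P = topology_generated_by
     (insert (split_points \<tau> P)
       ((\<lambda>u. {v \<in> split_points \<tau> P. split_less v u}) ` split_points \<tau> P \<union>
        (\<lambda>u. {v \<in> split_points \<tau> P. split_less u v}) ` split_points \<tau> P))"

definition split_X0 :: "(real \<Rightarrow> real) \<Rightarrow> real set \<Rightarrow> (real \<times> int) set" where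
  "split_X0 \<tau> P = {u \<in> split_points \<tau> P. fst u \<in> I0 \<tau> P}"

definition local_homeo :: "(real \<Rightarrow> real) \<Rightarrow> real set \<Rightarrow> real \<times> int \<Rightarrow> real \<times> int" where
  "local_homeo \<tau> P = (THE \<sigma>. \<sigma> \<in> extensional (split_points \<tau> P) \<and>
     continuous_map (split_interval \<tau> P) (split_interval \<tau> P) \<sigma> \<and>
     (\<forall>u \<in> split_X0 \<tau> P. fst (\<sigma> u) = \<tau> (fst u)))"

text \<open>Integration with respect to Lebesgue measure carried over to the split interval. As \<open>I1\<close> is
  countable, the measure lives on \<open>X\<^sub>0\<close>, where the inverse of the collapse map is
  \<open>x \<mapsto> (x, 0)\<close>.\<close>

definition lebesgue_int :: "(real \<Rightarrow> real) \<Rightarrow> real set \<Rightarrow> (real \<times> int \<Rightarrow> int) \<Rightarrow> real" where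
  "lebesgue_int \<tau> P f = (LINT x:I0 \<tau> P|lborel. real_of_int (f (x, 0)))"


section \<open>The dimension group of a local homeomorphism\<close>

text \<open>Elements of \<open>C(X, \<int>)\<close> are extended by \<open>0\<close> outside of \<open>X\<close>, so that equality of functions is
  equality on \<open>X\<close>. In particular the constant function \<open>1\<close> is the indicator of \<open>topspace X\<close>.\<close>

definition C_int :: "'a topology \<Rightarrow> ('a \<Rightarrow> int) set" where
  "C_int X = {f. continuous_map X (discrete_topology UNIV) f \<and> (\<forall>x. x \<notin> topspace X \<longrightarrow> f x = 0)}"

definition one_fun :: "'a topology \<Rightarrow> 'a \<Rightarrow> int" where
  "one_fun X = indicator (topspace X)"

definition transfer_op :: "'a topology \<Rightarrow> ('a \<Rightarrow> 'a) \<Rightarrow> ('a \<Rightarrow> int) \<Rightarrow> 'a \<Rightarrow> int" where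
  "transfer_op X \<sigma> f x = (\<Sum>y \<in> {y \<in> topspace X. \<sigma> y = x}. f y)"

definition dg_rel :: "'a topology \<Rightarrow> ('a \<Rightarrow> 'a) \<Rightarrow> (('a \<Rightarrow> int) \<times> ('a \<Rightarrow> int)) set" where
  "dg_rel X \<sigma> = {(f, g). f \<in> C_int X \<and> g \<in> C_int X \<and>
     (\<exists>n. (transfer_op X \<sigma> ^^ n) f = (transfer_op X \<sigma> ^^ n) g)}"

definition dg_class :: "'a topology \<Rightarrow> ('a \<Rightarrow> 'a) \<Rightarrow> ('a \<Rightarrow> int) \<Rightarrow> ('a \<Rightarrow> int) set" where
  "dg_class X \<sigma> f = dg_rel X \<sigma> `` {f}"

text \<open>The group operation is addition, written multiplicatively as in \<^theory>\<open>HOL-Algebra.Group\<close>.\<close>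

definition DG :: "'a topology \<Rightarrow> ('a \<Rightarrow> 'a) \<Rightarrow> ('a \<Rightarrow> int) set monoid" where
  "DG X \<sigma> = \<lparr> carrier = C_int X // dg_rel X \<sigma>,
     mult = (\<lambda>u v. \<Union>f \<in> u. \<Union>g \<in> v. dg_class X \<sigma> (\<lambda>x. f x + g x)),
     one = dg_class X \<sigma> (\<lambda>x. 0) \<rparr>"

definition dg_cone :: "'a topology \<Rightarrow> ('a \<Rightarrow> 'a) \<Rightarrow> ('a \<Rightarrow> int) set set" where
  "dg_cone X \<sigma> = {dg_class X \<sigma> f | f.
     f \<in> C_int X \<and> (\<exists>n. \<forall>x \<in> topspace X. 0 \<le> (transfer_op X \<sigma> ^^ n) f x)}"

definition dg_le :: "'a topology \<Rightarrow> ('a \<Rightarrow> 'a) \<Rightarrow> ('a \<Rightarrow> int) set \<Rightarrow> ('a \<Rightarrow> int) set \<Rightarrow> bool" where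
  "dg_le X \<sigma> u v \<longleftrightarrow> v \<otimes>\<^bsub>DG X \<sigma>\<^esub> inv\<^bsub>DG X \<sigma>\<^esub> u \<in> dg_cone X \<sigma>"

definition states :: "'a topology \<Rightarrow> ('a \<Rightarrow> 'a) \<Rightarrow> (('a \<Rightarrow> int) set \<Rightarrow> real) set" where
  "states X \<sigma> = {\<omega>. \<omega> \<in> extensional (carrier (DG X \<sigma>)) \<and>
     (\<forall>u \<in> carrier (DG X \<sigma>). \<forall>v \<in> carrier (DG X \<sigma>). \<omega> (u \<otimes>\<^bsub>DG X \<sigma>\<^esub> v) = \<omega> u + \<omega> v) \<and>
     (\<forall>u \<in> dg_cone X \<sigma>. 0 \<le> \<omega> u) \<and>
     \<omega> (dg_class X \<sigma> (one_fun X)) = 1}"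


section \<open>Cyclic modules and minimal polynomials\<close>

text \<open>The function \<open>p(L) f\<close>, for an operator \<open>L\<close> on integer-valued functions.\<close>

definition poly_act :: "(('a \<Rightarrow> int) \<Rightarrow> 'a \<Rightarrow> int) \<Rightarrow> int poly \<Rightarrow> ('a \<Rightarrow> int) \<Rightarrow> 'a \<Rightarrow> int" where
  "poly_act L p f = (\<lambda>x. \<Sum>i\<le>degree p. coeff p i * (L ^^ i) f x)"

definition cyclic_module :: "(('a \<Rightarrow> int) \<Rightarrow> 'a \<Rightarrow> int) \<Rightarrow> ('a \<Rightarrow> int) \<Rightarrow> ('a \<Rightarrow> int) set" where
  "cyclic_module L f = {poly_act L p f | p. True}"

definition annihilates :: "int poly \<Rightarrow> (('a \<Rightarrow> int) \<Rightarrow> 'a \<Rightarrow> int) \<Rightarrow> ('a \<Rightarrow> int) set \<Rightarrow> bool" where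
  "annihilates p L M \<longleftrightarrow> (\<forall>f \<in> M. poly_act L p f = (\<lambda>x. 0))"

definition minimal_poly :: "(('a \<Rightarrow> int) \<Rightarrow> 'a \<Rightarrow> int) \<Rightarrow> ('a \<Rightarrow> int) set \<Rightarrow> int poly" where
  "minimal_poly L M = (THE m. lead_coeff m = 1 \<and> annihilates m L M \<and>
     (\<forall>p. p \<noteq> 0 \<and> annihilates p L M \<longrightarrow> degree m \<le> degree p))"


section \<open>Stationary inductive limits\<close>

text \<open>Row vectors of length \<open>q\<close> are \<open>1 \<times> q\<close> matrices.\<close>

definition lim_rel :: "nat \<Rightarrow> int mat \<Rightarrow> ((int mat \<times> nat) \<times> (int mat \<times> nat)) set" where
  "lim_rel q B = {((v1, n1), (v2, n2)). v1 \<in> carrier_mat 1 q \<and> v2 \<in> carrier_mat 1 q \<and>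
     (\<exists>k. v1 * B ^\<^sub>m (n2 + k) = v2 * B ^\<^sub>m (n1 + k))}"

definition lim_class :: "nat \<Rightarrow> int mat \<Rightarrow> int mat \<Rightarrow> nat \<Rightarrow> (int mat \<times> nat) set" where
  "lim_class q B v n = lim_rel q B `` {(v, n)}"

definition ind_limit :: "nat \<Rightarrow> int mat \<Rightarrow> (int mat \<times> nat) set monoid" where
  "ind_limit q B = \<lparr> carrier = (carrier_mat 1 q \<times> UNIV) // lim_rel q B,
     mult = (\<lambda>u v. \<Union>(v1, n1) \<in> u. \<Union>(v2, n2) \<in> v.
       lim_class q B (v1 * B ^\<^sub>m n2 + v2 * B ^\<^sub>m n1) (n1 + n2)),
     one = lim_class q B (0\<^sub>m 1 q) 0 \<rparr>"

definition companion :: "nat \<Rightarrow> (nat \<Rightarrow> int) \<Rightarrow> int mat" where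
  "companion q a = mat q q (\<lambda>(i, j).
     if i = q - 1 then a (q - 1 - j) else if j = i + 1 then 1 else 0)"


section \<open>The beta transformation\<close>

definition beta_map :: "real \<Rightarrow> real \<Rightarrow> real" where
  "beta_map \<beta> x = (if x = 1 then Lim (at_left 1) (\<lambda>y. frac (\<beta> * y)) else frac (\<beta> * x))"

definition beta_partition :: "real \<Rightarrow> real set" where
  "beta_partition \<beta> = insert 1 ((\<lambda>k. real k / \<beta>) ` {0..nat \<lfloor>\<beta>\<rfloor>})"

definition eventually_periodic :: "('a \<Rightarrow> 'a) \<Rightarrow> 'a \<Rightarrow> bool" where
  "eventually_periodic \<tau> x \<longleftrightarrow> finite (range (\<lambda>n. (\<tau> ^^ n) x))"

text \<open>The ring \<open>\<int>[\<beta>, \<beta>\<^sup>-\<^sup>1]\<close> of values of Laurent polynomials.\<close>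

definition laurent_ring :: "real \<Rightarrow> real set" where
  "laurent_ring \<beta> = {\<Sum>k = - int N..int N. real_of_int (c k) * \<beta> powi k | N c. True}"

end

theory Submission
  imports Defs
begin

text \<open>Write \<open>D\<close> for the set of split points together with \<open>0\<close> and \<open>1\<close>, and let \<open>left_map x\<close> be the left limit
  of the beta transformation at \<open>x\<close>. As \<open>D\<close> is dense, \<open>C(X, \<int>)\<close> is spanned by the indicators
  \<open>I(0, x)\<close> of initial segments ending at some \<open>x \<in> D\<close>, and counting preimages gives
  \<open>L I(0, x) = m \<cdot> 1 + I(0, left_map x)\<close> with \<open>m = \<lceil>\<beta> x\<rceil> - 1\<close>. Every \<open>x \<in> D\<close> eventually enters the finite orbit of
  \<open>1\<close>, so each function ends up in the cyclic module generated by \<open>1\<close>, which is free on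
  \<open>1, L 1, \<dots>, L\<^sup>q\<^sup>-\<^sup>1 1\<close> and on which \<open>L\<close> acts by the companion matrix. Since \<open>L\<close> multiplies the
  Lebesgue integral by \<open>\<beta>\<close>, a contraction argument on the orbit of \<open>1\<close> shows that a positive
  integral forces \<open>L\<^sup>n f \<ge> 0\<close> for some \<open>n\<close>. This determines the order, and the order determines the state by
  rational approximation.\<close>

section \<open>Laurent polynomial values\<close>

text \<open>Segments are made to end at x^-, so that their images are governed by left limits alone;
  the left orbit of 1 stays in (0, 1] and never meets 0, unlike the orbit under the map itself. The
  operator L is onto but not injective: pieces of two branches with the same image have the same
  transfer. So no inverse of L is formed. A class corresponds to the set of all pairs (v, n) such
  that L^n of some representative has coordinates v; surjectivity makes every pair occur, and
  freeness of the powers of L at 1 makes the comparison faithful. The degree q is the number of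
  points of the left orbit of 1: the segment up to the n-th orbit point is a monic polynomial of
  degree n in L applied to 1, and segments with distinct ends are independent. Two properties of D
  are played against each other: its density makes segments separate points of X, while its
  countability makes X_0 dense and lets Lebesgue measure ignore D. Countability comes from the
  inclusion of D in the ring of Laurent polynomial values, which also bounds the range of the
  state.\<close>

lemma laurent_ring_finite_iff:
  "x \<in> laurent_ring \<beta> \<longleftrightarrow>
    (\<exists>F c. finite F \<and> x = (\<Sum>k\<in>F. real_of_int (c k) * \<beta> powi k))"
proof
  assume "x \<in> laurent_ring \<beta>"
  then show "\<exists>F c. finite F \<and> x = (\<Sum>k\<in>F. real_of_int (c k) * \<beta> powi k)"
    unfolding laurent_ring_def by blast
next
  assume "\<exists>F c. finite F \<and> x = (\<Sum>k\<in>F. real_of_int (c k) * \<beta> powi k)"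
  then obtain F c where F: "finite F" "x = (\<Sum>k\<in>F. real_of_int (c k) * \<beta> powi k)"
    by blast
  obtain N :: nat where N: "\<forall>k\<in>F. \<bar>k\<bar> \<le> int N"
  proof
    show "\<forall>k\<in>F. \<bar>k\<bar> \<le> int (nat (\<Sum>k\<in>F. \<bar>k\<bar>))"
      using F(1) by (auto simp: sum_nonneg intro!: member_le_sum[of _ F abs, simplified])
  qed
  have "x = (\<Sum>k=-int N..int N. real_of_int (if k \<in> F then c k else 0) * \<beta> powi k)"
    unfolding F(2) using F(1) N by (intro sum.mono_neutral_cong_left) force+
  then show "x \<in> laurent_ring \<beta>"
    unfolding laurent_ring_def by (intro CollectI exI[of _ N] exI[of _ "\<lambda>k. if k \<in> F then c k else 0"]) simp
qed

lemma laurent_ring_add: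
  assumes "x \<in> laurent_ring \<beta>" "y \<in> laurent_ring \<beta>"
  shows "x + y \<in> laurent_ring \<beta>"
proof -
  from assms obtain F c G d where
    x: "finite F" "x = (\<Sum>k\<in>F. real_of_int (c k) * \<beta> powi k)" and
    y: "finite G" "y = (\<Sum>k\<in>G. real_of_int (d k) * \<beta> powi k)"
    unfolding laurent_ring_finite_iff by blast
  have "x = (\<Sum>k\<in>F \<union> G. real_of_int (if k \<in> F then c k else 0) * \<beta> powi k)"
    unfolding x(2) using x(1) y(1) by (intro sum.mono_neutral_cong_left) auto
  moreover have "y = (\<Sum>k\<in>F \<union> G. real_of_int (if k \<in> G then d k else 0) * \<beta> powi k)"
    unfolding y(2) using x(1) y(1) by (intro sum.mono_neutral_cong_left) auto
  ultimately have "x + y = (\<Sum>k\<in>F \<union> G. real_of_int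
      ((if k \<in> F then c k else 0) + (if k \<in> G then d k else 0)) * \<beta> powi k)"
    by (simp add: sum.distrib distrib_right)
  with x(1) y(1) show ?thesis
    unfolding laurent_ring_finite_iff
    by (intro exI[of _ "F \<union> G"]
        exI[of _ "\<lambda>k. (if k \<in> F then c k else 0) + (if k \<in> G then d k else 0)"]) auto
qed

lemma laurent_ring_mult_powi:
  assumes "x \<in> laurent_ring \<beta>" "\<beta> \<noteq> 0"
  shows "x * \<beta> powi j \<in> laurent_ring \<beta>"
proof -
  from assms obtain F c where
    x: "finite F" "x = (\<Sum>k\<in>F. real_of_int (c k) * \<beta> powi k)"
    unfolding laurent_ring_finite_iff by blast
  have "x * \<beta> powi j = (\<Sum>k\<in>(\<lambda>k. k + j) ` F. real_of_int (c (k - j)) * \<beta> powi k)"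
    using assms(2) unfolding x(2)
    by (subst sum.reindex) (auto simp: inj_on_def sum_distrib_right power_int_add mult.assoc)
  with x(1) show ?thesis
    unfolding laurent_ring_finite_iff
    by (intro exI[of _ "(\<lambda>k. k + j) ` F"] exI[of _ "\<lambda>k. c (k - j)"]) auto
qed

lemma laurent_ring_of_int_powi: "real_of_int n * \<beta> powi k \<in> laurent_ring \<beta>"
  unfolding laurent_ring_finite_iff by (intro exI[of _ "{k}"] exI[of _ "\<lambda>_. n"]) simp

lemma laurent_ring_of_int: "real_of_int n \<in> laurent_ring \<beta>"
  using laurent_ring_of_int_powi[of n \<beta> 0] by simp

lemma laurent_ring_of_int_mult:
  assumes "x \<in> laurent_ring \<beta>"
  shows "real_of_int n * x \<in> laurent_ring \<beta>"
proof -
  from assms obtain F c where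
    x: "finite F" "x = (\<Sum>k\<in>F. real_of_int (c k) * \<beta> powi k)"
    unfolding laurent_ring_finite_iff by blast
  have "real_of_int n * x = (\<Sum>k\<in>F. real_of_int (n * c k) * \<beta> powi k)"
    unfolding x(2) by (simp add: sum_distrib_left mult.assoc)
  with x(1) show ?thesis
    unfolding laurent_ring_finite_iff by (intro exI[of _ F] exI[of _ "\<lambda>k. n * c k"]) auto
qed

text \<open>A value is determined by the bound N and a finite list of coefficients, with the
  coefficient of exponent k stored at position k + N; such pairs form a countable type.\<close>

lemma countable_laurent_ring: "countable (laurent_ring \<beta>)"
proof -
  define f where "f = (\<lambda>(N, cs). \<Sum>k=-int N..int N. real_of_int (cs ! nat (k + int N)) * \<beta> powi k)"
  have "laurent_ring \<beta> \<subseteq> range f"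
  proof
    fix x assume "x \<in> laurent_ring \<beta>"
    then obtain N c where x: "x = (\<Sum>k=-int N..int N. real_of_int (c k) * \<beta> powi k)"
      unfolding laurent_ring_def by blast
    have "x = f (N, map (\<lambda>i. c (int i - int N)) [0..<2*N+1])"
      unfolding x f_def prod.case by (intro sum.cong refl) (auto simp del: upt_Suc)
    then show "x \<in> range f" by blast
  qed
  then show ?thesis by (rule countable_subset) auto
qed

section \<open>The multivalued beta transformation\<close>

text \<open>Where \<beta> x is an integer the value is 1, in contrast to the 0 given by
  \<open>frac\<close>; elsewhere the two agree.\<close>

definition left_map :: "real \<Rightarrow> real \<Rightarrow> real" where
  "left_map \<beta> x = \<beta> * x - of_int \<lceil>\<beta> * x\<rceil> + 1"

lemma hat_image_iff:
  "y \<in> hat_image \<tau> P A \<longleftrightarrow>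
    (\<exists>a b. (a, b) \<in> partition_intervals P \<and> (\<exists>x\<in>A. a \<le> x \<and> x \<le> b \<and> branch \<tau> a b x = y))"
  unfolding hat_image_def UN_iff Bex_def split_paired_Ex prod.case image_iff by (auto 0 3)

lemma hat_preimage_iff: "x \<in> hat_preimage \<tau> P A \<longleftrightarrow> (\<exists>y\<in>A. y \<in> hat_image \<tau> P {x})"
proof -
  have "x \<in> hat_preimage \<tau> P A \<longleftrightarrow>
      (\<exists>a b. (a, b) \<in> partition_intervals P \<and> a \<le> x \<and> x \<le> b \<and> branch \<tau> a b x \<in> A)"
    unfolding hat_preimage_def UN_iff Bex_def split_paired_Ex prod.case mem_Collect_eq
      atLeastAtMost_iff conj_assoc ..
  then show ?thesis unfolding hat_image_iff by auto
qed

text \<open>The multivalued map as a relation, with k the number of the branch. Forward and backward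
  invariance then become closure under one relation and its converse.\<close>

definition hat_step :: "real \<Rightarrow> real \<Rightarrow> real \<Rightarrow> bool" where
  "hat_step \<beta> x y \<longleftrightarrow> x \<in> {0..1} \<and> y \<in> {0..1} \<and> (\<exists>k::nat. real k < \<beta> \<and> y = \<beta> * x - real k)"

lemma left_map_bounds: "0 < left_map \<beta> x" "left_map \<beta> x \<le> 1"
  unfolding left_map_def by linarith+

lemma left_map_eq_frac: "\<beta> * x \<notin> \<int> \<Longrightarrow> left_map \<beta> x = frac (\<beta> * x)"
  unfolding left_map_def frac_def by (auto simp: ceiling_altdef Ints_def)

lemma left_map_Ints: "\<beta> * x \<in> \<int> \<Longrightarrow> left_map \<beta> x = 1"
  unfolding left_map_def by (auto elim!: Ints_cases)

locale beta_transformation =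
  fixes \<beta> :: real
  assumes beta_gt_1: "1 < \<beta>"
begin

lemma mem_beta_partition:
  "x \<in> beta_partition \<beta> \<longleftrightarrow> x = 1 \<or> (\<exists>k::nat. real k \<le> \<beta> \<and> x = real k / \<beta>)"
proof -
  have "k \<le> nat \<lfloor>\<beta>\<rfloor> \<longleftrightarrow> real k \<le> \<beta>" for k :: nat
    using beta_gt_1 by (simp add: le_nat_iff le_floor_iff)
  then show ?thesis unfolding beta_partition_def by auto
qed

lemma beta_partition_subset: "beta_partition \<beta> \<subseteq> {0..1}"
  using beta_gt_1 by (auto simp: mem_beta_partition)

text \<open>The minimum accounts for the last branch, which is cut short at 1 unless \<beta> is an
  integer; the strict bound on k discards the degenerate interval that an integer \<beta> would
  produce at 1.\<close>

lemma partition_intervals_beta: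
  "(a, b) \<in> partition_intervals (beta_partition \<beta>) \<longleftrightarrow>
    (\<exists>k::nat. real k < \<beta> \<and> a = real k / \<beta> \<and> b = min 1 ((real k + 1) / \<beta>))"
proof
  assume ab: "(a, b) \<in> partition_intervals (beta_partition \<beta>)"
  then have a: "a \<in> beta_partition \<beta>" and b: "b \<in> beta_partition \<beta>" and less: "a < b"
    and none: "beta_partition \<beta> \<inter> {a<..<b} = {}"
    by (auto simp: partition_intervals_def)
  have "b \<le> 1" using b beta_partition_subset by auto
  with a less obtain k :: nat where k: "a = real k / \<beta>" by (auto simp: mem_beta_partition)
  have k\<beta>: "real k < \<beta>"
    using k less \<open>b \<le> 1\<close> beta_gt_1 by (smt (verit) divide_less_eq_1_pos)
  let ?b = "min 1 ((real k + 1) / \<beta>)"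
  have b0: "?b \<in> beta_partition \<beta>"
  proof (cases "real k + 1 \<le> \<beta>")
    case True
    then have "?b = real (Suc k) / \<beta>" using beta_gt_1 by (simp add: min_def add.commute)
    then show ?thesis using True by (auto simp: mem_beta_partition intro!: exI[of _ "Suc k"])
  next
    case False
    then have "?b = 1" using beta_gt_1 by (simp add: min_def)
    then show ?thesis by (simp add: mem_beta_partition)
  qed
  have a_less: "a < ?b" using k k\<beta> beta_gt_1 by (simp add: divide_strict_right_mono)
  have "\<not> ?b < b" using none b0 a_less by auto
  moreover have "\<not> b < ?b"
  proof
    assume "b < ?b"
    then have "b \<noteq> 1" "b < (real k + 1) / \<beta>" by auto
    then obtain j :: nat where j: "b = real j / \<beta>" using b by (auto simp: mem_beta_partition)
    have "real j < real k + 1" "real k < real j"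
      using \<open>b < (real k + 1) / \<beta>\<close> less j k beta_gt_1 by (auto simp: divide_less_cancel)
    then show False by simp
  qed
  ultimately show "\<exists>k::nat. real k < \<beta> \<and> a = real k / \<beta> \<and> b = min 1 ((real k + 1) / \<beta>)"
    using k k\<beta> by (intro exI[of _ k]) auto
next
  assume "\<exists>k::nat. real k < \<beta> \<and> a = real k / \<beta> \<and> b = min 1 ((real k + 1) / \<beta>)"
  then obtain k :: nat where k: "real k < \<beta>" "a = real k / \<beta>" "b = min 1 ((real k + 1) / \<beta>)"
    by blast
  have "b \<in> beta_partition \<beta>"
  proof (cases "real k + 1 \<le> \<beta>")
    case True
    then have "b = real (Suc k) / \<beta>" using beta_gt_1 k by (simp add: min_def add.commute)
    then show ?thesis using True by (auto simp: mem_beta_partition intro!: exI[of _ "Suc k"])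
  next
    case False
    then have "b = 1" using beta_gt_1 k by (simp add: min_def)
    then show ?thesis by (simp add: mem_beta_partition)
  qed
  moreover have "a < b" using k beta_gt_1 by (simp add: divide_strict_right_mono)
  moreover have "a \<in> beta_partition \<beta>" using k by (auto simp: mem_beta_partition)
  moreover have "beta_partition \<beta> \<inter> {a<..<b} = {}"
  proof -
    have False if "a < real j / \<beta>" "real j / \<beta> < b" for j :: nat
    proof -
      have "real j < real k + 1" "real k < real j"
        using that k beta_gt_1 by (auto simp: divide_less_cancel)
      then show False by simp
    qed
    then show ?thesis using k(3) by (fastforce simp: mem_beta_partition)
  qed
  ultimately show "(a, b) \<in> partition_intervals (beta_partition \<beta>)"
    by (simp add: partition_intervals_def)
qed

lemma branch_beta_map:
  fixes k :: nat
  assumes "real k < \<beta>" "x \<in> {real k / \<beta>..min 1 ((real k + 1) / \<beta>)}"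
  shows "branch (beta_map \<beta>) (real k / \<beta>) (min 1 ((real k + 1) / \<beta>)) x = \<beta> * x - real k"
proof -
  let ?a = "real k / \<beta>" and ?b = "min 1 ((real k + 1) / \<beta>)"
  have less: "?a < ?b" using assms(1) beta_gt_1 by (simp add: divide_strict_right_mono)
  have eq: "beta_map \<beta> y = \<beta> * y - real k" if "y \<in> {?a<..<?b}" for y
  proof -
    have y: "real k < \<beta> * y" "\<beta> * y < real k + 1" "y \<noteq> 1"
      using that beta_gt_1 by (auto simp: field_simps)
    then have "\<lfloor>\<beta> * y\<rfloor> = int k" by (intro floor_unique) auto
    with y(3) show ?thesis by (simp add: beta_map_def frac_def)
  qed
  have "((\<lambda>y. \<beta> * y - real k) \<longlongrightarrow> \<beta> * x - real k) (at x within {?a<..<?b})"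
    by (intro tendsto_intros)
  then have "(beta_map \<beta> \<longlongrightarrow> \<beta> * x - real k) (at x within {?a<..<?b})"
    by (rule Lim_transform_eventually) (use eq in \<open>auto simp: eventually_at_filter\<close>)
  \<comment> \<open>\<open>Lim\<close> names the limit only where it is unique, so the end points
    have to be limit points of the open interval.\<close>
  moreover have "at x within {?a<..<?b} \<noteq> bot"
  proof -
    have "x islimpt {?a<..<?b}"
    proof -
      consider "x = ?a" | "x = ?b" | "x \<in> interior {?a<..<?b}"
        using assms(2) by (force simp: interior_open)
      then show ?thesis
        using islimpt_greaterThanLessThan1[OF less] islimpt_greaterThanLessThan2[OF less]
          interior_limit_point by cases blast+
    qed
    then show ?thesis by (simp add: trivial_limit_within)
  qed
  ultimately show ?thesis unfolding branch_def by (intro tendsto_Lim) auto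
qed

text \<open>This is why \<open>hat_step\<close> can do without the interval of the branch: asking
  for argument and value in [0, 1] is the same condition.\<close>

lemma mem_branch_interval:
  fixes k :: nat
  assumes "real k < \<beta>"
  shows "x \<in> {real k / \<beta>..min 1 ((real k + 1) / \<beta>)} \<longleftrightarrow> x \<in> {0..1} \<and> \<beta> * x - real k \<in> {0..1}"
proof -
  have "0 \<le> x" if "real k \<le> \<beta> * x"
  proof -
    have "0 \<le> \<beta> * x" using that of_nat_0_le_iff order_trans by blast
    then show ?thesis using beta_gt_1 by (simp add: zero_le_mult_iff)
  qed
  then show ?thesis using assms beta_gt_1 by (auto simp: field_simps)
qed

lemma hat_image_beta: "hat_image (beta_map \<beta>) (beta_partition \<beta>) A = {y. \<exists>x\<in>A. hat_step \<beta> x y}"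
proof (intro equalityI subsetI)
  fix y assume "y \<in> hat_image (beta_map \<beta>) (beta_partition \<beta>) A"
  then obtain a b x where "(a, b) \<in> partition_intervals (beta_partition \<beta>)"
    and x: "x \<in> A" "x \<in> {a..b}" "y = branch (beta_map \<beta>) a b x"
    by (auto simp: hat_image_def)
  then obtain k :: nat where k: "real k < \<beta>" "a = real k / \<beta>" "b = min 1 ((real k + 1) / \<beta>)"
    by (auto simp: partition_intervals_beta)
  have "y = \<beta> * x - real k" using branch_beta_map[OF k(1)] x k by simp
  then show "y \<in> {y. \<exists>x\<in>A. hat_step \<beta> x y}"
    using x k mem_branch_interval[OF k(1), of x] by (auto simp: hat_step_def)
next
  fix y assume "y \<in> {y. \<exists>x\<in>A. hat_step \<beta> x y}"
  then obtain x and k :: nat where x: "x \<in> A" "x \<in> {0..1}" "y \<in> {0..1}" "real k < \<beta>"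
    "y = \<beta> * x - real k" by (auto simp: hat_step_def)
  let ?a = "real k / \<beta>" and ?b = "min 1 ((real k + 1) / \<beta>)"
  have mem: "x \<in> {?a..?b}" using x mem_branch_interval[OF x(4), of x] by simp
  have "y = branch (beta_map \<beta>) ?a ?b x" using branch_beta_map[OF x(4) mem] x by simp
  moreover have "(?a, ?b) \<in> partition_intervals (beta_partition \<beta>)"
    using x(4) by (auto simp: partition_intervals_beta)
  ultimately show "y \<in> hat_image (beta_map \<beta>) (beta_partition \<beta>) A"
    unfolding hat_image_def using mem x(1) by blast
qed

lemma hat_preimage_beta: "hat_preimage (beta_map \<beta>) (beta_partition \<beta>) A = {x. \<exists>y\<in>A. hat_step \<beta> x y}"
  by (auto simp: hat_preimage_iff hat_image_beta)

text \<open>The two alternatives are the left and the right limit. A value 0 forces \<beta> x = k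
  and is a right limit; a positive value lies in (0, 1], which fixes k as the ceiling of \<beta> x
  minus 1.\<close>

lemma hat_step_iff:
  "hat_step \<beta> x y \<longleftrightarrow>
    0 < x \<and> x \<le> 1 \<and> y = left_map \<beta> x \<or> 0 \<le> x \<and> x < 1 \<and> y = frac (\<beta> * x)"
proof
  assume "hat_step \<beta> x y"
  then obtain k :: nat where k: "0 \<le> x" "x \<le> 1" "0 \<le> y" "y \<le> 1" "real k < \<beta>" "y = \<beta> * x - real k"
    by (auto simp: hat_step_def)
  show "0 < x \<and> x \<le> 1 \<and> y = left_map \<beta> x \<or> 0 \<le> x \<and> x < 1 \<and> y = frac (\<beta> * x)"
  proof (cases "y = 0")
    case True
    then have "x < 1" using k by (metis eq_iff_diff_eq_0 less_eq_real_def mult.right_neutral order_less_irrefl)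
    moreover have "frac (\<beta> * x) = 0" using True k by (simp add: frac_eq_0_iff)
    ultimately show ?thesis using True k by auto
  next
    case False
    then have "\<lceil>\<beta> * x\<rceil> = int k + 1" using k by (intro ceiling_unique) auto
    moreover have "0 < x" using False k beta_gt_1 by (smt (verit) mult_eq_0_iff of_nat_0_le_iff)
    ultimately show ?thesis using k unfolding left_map_def by auto
  qed
next
  assume "0 < x \<and> x \<le> 1 \<and> y = left_map \<beta> x \<or> 0 \<le> x \<and> x < 1 \<and> y = frac (\<beta> * x)"
  then show "hat_step \<beta> x y"
  proof
    assume x: "0 < x \<and> x \<le> 1 \<and> y = left_map \<beta> x"
    define k where "k = nat (\<lceil>\<beta> * x\<rceil> - 1)"
    have pos: "0 < \<beta> * x" using x beta_gt_1 by simp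
    then have k: "real k = of_int \<lceil>\<beta> * x\<rceil> - 1" unfolding k_def by (simp add: of_nat_nat)
    have "\<beta> * x \<le> \<beta>" using x beta_gt_1 by simp
    then have "real k < \<beta>" unfolding k by linarith
    moreover have "y = \<beta> * x - real k" unfolding k using x by (simp add: left_map_def)
    ultimately show ?thesis
      using x left_map_bounds[of \<beta> x] unfolding hat_step_def by auto
  next
    assume x: "0 \<le> x \<and> x < 1 \<and> y = frac (\<beta> * x)"
    define k where "k = nat \<lfloor>\<beta> * x\<rfloor>"
    have k: "real k = of_int \<lfloor>\<beta> * x\<rfloor>" unfolding k_def using x beta_gt_1 by simp
    have "\<beta> * x < \<beta>" using x beta_gt_1 by simp
    then have "real k < \<beta>" unfolding k by linarith
    moreover have "y = \<beta> * x - real k" unfolding k using x by (simp add: frac_def)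
    ultimately show ?thesis
      using x frac_ge_0[of "\<beta> * x"] frac_lt_1[of "\<beta> * x"] unfolding hat_step_def by auto
  qed
qed

lemma hat_step_left: "0 < x \<Longrightarrow> x \<le> 1 \<Longrightarrow> hat_step \<beta> x (left_map \<beta> x)"
  and hat_step_right: "0 \<le> x \<Longrightarrow> x < 1 \<Longrightarrow> hat_step \<beta> x (frac (\<beta> * x))"
  by (auto simp: hat_step_iff)

section \<open>The set of split points: closure under steps, countability, density\<close>

definition D :: "real set" where
  "D = I1 (beta_map \<beta>) (beta_partition \<beta>)"

text \<open>Serves as the induction rule for \<open>D\<close>.\<close>

lemma D_least:
  assumes "beta_partition \<beta> \<subseteq> A" "A \<subseteq> {0..1}"
    and "\<And>x y. x \<in> A \<Longrightarrow> hat_step \<beta> x y \<Longrightarrow> y \<in> A"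
    and "\<And>x y. y \<in> A \<Longrightarrow> hat_step \<beta> x y \<Longrightarrow> x \<in> A"
  shows "D \<subseteq> A"
proof -
  have "hat_image (beta_map \<beta>) (beta_partition \<beta>) A \<subseteq> A"
    and "hat_preimage (beta_map \<beta>) (beta_partition \<beta>) A \<subseteq> A"
    unfolding hat_image_beta hat_preimage_beta using assms(3,4) by blast+
  with assms(1,2) show ?thesis unfolding D_def I1_def generalized_orbit_def by blast
qed

lemma generalized_orbit_beta_step:
  assumes "hat_step \<beta> x y"
  shows "x \<in> generalized_orbit (beta_map \<beta>) (beta_partition \<beta>) p \<longleftrightarrow>
    y \<in> generalized_orbit (beta_map \<beta>) (beta_partition \<beta>) p"
  unfolding generalized_orbit_def hat_image_beta hat_preimage_beta using assms by blast

lemma D_step_iff: "hat_step \<beta> x y \<Longrightarrow> x \<in> D \<longleftrightarrow> y \<in> D"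
  unfolding D_def I1_def using generalized_orbit_beta_step by blast

lemma beta_partition_subset_D: "beta_partition \<beta> \<subseteq> D"
  unfolding D_def I1_def generalized_orbit_def by blast

lemma D_subset: "D \<subseteq> {0..1}"
  by (rule D_least) (use beta_partition_subset in \<open>auto simp: hat_step_def\<close>)

lemma D_bounds: "x \<in> D \<Longrightarrow> 0 \<le> x" "x \<in> D \<Longrightarrow> x \<le> 1"
  using D_subset by auto

lemma zero_in_D: "0 \<in> D" and one_in_D: "1 \<in> D"
  using beta_partition_subset_D beta_gt_1 by (auto simp: mem_beta_partition intro: exI[of _ 0])

lemma left_map_in_D_iff: "0 < x \<Longrightarrow> x \<le> 1 \<Longrightarrow> left_map \<beta> x \<in> D \<longleftrightarrow> x \<in> D"
  using D_step_iff hat_step_left by blast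

lemma frac_in_D_iff: "0 \<le> x \<Longrightarrow> x < 1 \<Longrightarrow> frac (\<beta> * x) \<in> D \<longleftrightarrow> x \<in> D"
  using D_step_iff hat_step_right by blast

text \<open>A step \<beta> x - k and its inverse (y + k) / \<beta> both stay in the ring. The
  inclusion gives the countability of \<open>D\<close> and later confines the integrals of
  continuous functions.\<close>

lemma D_subset_laurent_ring: "D \<subseteq> laurent_ring \<beta>"
proof -
  have "D \<subseteq> laurent_ring \<beta> \<inter> {0..1}"
  proof (rule D_least)
    show "beta_partition \<beta> \<subseteq> laurent_ring \<beta> \<inter> {0..1}"
    proof
      fix x assume x: "x \<in> beta_partition \<beta>"
      then have "x \<in> laurent_ring \<beta>"
        using laurent_ring_of_int[of 1] laurent_ring_of_int_powi[of "int k" \<beta> "-1" for k]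
        by (auto simp: mem_beta_partition power_int_minus field_simps)
      with x show "x \<in> laurent_ring \<beta> \<inter> {0..1}" using beta_partition_subset by auto
    qed
    fix x y assume step: "hat_step \<beta> x y"
    then obtain k :: nat where y: "y = \<beta> * x - real k" "x \<in> {0..1}" "y \<in> {0..1}"
      by (auto simp: hat_step_def)
    { assume "x \<in> laurent_ring \<beta> \<inter> {0..1}"
      then have "x * \<beta> powi 1 + of_int (- int k) \<in> laurent_ring \<beta>"
        using beta_gt_1 by (intro laurent_ring_add laurent_ring_mult_powi laurent_ring_of_int) auto
      then show "y \<in> laurent_ring \<beta> \<inter> {0..1}" using y by (simp add: mult.commute) }
    { assume "y \<in> laurent_ring \<beta> \<inter> {0..1}"
      then have "(y + of_int (int k)) * \<beta> powi (-1) \<in> laurent_ring \<beta>"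
        using beta_gt_1 by (intro laurent_ring_add laurent_ring_mult_powi laurent_ring_of_int) auto
      then show "x \<in> laurent_ring \<beta> \<inter> {0..1}"
        using y beta_gt_1 by (simp add: power_int_minus field_simps) }
  qed auto
  then show ?thesis by blast
qed

lemma countable_D: "countable D"
  using D_subset_laurent_ring countable_laurent_ring by (rule countable_subset)

text \<open>A gap of \<open>D\<close> contains no partition point, so the map expands it to a longer gap.\<close>

lemma gap_D_bound:
  assumes "0 \<le> a" "a < b" "b \<le> 1" "{a<..<b} \<inter> D = {}"
  shows "\<beta> ^ n * (b - a) \<le> 1"
  using assms
proof (induction n arbitrary: a b)
  case 0
  then show ?case by simp
next
  case (Suc n)
  define k where "k = nat \<lfloor>\<beta> * a\<rfloor>"
  have k: "real k = of_int \<lfloor>\<beta> * a\<rfloor>" unfolding k_def using Suc.prems beta_gt_1 by simp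
  have a: "0 \<le> \<beta> * a - real k" "\<beta> * a < real k + 1" unfolding k by linarith+
  \<comment> \<open>Otherwise (k + 1) / \<beta> would be a partition point inside the gap; so the
    whole gap lies on branch k.\<close>
  have b: "\<beta> * b \<le> real k + 1"
  proof (rule ccontr)
    assume "\<not> ?thesis"
    then have less: "(real k + 1) / \<beta> < b" "a < (real k + 1) / \<beta>"
      using a beta_gt_1 by (auto simp: field_simps)
    then have "(real k + 1) / \<beta> < 1" using Suc.prems by simp
    then have "(real k + 1) / \<beta> \<in> D"
      using beta_partition_subset_D beta_gt_1
      by (auto simp: mem_beta_partition add.commute field_simps intro!: exI[of _ "Suc k"] subsetD[OF beta_partition_subset_D])
    with less Suc.prems show False by auto
  qed
  \<comment> \<open>A point of \<open>D\<close> in the image would be carried back along branch k to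
    a point of \<open>D\<close> in the gap.\<close>
  have "{\<beta> * a - real k<..<\<beta> * b - real k} \<inter> D = {}"
  proof (rule ccontr)
    assume "\<not> ?thesis"
    then obtain z where z: "\<beta> * a - real k < z" "z < \<beta> * b - real k" "z \<in> D" by auto
    define y where "y = (z + real k) / \<beta>"
    have y: "a < y" "y < b" using z beta_gt_1 by (auto simp: y_def field_simps)
    have "real k < \<beta>" using a Suc.prems beta_gt_1
      by (smt (verit) mult_less_cancel_left2)
    moreover have "z = \<beta> * y - real k" using beta_gt_1 by (simp add: y_def)
    moreover have "z \<in> {0..1}" using z D_subset by auto
    ultimately have "hat_step \<beta> y z" using y Suc.prems by (auto simp: hat_step_def)
    then have "y \<in> D" using z D_step_iff by blast
    with y Suc.prems show False by auto
  qed
  then have "\<beta> ^ n * ((\<beta> * b - real k) - (\<beta> * a - real k)) \<le> 1"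
    using a b Suc.prems beta_gt_1 by (intro Suc.IH) auto
  then show ?case by (simp add: algebra_simps)
qed

lemma D_dense:
  assumes "0 \<le> a" "a < b" "b \<le> 1"
  obtains d where "d \<in> D" "a < d" "d < b"
proof -
  obtain n where "1 / (b - a) < \<beta> ^ n" using real_arch_pow[OF beta_gt_1] by blast
  then have "\<not> \<beta> ^ n * (b - a) \<le> 1" using assms by (simp add: field_simps)
  then have "{a<..<b} \<inter> D \<noteq> {}" using gap_D_bound[OF assms] by blast
  then show thesis using that by auto
qed

text \<open>An interval is uncountable. This is what makes X_0 dense in X.\<close>

lemma complement_D_dense:
  assumes "a < b"
  obtains x where "x \<notin> D" "a < x" "x < b"
proof -
  have "uncountable {a<..<b}" using assms by (simp add: uncountable_open_interval)
  then have "\<not> {a<..<b} \<subseteq> D" using countable_D countable_subset by blast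
  then show thesis using that by (meson greaterThanLessThan_iff subsetI)
qed

section \<open>The orbit of 1 under left limits\<close>

definition orbit :: "nat \<Rightarrow> real" where
  "orbit n = (left_map \<beta> ^^ n) 1"

lemma orbit_0 [simp]: "orbit 0 = 1" and orbit_Suc: "orbit (Suc n) = left_map \<beta> (orbit n)"
  by (simp_all add: orbit_def)

lemma orbit_bounds: "0 < orbit n" "orbit n \<le> 1"
  using left_map_bounds by (cases n; simp add: orbit_Suc)+

lemma orbit_in_D: "orbit n \<in> D"
  by (induction n) (auto simp: one_in_D orbit_Suc left_map_in_D_iff orbit_bounds)

lemma left_iterate_bounds:
  assumes "0 < x" "x \<le> 1"
  shows "0 < (left_map \<beta> ^^ n) x \<and> (left_map \<beta> ^^ n) x \<le> 1"
  using assms left_map_bounds by (cases n) auto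

text \<open>The points that join the orbit, together with 0, are closed under steps in both
  directions. Right limits matter only where \<beta> x is an integer, and there the left limit is
  already 1.\<close>

lemma D_enters_orbit:
  assumes "x \<in> D" "0 < x"
  shows "\<exists>n j. (left_map \<beta> ^^ n) x = orbit j"
proof -
  \<comment> \<open>The point 0 is added by hand: it is a partition point and a right limit, but no
    left iterate reaches the orbit from it.\<close>
  define A where "A = {x\<in>{0..1}. x = 0 \<or> (\<exists>n j. (left_map \<beta> ^^ n) x = orbit j)}"
  have A_left: "left_map \<beta> x \<in> A \<longleftrightarrow> x \<in> A" if x: "0 < x" "x \<le> 1" for x
  proof
    assume "left_map \<beta> x \<in> A"
    then obtain n j where "(left_map \<beta> ^^ n) (left_map \<beta> x) = orbit j"
      using left_map_bounds[of \<beta> x] by (auto simp: A_def)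
    then have "(left_map \<beta> ^^ Suc n) x = orbit j" by (simp add: funpow_swap1)
    then show "x \<in> A" using x unfolding A_def by fastforce
  next
    assume "x \<in> A"
    then obtain n j where nj: "(left_map \<beta> ^^ n) x = orbit j"
      using x by (auto simp: A_def)
    have "(left_map \<beta> ^^ n) (left_map \<beta> x) = orbit (Suc j)"
      using nj by (metis funpow_swap1 orbit_Suc)
    then show "left_map \<beta> x \<in> A" using left_map_bounds[of \<beta> x] unfolding A_def by fastforce
  qed
  have A_frac: "frac (\<beta> * x) \<in> A \<longleftrightarrow> x \<in> A" if x: "0 \<le> x" "x < 1" for x
  proof (cases "x = 0 \<or> \<beta> * x \<notin> \<int>")
    case True
    then show ?thesis
    proof (cases "x = 0")
      case False
      then have "left_map \<beta> x = frac (\<beta> * x)" using True left_map_eq_frac by blast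
      then show ?thesis using A_left[of x] x False by simp
    qed (simp add: A_def)
  next
    case False
    \<comment> \<open>The left limit is 1 and the right limit is 0, and both lie in
      \<open>A\<close>; hence so does x, by way of its left limit.\<close>
    then have left: "left_map \<beta> x = 1" and frac: "frac (\<beta> * x) = 0"
      using left_map_Ints by (auto simp: frac_eq_0_iff)
    have "1 \<in> A" "0 \<in> A" unfolding A_def by (auto intro!: exI[of _ 0])
    then show ?thesis unfolding frac using A_left[of x] left False x by simp
  qed
  have A_step: "x \<in> A \<longleftrightarrow> y \<in> A" if "hat_step \<beta> x y" for x y
    using that A_left[of x] A_frac[of x] unfolding hat_step_iff by metis
  have "D \<subseteq> A"
  proof (rule D_least)
    show "beta_partition \<beta> \<subseteq> A"
    proof
      fix x assume x: "x \<in> beta_partition \<beta>"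
      show "x \<in> A"
      proof (cases "x = 0 \<or> x = 1")
        case True
        then show ?thesis unfolding A_def by (auto intro!: exI[of _ 0])
      next
        case False
        with x obtain k :: nat where "x = real k / \<beta>" by (auto simp: mem_beta_partition)
        then have "\<beta> * x \<in> \<int>" using beta_gt_1 by simp
        then have "frac (\<beta> * x) = 0" by (simp add: frac_eq_0_iff)
        then have "frac (\<beta> * x) \<in> A" by (simp only:) (simp add: A_def)
        moreover have "0 \<le> x" "x < 1" using False x beta_partition_subset by force+
        ultimately show ?thesis using A_frac by blast
      qed
    qed
    show "A \<subseteq> {0..1}" by (auto simp: A_def)
  qed (use A_step in blast)+
  with assms show ?thesis by (auto simp: A_def)
qed

lemma beta_map_one: "beta_map \<beta> 1 = left_map \<beta> 1"
proof -
  \<comment> \<open>This is the floor of \<beta> y for all y just below 1, also when \<beta> is an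
    integer.\<close>
  define k where "k = \<lceil>\<beta>\<rceil> - 1"
  have k: "of_int k < \<beta>" "\<beta> \<le> of_int k + 1" unfolding k_def by linarith+
  have ev: "eventually (\<lambda>y. \<beta> * y - of_int k = frac (\<beta> * y)) (at_left 1)"
    unfolding eventually_at_left_field
  proof (intro exI[of _ "of_int k / \<beta>"] conjI allI impI)
    show "of_int k / \<beta> < 1" using k beta_gt_1 by simp
    fix y assume y: "of_int k / \<beta> < y" "y < 1"
    have "of_int k < \<beta> * y" using y(1) beta_gt_1 by (simp add: field_simps)
    moreover have "\<beta> * y < of_int k + 1" using y(2) k beta_gt_1
      by (smt (verit) mult_less_cancel_left2)
    ultimately have "\<lfloor>\<beta> * y\<rfloor> = k" by (intro floor_unique) auto
    then show "\<beta> * y - of_int k = frac (\<beta> * y)" by (simp add: frac_def)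
  qed
  have "((\<lambda>y. \<beta> * y - of_int k) \<longlongrightarrow> \<beta> * 1 - of_int k) (at_left 1)"
    by (intro tendsto_intros)
  then have "((\<lambda>y. frac (\<beta> * y)) \<longlongrightarrow> \<beta> * 1 - of_int k) (at_left 1)"
    by (rule Lim_transform_eventually) (rule ev)
  then have "Lim (at_left 1) (\<lambda>y. frac (\<beta> * y)) = \<beta> * 1 - of_int k"
    by (intro tendsto_Lim) auto
  then show ?thesis by (simp add: beta_map_def left_map_def k_def)
qed

text \<open>Where the orbit of \<open>1\<close> under \<open>beta_map\<close> hits \<open>0\<close>, the orbit of left limits returns to \<open>1\<close>.\<close>

lemma finite_range_orbit:
  assumes "eventually_periodic (beta_map \<beta>) 1"
  shows "finite (range orbit)"
proof (cases "\<exists>m\<ge>1. orbit m = 1")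
  case True
  then obtain m where m: "1 \<le> m" "orbit m = 1" by blast
  have "orbit n \<in> orbit ` {..<m}" for n
  proof (induction n)
    case 0
    then show ?case using m by (intro image_eqI[of _ _ 0]) auto
  next
    case (Suc n)
    then obtain i where i: "orbit n = orbit i" "i < m" by auto
    then have eq: "orbit (Suc n) = orbit (Suc i)" by (simp add: orbit_Suc)
    show ?case
    proof (cases "Suc i = m")
      case True
      then have "orbit (Suc n) = orbit 0" using eq m by simp
      then show ?thesis using m by (intro image_eqI[of _ _ 0]) auto
    next
      case False
      with i eq show ?thesis by (intro image_eqI[of _ _ "Suc i"]) auto
    qed
  qed
  then have "range orbit \<subseteq> orbit ` {..<m}" by blast
  then show ?thesis by (rule finite_subset) auto
next
  case False
  \<comment> \<open>Without a return to 1, the product of \<beta> with an orbit point is never an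
    integer, so left limit and value never differ along the orbit.\<close>
  have "(beta_map \<beta> ^^ n) 1 = orbit n" for n
  proof (induction n)
    case 0
    then show ?case by simp
  next
    case (Suc n)
    show ?case
    proof (cases "orbit n = 1")
      case True
      then show ?thesis using Suc by (simp add: orbit_Suc beta_map_one)
    next
      case ne: False
      have "orbit (Suc n) \<noteq> 1" using False by auto
      then have "\<beta> * orbit n \<notin> \<int>" using left_map_Ints by (auto simp: orbit_Suc)
      then show ?thesis using Suc ne by (simp add: orbit_Suc left_map_eq_frac beta_map_def)
    qed
  qed
  then show ?thesis using assms by (simp add: eventually_periodic_def)
qed

end


section \<open>Continuous integer-valued functions\<close>

lemma C_int_iff:
  "f \<in> C_int X \<longleftrightarrow>
    (\<forall>n. openin X {x \<in> topspace X. f x = n}) \<and> (\<forall>x. x \<notin> topspace X \<longrightarrow> f x = 0)"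
proof -
  have "continuous_map X (discrete_topology UNIV) f \<longleftrightarrow> (\<forall>n. openin X {x \<in> topspace X. f x = n})"
  proof
    assume "continuous_map X (discrete_topology UNIV) f"
    then show "\<forall>n. openin X {x \<in> topspace X. f x = n}"
      using openin_continuous_map_preimage[of X "discrete_topology UNIV" f "{n}" for n] by auto
  next
    assume op: "\<forall>n. openin X {x \<in> topspace X. f x = n}"
    have "{x \<in> topspace X. f x \<in> U} = (\<Union>n\<in>U. {x \<in> topspace X. f x = n})" for U by auto
    with op show "continuous_map X (discrete_topology UNIV) f"
      by (auto simp: continuous_map_def intro!: openin_Union)
  qed
  then show ?thesis by (simp add: C_int_def)
qed

lemma C_int_zero: "(\<lambda>x. 0) \<in> C_int X"
  by (simp add: C_int_def)

lemma C_int_indicator: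
  assumes "openin X S" "openin X (topspace X - S)"
  shows "indicator S \<in> C_int X"
proof -
  have S: "S \<subseteq> topspace X" using assms(1) by (rule openin_subset)
  have "{x \<in> topspace X. indicator S x = n} =
      (if n = 1 then S else if n = 0 then topspace X - S else {})" for n :: int
    using S by (auto simp: indicator_def)
  then show ?thesis using assms S by (auto simp: C_int_iff indicator_def)
qed

lemma C_int_add:
  assumes "f \<in> C_int X" "g \<in> C_int X"
  shows "(\<lambda>x. f x + g x) \<in> C_int X"
proof -
  have "{x \<in> topspace X. f x + g x = n} =
      (\<Union>m. {x \<in> topspace X. f x = m} \<inter> {x \<in> topspace X. g x = n - m})" for n
    by auto
  then show ?thesis using assms by (auto simp: C_int_iff intro!: openin_Union openin_Int)
qed

lemma C_int_scale:
  assumes "f \<in> C_int X"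
  shows "(\<lambda>x. c * f x) \<in> C_int X"
proof -
  have "{x \<in> topspace X. c * f x = n} = (\<Union>m\<in>{m. c * m = n}. {x \<in> topspace X. f x = m})" for n
    by auto
  then show ?thesis using assms by (auto simp: C_int_iff intro!: openin_Union)
qed

section \<open>The split interval\<close>

context beta_transformation
begin

definition X :: "(real \<times> int) topology" where
  "X = split_interval (beta_map \<beta>) (beta_partition \<beta>)"

text \<open>The end points carry no sign in \<open>X\<close>; \<open>side\<close> regards them as \<open>0\<^sup>+\<close> and \<open>1\<^sup>-\<close>, which makes
  them behave like all other points of \<open>D\<close>.\<close>

definition side :: "real \<times> int \<Rightarrow> int" where
  "side u = (if fst u = 0 then 1 else if fst u = 1 then - 1 else snd u)"

definition pt :: "real \<Rightarrow> int \<Rightarrow> real \<times> int" where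
  "pt y e = (y, if y = 0 \<or> y = 1 then 0 else e)"

text \<open>The admissible pairs, that is, the values of \<open>(fst u, side u)\<close> for points u
  of X; \<open>pt\<close> turns such a pair back into its point.\<close>

definition valid :: "real \<Rightarrow> int \<Rightarrow> bool" where
  "valid y e \<longleftrightarrow> 0 \<le> y \<and> y \<le> 1 \<and>
    (y \<notin> D \<and> e = 0 \<or> y \<in> D \<and> y < 1 \<and> e = 1 \<or> y \<in> D \<and> 0 < y \<and> e = - 1)"

text \<open>The initial segment ending at x^-. Since 1 has side -1 and 0 has side 1, it is all of X
  for x = 1 and empty for x = 0.\<close>

definition cut :: "real \<Rightarrow> (real \<times> int) set" where
  "cut x = {u \<in> topspace X. fst u < x \<or> fst u = x \<and> side u < 0}"

definition cut_fun :: "real \<Rightarrow> real \<times> int \<Rightarrow> int" where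
  "cut_fun x = indicator (cut x)"

lemma topspace_X: "topspace X = split_points (beta_map \<beta>) (beta_partition \<beta>)"
  unfolding X_def split_interval_def by auto

lemma mem_X_iff: "u \<in> topspace X \<longleftrightarrow> 0 \<le> fst u \<and> fst u \<le> 1 \<and>
    (if fst u \<in> D - {0, 1} then snd u = - 1 \<or> snd u = 1 else snd u = 0)"
  unfolding topspace_X split_points_def D_def[symmetric] using D_bounds
  by (cases u) (auto simp: image_iff)

lemma valid_side: "u \<in> topspace X \<Longrightarrow> valid (fst u) (side u)"
  using zero_in_D one_in_D by (auto simp: mem_X_iff valid_def side_def split: if_splits)

lemma pt_side: "u \<in> topspace X \<Longrightarrow> pt (fst u) (side u) = u"
  by (auto simp: mem_X_iff pt_def side_def prod_eq_iff split: if_splits)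

lemma fst_pt [simp]: "fst (pt y e) = y"
  by (simp add: pt_def)

lemma pt_in_X: "valid y e \<Longrightarrow> pt y e \<in> topspace X"
  by (auto simp: mem_X_iff pt_def valid_def)

lemma side_pt: "valid y e \<Longrightarrow> side (pt y e) = e"
  using zero_in_D one_in_D by (auto simp: side_def pt_def valid_def)

lemma X_eqI: "u \<in> topspace X \<Longrightarrow> v \<in> topspace X \<Longrightarrow> fst u = fst v \<Longrightarrow> side u = side v \<Longrightarrow> u = v"
  by (metis pt_side)

lemma X_bounds: "u \<in> topspace X \<Longrightarrow> 0 \<le> fst u" "u \<in> topspace X \<Longrightarrow> fst u \<le> 1"
  by (auto simp: mem_X_iff)

lemma side_zero_iff: "u \<in> topspace X \<Longrightarrow> side u = 0 \<longleftrightarrow> fst u \<notin> D"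
  using valid_side[of u] by (auto simp: valid_def)

lemma side_neg_iff: "u \<in> topspace X \<Longrightarrow> side u < 0 \<longleftrightarrow> side u = - 1"
  using valid_side[of u] by (auto simp: valid_def)

lemma pt_zero_in_X:
  assumes "y \<notin> D" "0 \<le> y" "y \<le> 1"
  shows "(y, 0) \<in> topspace X"
  using assms by (auto simp: mem_X_iff)

lemma split_less_iff_side:
  assumes "u \<in> topspace X" "v \<in> topspace X"
  shows "split_less u v \<longleftrightarrow> fst u < fst v \<or> fst u = fst v \<and> side u < side v"
  using assms by (auto simp: split_less_def side_def mem_X_iff)

lemma cut_subset: "cut x \<subseteq> topspace X"
  by (auto simp: cut_def)

lemma mem_cut_iff: "u \<in> topspace X \<Longrightarrow> u \<in> cut x \<longleftrightarrow> fst u < x \<or> fst u = x \<and> side u < 0"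
  by (simp add: cut_def)

lemma cut_ge_one: "1 \<le> x \<Longrightarrow> cut x = topspace X"
  using X_bounds by (force simp: cut_def side_def)

lemma cut_zero: "cut 0 = {}"
  using X_bounds by (force simp: cut_def side_def)

lemma cut_Int: "x \<le> y \<Longrightarrow> cut x \<inter> cut y = cut x"
  by (auto simp: cut_def)

lemma openin_lower_ray: "u \<in> topspace X \<Longrightarrow> openin X {v \<in> topspace X. split_less v u}"
  and openin_upper_ray: "u \<in> topspace X \<Longrightarrow> openin X {v \<in> topspace X. split_less u v}"
  unfolding topspace_X by (auto simp: X_def split_interval_def intro!: topology_generated_by_Basis)

text \<open>Nothing lies between x^- and x^+, so the segment is the open ray below x^+ and its
  complement the open ray above x^-.\<close>

lemma clopen_cut:
  assumes "x \<in> D \<or> 1 \<le> x"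
  shows "openin X (cut x) \<and> openin X (topspace X - cut x)"
proof -
  consider "x = 0" | "1 \<le> x" | "x \<in> D" "0 < x" "x < 1"
    using assms D_bounds[of x] by fastforce
  then show ?thesis
  proof cases
    case 3
    have v: "valid x 1" "valid x (-1)" using 3 by (auto simp: valid_def)
    have side_cases: "side u = 1 \<or> side u = - 1" if "u \<in> topspace X" "fst u = x" for u
      using valid_side[OF that(1)] that(2) 3(1) by (auto simp: valid_def)
    have "cut x = {u \<in> topspace X. split_less u (pt x 1)}"
      using v(1) side_cases by (force simp: cut_def split_less_iff_side pt_in_X side_pt)
    moreover have "topspace X - cut x = {u \<in> topspace X. split_less (pt x (-1)) u}"
      using v(2) side_cases by (force simp: cut_def split_less_iff_side pt_in_X side_pt)
    ultimately show ?thesis using openin_lower_ray openin_upper_ray v pt_in_X by metis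
  qed (auto simp: cut_zero cut_ge_one)
qed

text \<open>Points over different reals are separated by the density of \<open>D\<close>; the two
  halves of one point are separated by the cut at that point.\<close>

lemma separating_cut:
  assumes "u \<in> topspace X" "v \<in> topspace X" "split_less u v"
  obtains x where "x \<in> D" "0 < x" "x < 1" "u \<in> cut x" "v \<notin> cut x"
proof (cases "fst u < fst v")
  case True
  then obtain x where "x \<in> D" "fst u < x" "x < fst v"
    using D_dense[of "fst u" "fst v"] assms X_bounds by blast
  moreover have "0 < x" "x < 1" using calculation X_bounds assms by fastforce+
  ultimately show ?thesis using that assms by (simp add: mem_cut_iff)
next
  case False
  then have less: "fst u = fst v" "side u < side v" using assms by (auto simp: split_less_iff_side)
  then have "side u = - 1" "side v = 1" using valid_side[OF assms(1)] valid_side[OF assms(2)]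
    by (auto simp: valid_def)
  then show ?thesis using that[of "fst v"] less assms valid_side[OF assms(1)] valid_side[OF assms(2)]
    by (auto simp: mem_cut_iff valid_def)
qed

lemma split_less_of_cut:
  assumes "u \<in> cut x" "v \<in> topspace X" "v \<notin> cut x"
  shows "split_less u v"
  using assms by (auto simp: cut_def split_less_iff_side)

lemma split_less_linear:
  assumes "u \<in> topspace X" "v \<in> topspace X" "u \<noteq> v"
  shows "split_less u v \<or> split_less v u"
  using assms X_eqI[of u v] split_less_iff_side[of u v] split_less_iff_side[of v u] by linarith

lemma X_generated:
  "X = topology_generated_by (insert (topspace X)
       ((\<lambda>u. {v \<in> topspace X. split_less v u}) ` topspace X \<union>
        (\<lambda>u. {v \<in> topspace X. split_less u v}) ` topspace X))"
  unfolding topspace_X by (simp add: X_def split_interval_def)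

text \<open>By \<open>separating_cut\<close>, lower rays are unions of cuts and upper rays are
  unions of complements of cuts, so continuity can be tested on cuts.\<close>

lemma continuous_map_into_X:
  assumes "f \<in> topspace T \<rightarrow> topspace X"
    and "\<And>x. x \<in> D \<Longrightarrow> 0 < x \<Longrightarrow> x < 1 \<Longrightarrow>
      openin T {t \<in> topspace T. f t \<in> cut x} \<and> openin T {t \<in> topspace T. f t \<notin> cut x}"
  shows "continuous_map T X f"
proof -
  let ?B = "insert (topspace X)
       ((\<lambda>u. {v \<in> topspace X. split_less v u}) ` topspace X \<union>
        (\<lambda>u. {v \<in> topspace X. split_less u v}) ` topspace X)"
  have "continuous_map T (topology_generated_by ?B) f"
  proof (rule continuous_on_generated_topo)
    show "f ` topspace T \<subseteq> \<Union> ?B" using assms(1) by auto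
    fix U assume "U \<in> ?B"
    then consider "U = topspace X"
      | u where "u \<in> topspace X" "U = {v \<in> topspace X. split_less v u}"
      | u where "u \<in> topspace X" "U = {v \<in> topspace X. split_less u v}" by blast
    then show "openin T (f -` U \<inter> topspace T)"
    proof cases
      case 1
      then have "f -` U \<inter> topspace T = topspace T" using assms(1) by auto
      then show ?thesis by simp
    next
      case (2 u)
      have "f -` U \<inter> topspace T =
          (\<Union>x\<in>{x \<in> D. 0 < x \<and> x < 1 \<and> u \<notin> cut x}. {t \<in> topspace T. f t \<in> cut x})"
        (is "_ = ?R")
      proof (intro equalityI subsetI)
        fix t assume "t \<in> f -` U \<inter> topspace T"
        then show "t \<in> ?R" using 2 separating_cut[of "f t" u] by auto
      next
        fix t assume "t \<in> ?R"
        then show "t \<in> f -` U \<inter> topspace T" using 2 split_less_of_cut[of "f t" _ u] cut_subset by auto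
      qed
      then show ?thesis using assms(2) by (auto intro!: openin_Union)
    next
      case (3 u)
      have "f -` U \<inter> topspace T =
          (\<Union>x\<in>{x \<in> D. 0 < x \<and> x < 1 \<and> u \<in> cut x}. {t \<in> topspace T. f t \<notin> cut x})"
        (is "_ = ?R")
      proof (intro equalityI subsetI)
        fix t assume "t \<in> f -` U \<inter> topspace T"
        then show "t \<in> ?R" using 3 separating_cut[of u "f t"] by auto
      next
        fix t assume "t \<in> ?R"
        then show "t \<in> f -` U \<inter> topspace T"
          using 3 assms(1) split_less_of_cut[of u _ "f t"] by auto
      qed
      then show ?thesis using assms(2) by (auto intro!: openin_Union)
    qed
  qed
  then show ?thesis by (simp only: X_generated[symmetric])
qed

text \<open>A neighbourhood on the side that u faces: the last condition keeps points to the right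
  for side 1, to the left for side -1, and on both sides for an unsplit point. The middle condition
  removes the other half of u.\<close>

definition nbhd :: "real \<times> int \<Rightarrow> real \<Rightarrow> (real \<times> int) set" where
  "nbhd u \<epsilon> = {v \<in> topspace X. \<bar>fst v - fst u\<bar> < \<epsilon> \<and> (fst v = fst u \<longrightarrow> v = u) \<and>
    0 \<le> side u * (fst v - fst u)}"

lemma nbhd_mono: "\<delta> \<le> \<epsilon> \<Longrightarrow> nbhd u \<delta> \<subseteq> nbhd u \<epsilon>"
  by (auto simp: nbhd_def)

lemma nbhd_lower_ray:
  assumes "u \<in> topspace X" "w \<in> topspace X" "split_less u w"
  shows "\<exists>\<epsilon>>0. nbhd u \<epsilon> \<subseteq> {v \<in> topspace X. split_less v w}"
proof (cases "fst u < fst w")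
  case True
  then show ?thesis using assms(2)
    by (intro exI[of _ "fst w - fst u"]) (auto simp: split_less_iff_side nbhd_def)
next
  case False
  \<comment> \<open>Now u and w are the halves x^- and x^+ of one point; a neighbourhood of u faces
    left and avoids w whatever its radius, so 1 will do.\<close>
  then have eq: "fst u = fst w" "side u < side w" using assms by (auto simp: split_less_iff_side)
  then have "side u = - 1"
    using valid_side[OF assms(1)] valid_side[OF assms(2)] by (auto simp: valid_def)
  then have "fst v < fst w \<or> v = u" if "v \<in> nbhd u 1" for v
    using that eq(1) by (auto simp: nbhd_def less_le)
  moreover have "nbhd u 1 \<subseteq> topspace X" by (auto simp: nbhd_def)
  ultimately have "nbhd u 1 \<subseteq> {v \<in> topspace X. split_less v w}"
    using assms(2,3) split_less_iff_side by blast
  then show ?thesis by (intro exI[of _ 1]) simp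
qed

lemma nbhd_upper_ray:
  assumes "u \<in> topspace X" "w \<in> topspace X" "split_less w u"
  shows "\<exists>\<epsilon>>0. nbhd u \<epsilon> \<subseteq> {v \<in> topspace X. split_less w v}"
proof (cases "fst w < fst u")
  case True
  then show ?thesis using assms(2)
    by (intro exI[of _ "fst u - fst w"]) (auto simp: split_less_iff_side nbhd_def)
next
  case False
  then have eq: "fst u = fst w" "side w < side u" using assms by (auto simp: split_less_iff_side)
  then have "side u = 1"
    using valid_side[OF assms(1)] valid_side[OF assms(2)] by (auto simp: valid_def)
  then have "fst w < fst v \<or> v = u" if "v \<in> nbhd u 1" for v
    using that eq(1) by (auto simp: nbhd_def less_le)
  moreover have "nbhd u 1 \<subseteq> topspace X" by (auto simp: nbhd_def)
  ultimately have "nbhd u 1 \<subseteq> {v \<in> topspace X. split_less w v}"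
    using assms(2,3) split_less_iff_side by blast
  then show ?thesis by (intro exI[of _ 1]) simp
qed

lemma open_nbhd:
  assumes "openin X U" "u \<in> U"
  shows "\<exists>\<epsilon>>0. nbhd u \<epsilon> \<subseteq> U"
proof -
  have "generate_topology_on (insert (topspace X)
       ((\<lambda>u. {v \<in> topspace X. split_less v u}) ` topspace X \<union>
        (\<lambda>u. {v \<in> topspace X. split_less u v}) ` topspace X)) U"
    using assms(1) by (intro openin_topology_generated_by) (simp only: X_generated[symmetric])
  then have "\<forall>u\<in>U. \<exists>\<epsilon>>0. nbhd u \<epsilon> \<subseteq> U"
  proof (induction rule: generate_topology_on.induct)
    case Empty
    then show ?case by simp
  next
    case (Int A B)
    show ?case
    proof
      fix u assume "u \<in> A \<inter> B"
      then obtain \<epsilon> \<delta> where "\<epsilon> > 0" "nbhd u \<epsilon> \<subseteq> A" "\<delta> > 0" "nbhd u \<delta> \<subseteq> B"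
        using Int.IH by blast
      then show "\<exists>\<epsilon>>0. nbhd u \<epsilon> \<subseteq> A \<inter> B"
        using nbhd_mono[of "min \<epsilon> \<delta>" \<epsilon> u] nbhd_mono[of "min \<epsilon> \<delta>" \<delta> u]
        by (intro exI[of _ "min \<epsilon> \<delta>"]) auto
    qed
  next
    case (UN K)
    show ?case
    proof
      fix u assume "u \<in> \<Union>K"
      then obtain A where "A \<in> K" "u \<in> A" by blast
      with UN.IH[of A] show "\<exists>\<epsilon>>0. nbhd u \<epsilon> \<subseteq> \<Union>K" by blast
    qed
  next
    case (Basis S)
    then consider "S = topspace X"
      | w where "w \<in> topspace X" "S = {v \<in> topspace X. split_less v w}"
      | w where "w \<in> topspace X" "S = {v \<in> topspace X. split_less w v}" by blast
    then show ?case
    proof cases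
      case 1
      then show ?thesis by (auto simp: nbhd_def intro: exI[of _ 1])
    next
      case (2 w)
      then show ?thesis using nbhd_lower_ray by simp
    next
      case (3 w)
      then show ?thesis using nbhd_upper_ray by simp
    qed
  qed
  then show ?thesis using assms(2) by blast
qed

text \<open>The interval lies on the side that the chosen point u faces and need not have u above
  it. From here come the density of X_0 and the strict positivity of the integral.\<close>

lemma open_contains_interval:
  assumes "openin X U" "u \<in> U"
  obtains a b where "0 \<le> a" "a < b" "b \<le> 1" "\<And>v. v \<in> topspace X \<Longrightarrow> a < fst v \<Longrightarrow> fst v < b \<Longrightarrow> v \<in> U"
proof -
  have u: "u \<in> topspace X" using assms openin_subset by blast
  obtain \<epsilon> where e: "\<epsilon> > 0" "nbhd u \<epsilon> \<subseteq> U"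
    using open_nbhd[OF assms] by blast
  show thesis
  proof (cases "side u = - 1")
    case True
    then have "0 < fst u" "fst u \<le> 1" using valid_side[OF u] by (auto simp: valid_def)
    moreover have "v \<in> U" if "v \<in> topspace X" "max 0 (fst u - \<epsilon>) < fst v" "fst v < fst u" for v
      using e(2) that True by (auto simp: nbhd_def)
    ultimately show thesis using e(1) by (intro that[of "max 0 (fst u - \<epsilon>)" "fst u"]) auto
  next
    case False
    then have s: "0 \<le> fst u" "fst u < 1" "0 \<le> side u"
      using valid_side[OF u] one_in_D by (auto simp: valid_def less_le)
    moreover have "v \<in> U" if "v \<in> topspace X" "fst u < fst v" "fst v < min 1 (fst u + \<epsilon>)" for v
      using e(2) that s(3) by (auto simp: nbhd_def)
    ultimately show thesis using e(1) by (intro that[of "fst u" "min 1 (fst u + \<epsilon>)"]) auto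
  qed
qed

lemma open_meets_X0:
  assumes "openin X U" "U \<noteq> {}"
  obtains y where "y \<notin> D" "0 \<le> y" "y \<le> 1" "(y, 0) \<in> U"
proof -
  obtain u where "u \<in> U" using assms by blast
  then obtain a b where ab: "0 \<le> a" "a < b" "b \<le> 1"
      "\<And>v. v \<in> topspace X \<Longrightarrow> a < fst v \<Longrightarrow> fst v < b \<Longrightarrow> v \<in> U"
    using open_contains_interval[OF assms(1)] by metis
  obtain y where "y \<notin> D" "a < y" "y < b" using complement_D_dense[OF ab(2)] by blast
  moreover from this have "0 \<le> y" "y \<le> 1" using ab by auto
  ultimately show thesis using that[of y] ab(4) pt_zero_in_X by simp
qed

section \<open>The local homeomorphism\<close>

definition side_map :: "real \<Rightarrow> int \<Rightarrow> real" where
  "side_map y e = (if e < 0 then left_map \<beta> y else frac (\<beta> * y))"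

text \<open>All branches are increasing, so the side of a point is kept; it also selects the left or
  the right limit.\<close>

definition sigma :: "real \<times> int \<Rightarrow> real \<times> int" where
  "sigma = (\<lambda>u\<in>topspace X. pt (side_map (fst u) (side u)) (side u))"

lemma sigma_extensional: "sigma \<in> extensional (topspace X)"
  unfolding sigma_def by (rule restrict_extensional)

lemma valid_side_map:
  assumes "valid y e"
  shows "valid (side_map y e) e"
proof (cases "e < 0")
  case True
  then have "y \<in> D" "0 < y" "y \<le> 1" "e = - 1" using assms by (auto simp: valid_def)
  then show ?thesis using left_map_bounds[of \<beta> y] left_map_in_D_iff[of y]
    by (simp add: valid_def side_map_def)
next
  case False
  then have y: "0 \<le> y" "y < 1" using assms one_in_D by (auto simp: valid_def less_le)
  have "valid t e" if "0 \<le> t" "t < 1" "t \<in> D \<longleftrightarrow> y \<in> D" for t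
    using that assms False by (auto simp: valid_def)
  from this[of "frac (\<beta> * y)"] show ?thesis
    using frac_ge_0[of "\<beta> * y"] frac_lt_1[of "\<beta> * y"] frac_in_D_iff[OF y] False
    by (simp add: side_map_def)
qed

lemma sigma_props:
  assumes "u \<in> topspace X"
  shows "sigma u \<in> topspace X" "fst (sigma u) = side_map (fst u) (side u)" "side (sigma u) = side u"
  using valid_side_map[OF valid_side[OF assms]] assms
  by (auto simp: sigma_def pt_in_X side_pt)

lemma hat_step_side_map:
  assumes "valid y e"
  shows "hat_step \<beta> y (side_map y e)"
proof (cases "e < 0")
  case True
  then show ?thesis using assms hat_step_left[of y] by (auto simp: valid_def side_map_def)
next
  case False
  then have "0 \<le> y" "y < 1" using assms one_in_D by (auto simp: valid_def order.strict_iff_order)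
  then show ?thesis using False hat_step_right[of y] by (simp add: side_map_def)
qed

text \<open>A left limit lies in (0, 1] and a right limit in [0, 1); these half-open ranges
  determine the branch.\<close>

lemma side_map_eqI:
  assumes "\<beta> * y - real k = t" "0 \<le> t" "t \<le> 1" "e < 0 \<Longrightarrow> 0 < t" "0 \<le> e \<Longrightarrow> t < 1"
  shows "side_map y e = t"
proof (cases "e < 0")
  case True
  then have "\<lceil>\<beta> * y\<rceil> = int k + 1" using assms by (intro ceiling_unique) auto
  then show ?thesis using True assms by (simp add: side_map_def left_map_def)
next
  case False
  then have "\<lfloor>\<beta> * y\<rfloor> = int k" using assms by (intro floor_unique) auto
  then show ?thesis using False assms by (simp add: side_map_def frac_def)
qed

lemma inverse_branch_in_D:
  assumes "x \<in> D" "real k < \<beta>" "(x + real k) / \<beta> \<le> 1"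
  shows "(x + real k) / \<beta> \<in> D"
proof -
  have "hat_step \<beta> ((x + real k) / \<beta>) x"
    using assms beta_gt_1 D_bounds[of x] by (auto simp: hat_step_def intro!: exI[of _ k])
  then show ?thesis using D_step_iff assms(1) by blast
qed

text \<open>On branch k the preimage of the segment up to x runs from k / \<beta> to (x + k) /
  \<beta>. The form \<open>0 + real k\<close> presents both ends as inverse branch points, of 0 and
  of x. An end beyond 1 gives all of X, so the incomplete last branch is no special case.\<close>

lemma sigma_preimage_cut:
  assumes "x \<in> D" "0 < x" "x < 1"
  shows "{u \<in> topspace X. sigma u \<in> cut x} =
    (\<Union>k\<in>{k. real k < \<beta>}. cut ((x + real k) / \<beta>) - cut ((0 + real k) / \<beta>))"
proof (intro equalityI subsetI)
  fix u assume "u \<in> {u \<in> topspace X. sigma u \<in> cut x}"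
  then have u: "u \<in> topspace X" and sx: "sigma u \<in> cut x" by auto
  let ?y = "fst u" and ?e = "side u"
  define t where "t = side_map ?y ?e"
  obtain k :: nat where k: "real k < \<beta>" "t = \<beta> * ?y - real k"
    using hat_step_side_map[OF valid_side[OF u]] by (auto simp: hat_step_def t_def)
  have "t < x \<or> t = x \<and> ?e < 0" using sx sigma_props[OF u] by (auto simp: mem_cut_iff t_def)
  then have "u \<in> cut ((x + real k) / \<beta>)"
    using u beta_gt_1 unfolding k(2) by (auto simp: mem_cut_iff field_simps)
  moreover have "u \<notin> cut ((0 + real k) / \<beta>)"
  proof -
    have "0 \<le> t" "?e < 0 \<Longrightarrow> 0 < t"
      using left_map_bounds[of \<beta> ?y] by (auto simp: side_map_def t_def)
    then show ?thesis using u beta_gt_1 unfolding k(2) by (auto simp: mem_cut_iff field_simps)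
  qed
  ultimately show "u \<in> (\<Union>k\<in>{k. real k < \<beta>}. cut ((x + real k) / \<beta>) - cut ((0 + real k) / \<beta>))"
    using k(1) by blast
next
  fix u assume "u \<in> (\<Union>k\<in>{k. real k < \<beta>}. cut ((x + real k) / \<beta>) - cut ((0 + real k) / \<beta>))"
  then obtain k :: nat where k: "real k < \<beta>" "u \<in> cut ((x + real k) / \<beta>)" "u \<notin> cut ((0 + real k) / \<beta>)"
    by blast
  have u: "u \<in> topspace X" using k cut_subset by blast
  let ?t = "\<beta> * fst u - real k"
  have t: "?t < x \<or> ?t = x \<and> side u < 0" "0 < ?t \<or> ?t = 0 \<and> \<not> side u < 0"
    using k(2,3) u beta_gt_1 by (auto simp: mem_cut_iff field_simps)
  then have "side_map (fst u) (side u) = ?t"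
    using assms by (intro side_map_eqI[OF refl]) auto
  then show "u \<in> {u \<in> topspace X. sigma u \<in> cut x}"
    using u t sigma_props[OF u] by (auto simp: mem_cut_iff)
qed

lemma finite_digits: "finite {k::nat. real k < \<beta>}"
proof -
  have "{k::nat. real k < \<beta>} \<subseteq> {..nat \<lceil>\<beta>\<rceil>}" by (auto simp: le_nat_iff) linarith
  then show ?thesis by (rule finite_subset) simp
qed

lemma continuous_sigma: "continuous_map X X sigma"
proof (rule continuous_map_into_X)
  show "sigma \<in> topspace X \<rightarrow> topspace X" using sigma_props by auto
  fix x assume x: "x \<in> D" "0 < x" "x < 1"
  let ?A = "\<lambda>k::nat. cut ((x + real k) / \<beta>) - cut ((0 + real k) / \<beta>)"
  have clopen: "openin X (cut ((z + real k) / \<beta>)) \<and> openin X (topspace X - cut ((z + real k) / \<beta>))"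
    if "z \<in> D" "real k < \<beta>" for z k
    using clopen_cut inverse_branch_in_D[OF that] by (meson le_cases)
  have A: "openin X (?A k)" "closedin X (?A k)" if k: "real k < \<beta>" for k
  proof -
    have "?A k = cut ((x + real k) / \<beta>) \<inter> (topspace X - cut ((0 + real k) / \<beta>))"
      using cut_subset by auto
    then show "openin X (?A k)" using clopen[OF x(1) k] clopen[OF zero_in_D k] by auto
    show "closedin X (?A k)"
      using clopen[OF x(1) k] clopen[OF zero_in_D k] cut_subset
      by (intro closedin_diff) (auto simp: closedin_def)
  qed
  have "openin X {u \<in> topspace X. sigma u \<in> cut x}"
    unfolding sigma_preimage_cut[OF x] using A(1) by (intro openin_Union) auto
  moreover have "closedin X {u \<in> topspace X. sigma u \<in> cut x}"
    unfolding sigma_preimage_cut[OF x] using A(2) finite_digits by (intro closedin_Union) auto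
  moreover have "topspace X - {u \<in> topspace X. sigma u \<in> cut x} = {u \<in> topspace X. sigma u \<notin> cut x}"
    by auto
  ultimately show "openin X {u \<in> topspace X. sigma u \<in> cut x} \<and> openin X {u \<in> topspace X. sigma u \<notin> cut x}"
    by (auto simp: closedin_def)
qed

lemma split_X0_iff:
  "u \<in> split_X0 (beta_map \<beta>) (beta_partition \<beta>) \<longleftrightarrow> fst u \<notin> D \<and> 0 \<le> fst u \<and> fst u \<le> 1 \<and> snd u = 0"
  unfolding split_X0_def topspace_X[symmetric] I0_def D_def[symmetric]
  by (auto simp: mem_X_iff)

lemma sigma_X0:
  assumes "y \<notin> D" "0 \<le> y" "y \<le> 1"
  shows "fst (sigma (y, 0)) = beta_map \<beta> y"
proof -
  have "y \<noteq> 0" "y \<noteq> 1" using assms zero_in_D one_in_D by auto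
  then show ?thesis using sigma_props(2)[OF pt_zero_in_X[OF assms]]
    by (simp add: side_map_def side_def beta_map_def)
qed

lemma beta_map_X0:
  assumes "y \<notin> D" "0 \<le> y" "y \<le> 1"
  shows "beta_map \<beta> y \<notin> D"
proof -
  have "y \<noteq> 1" using assms one_in_D by auto
  then show ?thesis using assms frac_in_D_iff[of y] by (simp add: beta_map_def)
qed

text \<open>Two continuous lifts agree on the dense set \<open>X\<^sub>0\<close>, hence everywhere, as cuts separate points.\<close>

lemma local_homeo_eq_sigma: "local_homeo (beta_map \<beta>) (beta_partition \<beta>) = sigma"
  unfolding local_homeo_def X_def[symmetric] topspace_X[symmetric]
proof (rule the_equality)
  show "sigma \<in> extensional (topspace X) \<and> continuous_map X X sigma \<and>
      (\<forall>u\<in>split_X0 (beta_map \<beta>) (beta_partition \<beta>). fst (sigma u) = beta_map \<beta> (fst u))"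
    using continuous_sigma sigma_X0 sigma_extensional by (auto simp: split_X0_iff)
next
  fix s assume "s \<in> extensional (topspace X) \<and> continuous_map X X s \<and>
      (\<forall>u\<in>split_X0 (beta_map \<beta>) (beta_partition \<beta>). fst (s u) = beta_map \<beta> (fst u))"
  then have s: "s \<in> extensional (topspace X)" "continuous_map X X s"
      "\<And>y. y \<notin> D \<Longrightarrow> 0 \<le> y \<Longrightarrow> y \<le> 1 \<Longrightarrow> fst (s (y, 0)) = beta_map \<beta> y"
    by (auto simp: split_X0_iff)
  \<comment> \<open>The image of a point off \<open>D\<close> is again off \<open>D\<close>, and
    only one point of X lies over it, so the projection determines the lift.\<close>
  have eq0: "s (y, 0) = sigma (y, 0)" if y: "y \<notin> D" "0 \<le> y" "y \<le> 1" for y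
  proof -
    note yX = pt_zero_in_X[OF y]
    have sX: "s (y, 0) \<in> topspace X" using s(2) yX by (auto simp: continuous_map_def)
    have fst: "fst (s (y, 0)) = fst (sigma (y, 0))" using s(3)[OF y] sigma_X0[OF y] by simp
    have "fst (s (y, 0)) \<notin> D" using s(3)[OF y] beta_map_X0[OF y] by simp
    then have "side (s (y, 0)) = 0" "side (sigma (y, 0)) = 0"
      using side_zero_iff sX sigma_props(1)[OF yX] fst by auto
    with fst show ?thesis using X_eqI sX sigma_props(1)[OF yX] by simp
  qed
  have no_split: False
    if f: "continuous_map X X f" and g: "continuous_map X X g"
      and eq: "\<And>y. y \<notin> D \<Longrightarrow> 0 \<le> y \<Longrightarrow> y \<le> 1 \<Longrightarrow> f (y, 0) = g (y, 0)"
      and u: "u \<in> topspace X" "split_less (f u) (g u)" for f g u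
  proof -
    have "f u \<in> topspace X" "g u \<in> topspace X" using f g u by (auto simp: continuous_map_def)
    then obtain x where x: "x \<in> D" "f u \<in> cut x" "g u \<notin> cut x"
      using separating_cut u(2) by metis
    have op: "openin X (cut x)" "openin X (topspace X - cut x)" using clopen_cut x(1) by auto
    let ?U = "{u \<in> topspace X. f u \<in> cut x} \<inter> {u \<in> topspace X. g u \<in> topspace X - cut x}"
    have op_U: "openin X ?U"
      using openin_continuous_map_preimage[OF f op(1)] openin_continuous_map_preimage[OF g op(2)]
      by (rule openin_Int)
    have "u \<in> ?U" using x u \<open>g u \<in> topspace X\<close> by simp
    then have "?U \<noteq> {}" by blast
    then obtain y where "y \<notin> D" "0 \<le> y" "y \<le> 1" "(y, 0) \<in> ?U"
      by (rule open_meets_X0[OF op_U])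
    then show False using eq[of y] by auto
  qed
  show "s = sigma"
  proof (rule extensionalityI[OF s(1)])
    show "sigma \<in> extensional (topspace X)" by (rule sigma_extensional)
    fix u assume u: "u \<in> topspace X"
    have "s u \<in> topspace X" "sigma u \<in> topspace X"
      using s(2) u sigma_props by (auto simp: continuous_map_def)
    then show "s u = sigma u"
      using no_split[OF s(2) continuous_sigma eq0 u] no_split[OF continuous_sigma s(2) eq0[symmetric] u]
        split_less_linear by blast
  qed
qed

section \<open>Continuous functions are combinations of cut functions\<close>

text \<open>Generators have x > 0 so that the formula for the transfer of a cut function applies to
  each of them; the cut at 0 is empty anyway.\<close>

inductive_set cut_span :: "(real \<times> int \<Rightarrow> int) set" where
  zero: "(\<lambda>u. 0) \<in> cut_span"
| add: "f \<in> cut_span \<Longrightarrow> x \<in> D \<Longrightarrow> 0 < x \<Longrightarrow> (\<lambda>u. f u + c * cut_fun x u) \<in> cut_span"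

lemma cut_fun_in_C_int: "x \<in> D \<Longrightarrow> cut_fun x \<in> C_int X"
  unfolding cut_fun_def using clopen_cut C_int_indicator by blast

lemma cut_span_in_C_int: "f \<in> cut_span \<Longrightarrow> f \<in> C_int X"
proof (induction rule: cut_span.induct)
  case (add f x c)
  show ?case by (intro C_int_add C_int_scale cut_fun_in_C_int add)
qed (rule C_int_zero)

lemma cut_fun_zero: "cut_fun 0 = (\<lambda>u. 0)"
  by (auto simp: cut_fun_def cut_zero)

lemma cut_fun_in_span:
  assumes "x \<in> D"
  shows "(\<lambda>u. c * cut_fun x u) \<in> cut_span"
proof (cases "x = 0")
  case True
  then show ?thesis by (simp add: cut_fun_zero cut_span.zero)
next
  case False
  then have "0 < x" using D_bounds(1)[OF assms] by simp
  then show ?thesis using cut_span.add[OF cut_span.zero assms, of c] by simp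
qed

lemma cut_span_add:
  assumes "f \<in> cut_span" "g \<in> cut_span"
  shows "(\<lambda>u. f u + g u) \<in> cut_span"
  using assms(2)
proof (induction rule: cut_span.induct)
  case zero
  then show ?case using assms(1) by simp
next
  case (add g x c)
  then show ?case using cut_span.add[OF add.IH, of x c] by (simp add: add.assoc)
qed

lemma cut_span_scale:
  assumes "f \<in> cut_span"
  shows "(\<lambda>u. c * f u) \<in> cut_span"
  using assms
proof (induction rule: cut_span.induct)
  case zero
  then show ?case by (simp add: cut_span.zero)
next
  case (add g x d)
  then show ?case using cut_span.add[OF add.IH, of x "c * d"] by (simp add: algebra_simps)
qed

lemma cut_fun_mult: "cut_fun x u * cut_fun y u = cut_fun (min x y) u"
  using cut_Int[of x y] cut_Int[of y x] by (auto simp: cut_fun_def indicator_def min_def)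

text \<open>Cuts are nested, so the product of two cut functions is a cut function. Multiplying by a
  cut is how local representations are restricted and glued.\<close>

lemma cut_span_mult_cut_fun:
  assumes "f \<in> cut_span" "x \<in> D"
  shows "(\<lambda>u. f u * cut_fun x u) \<in> cut_span"
  using assms(1)
proof (induction rule: cut_span.induct)
  case zero
  then show ?case by (simp add: cut_span.zero)
next
  case (add g y d)
  have "(\<lambda>u. d * cut_fun (min y x) u) \<in> cut_span"
    using add assms(2) by (intro cut_fun_in_span) (auto simp: min_def)
  from cut_span_add[OF add.IH this] show ?case
    by (simp add: distrib_right mult.assoc cut_fun_mult)
qed

text \<open>The halves x^- and x^+ each have a one-sided neighbourhood on which f is constant; at 0
  and at 1 one of the two sides is empty.\<close>

lemma C_int_one_sided:
  assumes f: "f \<in> C_int X" and x: "x \<in> D"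
  shows "\<exists>\<epsilon>>0. \<exists>c. \<forall>v\<in>topspace X. \<bar>fst v - x\<bar> < \<epsilon> \<longrightarrow> v \<in> cut x \<longrightarrow> f v = c"
    and "\<exists>\<epsilon>>0. \<exists>c. \<forall>v\<in>topspace X. \<bar>fst v - x\<bar> < \<epsilon> \<longrightarrow> v \<notin> cut x \<longrightarrow> f v = c"
proof -
  have op: "openin X {v \<in> topspace X. f v = n}" for n using f by (simp add: C_int_iff)
  show "\<exists>\<epsilon>>0. \<exists>c. \<forall>v\<in>topspace X. \<bar>fst v - x\<bar> < \<epsilon> \<longrightarrow> v \<in> cut x \<longrightarrow> f v = c"
  proof (cases "x = 0")
    case True
    then show ?thesis by (auto simp: cut_zero intro: exI[of _ 1])
  next
    case False
    then have v: "valid x (-1)" using x D_bounds[OF x] by (auto simp: valid_def)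
    define u where "u = pt x (-1)"
    have u: "u \<in> topspace X" "fst u = x" "side u = - 1"
      using v by (simp_all add: u_def pt_in_X side_pt)
    obtain \<epsilon> where "\<epsilon> > 0" and e: "nbhd u \<epsilon> \<subseteq> {v \<in> topspace X. f v = f u}"
      using open_nbhd[OF op, of u "f u"] u(1) by auto
    have "f v = f u" if "v \<in> topspace X" "\<bar>fst v - x\<bar> < \<epsilon>" "v \<in> cut x" for v
    proof -
      have "v \<in> nbhd u \<epsilon>"
        using that u X_eqI[of v u] by (auto simp: nbhd_def mem_cut_iff side_neg_iff)
      then show ?thesis using e by blast
    qed
    with \<open>\<epsilon> > 0\<close> show ?thesis by blast
  qed
  show "\<exists>\<epsilon>>0. \<exists>c. \<forall>v\<in>topspace X. \<bar>fst v - x\<bar> < \<epsilon> \<longrightarrow> v \<notin> cut x \<longrightarrow> f v = c"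
  proof (cases "x = 1")
    case True
    then show ?thesis by (auto simp: cut_ge_one intro: exI[of _ 1])
  next
    case False
    then have v: "valid x 1" using x D_bounds[OF x] by (auto simp: valid_def)
    define u where "u = pt x 1"
    have u: "u \<in> topspace X" "fst u = x" "side u = 1"
      using v by (simp_all add: u_def pt_in_X side_pt)
    obtain \<epsilon> where "\<epsilon> > 0" and e: "nbhd u \<epsilon> \<subseteq> {v \<in> topspace X. f v = f u}"
      using open_nbhd[OF op, of u "f u"] u(1) by auto
    have "f v = f u" if v: "v \<in> topspace X" "\<bar>fst v - x\<bar> < \<epsilon>" "v \<notin> cut x" for v
    proof -
      have "side v = 1" if "fst v = x"
        using v that x valid_side[of v] by (auto simp: mem_cut_iff valid_def)
      then have "v \<in> nbhd u \<epsilon>"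
        using v u X_eqI[of v u] by (auto simp: nbhd_def mem_cut_iff)
      then show ?thesis using e by blast
    qed
    with \<open>\<epsilon> > 0\<close> show ?thesis by blast
  qed
qed

lemma C_int_local_span:
  assumes f: "f \<in> C_int X" and x: "0 \<le> x" "x \<le> 1"
  obtains \<epsilon> g where "\<epsilon> > 0" "g \<in> cut_span"
    "\<forall>v\<in>topspace X. \<bar>fst v - x\<bar> < \<epsilon> \<longrightarrow> f v = g v"
proof (cases "x \<in> D")
  case False
  define u where "u = (x, 0 :: int)"
  have u: "u \<in> topspace X" "fst u = x" using pt_zero_in_X[OF False x] by (simp_all add: u_def)
  then have side: "side u = 0" using side_zero_iff False by simp
  have "openin X {v \<in> topspace X. f v = f u}" using f by (simp add: C_int_iff)
  then obtain \<epsilon> where "\<epsilon> > 0" and e: "nbhd u \<epsilon> \<subseteq> {v \<in> topspace X. f v = f u}"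
    using open_nbhd[of _ u] u(1) by blast
  have "f v = f u * cut_fun 1 v" if "v \<in> topspace X" "\<bar>fst v - x\<bar> < \<epsilon>" for v
  proof -
    have "fst v = fst u \<longrightarrow> v = u" using u that False X_eqI side_zero_iff by metis
    then have "v \<in> nbhd u \<epsilon>" using that u side by (simp add: nbhd_def)
    then have "f v = f u" using e by blast
    then show ?thesis using that by (simp add: cut_fun_def cut_ge_one)
  qed
  with \<open>\<epsilon> > 0\<close> cut_fun_in_span[OF one_in_D] show thesis
    by (intro that[of \<epsilon> "\<lambda>v. f u * cut_fun 1 v"]) auto
next
  case True
  obtain \<epsilon> c where e: "\<epsilon> > 0" "\<forall>v\<in>topspace X. \<bar>fst v - x\<bar> < \<epsilon> \<longrightarrow> v \<in> cut x \<longrightarrow> f v = c"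
    using C_int_one_sided(1)[OF f True] by blast
  obtain \<delta> d where d: "\<delta> > 0" "\<forall>v\<in>topspace X. \<bar>fst v - x\<bar> < \<delta> \<longrightarrow> v \<notin> cut x \<longrightarrow> f v = d"
    using C_int_one_sided(2)[OF f True] by blast
  let ?g = "\<lambda>v. (c - d) * cut_fun x v + d * cut_fun 1 v"
  have "f v = ?g v" if "v \<in> topspace X" "\<bar>fst v - x\<bar> < min \<epsilon> \<delta>" for v
    using e d that by (cases "v \<in> cut x") (auto simp: cut_fun_def cut_ge_one)
  moreover have "?g \<in> cut_span" using cut_span_add cut_fun_in_span True one_in_D by simp
  ultimately show thesis using e(1) d(1) by (intro that[of "min \<epsilon> \<delta>" ?g]) auto
qed

text \<open>Compactness enters through the Bolzano principle: f is a combination of cuts near every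
  real number, and representations on adjacent intervals can be merged.\<close>

lemma C_int_eq_cut_span: "C_int X = cut_span"
proof (intro equalityI subsetI)
  fix f assume f: "f \<in> C_int X"
  \<comment> \<open>The representation must hold strictly beyond both ends, so that two adjacent
    intervals overlap.\<close>
  define P where "P a b \<longleftrightarrow> (0 \<le> a \<longrightarrow> b \<le> 1 \<longrightarrow> (\<exists>a'<a. \<exists>b'>b. \<exists>g\<in>cut_span.
      \<forall>v\<in>topspace X. a' < fst v \<longrightarrow> fst v < b' \<longrightarrow> f v = g v))" for a b
  have "(0::real) \<le> 1" by simp
  then have "P 0 1"
  proof (induction rule: Bolzano)
    case (trans a b c)
    show ?case unfolding P_def
    proof (intro impI)
      assume ac: "0 \<le> a" "c \<le> 1"
      obtain a1 b1 g1 where 1: "a1 < a" "b < b1" "g1 \<in> cut_span"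
          "\<forall>v\<in>topspace X. a1 < fst v \<longrightarrow> fst v < b1 \<longrightarrow> f v = g1 v"
        using trans ac unfolding P_def by fastforce
      obtain a2 b2 g2 where 2: "a2 < b" "c < b2" "g2 \<in> cut_span"
          "\<forall>v\<in>topspace X. a2 < fst v \<longrightarrow> fst v < b2 \<longrightarrow> f v = g2 v"
        using trans ac unfolding P_def by fastforce
      \<comment> \<open>The overlap contains a point of \<open>D\<close>, where g1 can be exchanged
        for g2.\<close>
      obtain d where d: "d \<in> D" "max 0 a2 < d" "d < min 1 b1"
        by (rule D_dense[of "max 0 a2" "min 1 b1"]) (use 1 2 trans ac in auto)
      let ?g = "\<lambda>v. g2 v + ((g1 v + (- 1) * g2 v) * cut_fun d v)"
      have "?g \<in> cut_span"
        using 1(3) 2(3) d(1) by (intro cut_span_add cut_span_mult_cut_fun cut_span_scale)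
      moreover have "\<forall>v\<in>topspace X. a1 < fst v \<longrightarrow> fst v < b2 \<longrightarrow> f v = ?g v"
      proof (intro ballI impI)
        fix v assume "v \<in> topspace X" "a1 < fst v" "fst v < b2"
        then show "f v = ?g v"
          using 1(4) 2(4) d by (cases "v \<in> cut d") (auto simp: cut_fun_def mem_cut_iff)
      qed
      ultimately show "\<exists>a'<a. \<exists>b'>c. \<exists>g\<in>cut_span.
          \<forall>v\<in>topspace X. a' < fst v \<longrightarrow> fst v < b' \<longrightarrow> f v = g v"
        using 1(1) 2(2) by (intro exI[of _ a1] exI[of _ b2] bexI[of _ ?g] conjI)
    qed
  next
    case (local x)
    obtain \<epsilon> g where e: "\<epsilon> > 0" "g \<in> cut_span"
        "\<forall>v\<in>topspace X. \<bar>fst v - x\<bar> < \<epsilon> \<longrightarrow> f v = g v"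
      by (rule C_int_local_span[OF f local])
    have "P a b" if "a \<le> x" "x \<le> b" "b - a < \<epsilon>" for a b
      unfolding P_def using that e
      by (intro impI exI[of _ "x - \<epsilon>"] exI[of _ "x + \<epsilon>"] conjI bexI[of _ g] ballI) auto
    with e(1) show ?case by (intro exI[of _ \<epsilon>]) simp
  qed
  then obtain a b g where g: "a < 0" "1 < b" "g \<in> cut_span"
      "\<forall>v\<in>topspace X. a < fst v \<longrightarrow> fst v < b \<longrightarrow> f v = g v"
    unfolding P_def by auto
  have "f v = g v" for v
  proof (cases "v \<in> topspace X")
    case True
    then show ?thesis using g X_bounds[of v] by force
  next
    case False
    then show ?thesis using f cut_span_in_C_int[OF g(3)] unfolding C_int_iff by metis
  qed
  then show "f \<in> cut_span" using g(3) by (simp add: ext[of f g])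
qed (rule cut_span_in_C_int)

end


section \<open>The transfer operator on cut functions\<close>

lemma transfer_op_add:
  "transfer_op X \<sigma> (\<lambda>x. f x + g x) = (\<lambda>x. transfer_op X \<sigma> f x + transfer_op X \<sigma> g x)"
  by (rule ext) (simp add: transfer_op_def sum.distrib)

lemma transfer_op_scale: "transfer_op X \<sigma> (\<lambda>x. c * f x) = (\<lambda>x. c * transfer_op X \<sigma> f x)"
  by (rule ext) (simp add: transfer_op_def sum_distrib_left)

context beta_transformation
begin

definition L :: "(real \<times> int \<Rightarrow> int) \<Rightarrow> real \<times> int \<Rightarrow> int" where
  "L = transfer_op X sigma"

text \<open>The number of branches ending strictly below x, for x > 0. If \<beta> x is an integer,
  the last full branch is left out here and is accounted for by \<open>left_map\<close> being
  1.\<close>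

definition digit :: "real \<Rightarrow> nat" where
  "digit x = nat (\<lceil>\<beta> * x\<rceil> - 1)"

lemma L_add: "L (\<lambda>u. f u + g u) = (\<lambda>u. L f u + L g u)"
  and L_scale: "L (\<lambda>u. c * f u) = (\<lambda>u. c * L f u)"
  unfolding L_def by (rule transfer_op_add transfer_op_scale)+

lemma L_zero: "L (\<lambda>u. 0) = (\<lambda>u. 0)"
  using L_scale[of 0 "\<lambda>u. 0"] by simp

lemma left_map_plus_digit: "0 < x \<Longrightarrow> left_map \<beta> x + real (digit x) = \<beta> * x"
proof -
  assume "0 < x"
  then have "0 < \<beta> * x" using beta_gt_1 by simp
  then have "real (digit x) = of_int \<lceil>\<beta> * x\<rceil> - 1" by (simp add: digit_def of_nat_nat)
  then show ?thesis by (simp add: left_map_def)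
qed

lemma inverse_branch_valid:
  fixes k :: nat
  assumes "valid t e" "(t + real k) / \<beta> < 1 \<or> (t + real k) / \<beta> = 1 \<and> e < 0"
  shows "valid ((t + real k) / \<beta>) e" "side_map ((t + real k) / \<beta>) e = t"
proof -
  let ?y = "(t + real k) / \<beta>"
  have t: "0 \<le> t" "t \<le> 1" "e < 0 \<Longrightarrow> 0 < t" "0 \<le> e \<Longrightarrow> t < 1"
    using assms(1) one_in_D by (auto simp: valid_def order.strict_iff_order)
  have y: "0 \<le> ?y" "?y \<le> 1" "e < 0 \<Longrightarrow> 0 < ?y" using t assms(2) beta_gt_1 by auto
  have "real k < \<beta>"
  proof (cases "e < 0")
    case True
    have "t + real k \<le> \<beta>" using y(2) beta_gt_1 by (simp add: field_simps)
    with t(3) True show ?thesis by linarith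
  next
    case False
    then have "t + real k < \<beta>" using assms(2) beta_gt_1 by (simp add: field_simps)
    with t(1) show ?thesis by linarith
  qed
  then have "hat_step \<beta> ?y t"
    using y t beta_gt_1 by (auto simp: hat_step_def intro!: exI[of _ k])
  then have "?y \<in> D \<longleftrightarrow> t \<in> D" by (rule D_step_iff)
  with assms y show "valid ?y e" by (auto simp: valid_def)
  show "side_map ?y e = t" using t beta_gt_1 by (intro side_map_eqI[of _ k]) auto
qed

lemma sigma_fibre:
  assumes "u \<in> topspace X"
  obtains k :: nat where "real k < \<beta>" "u = pt ((fst (sigma u) + real k) / \<beta>) (side (sigma u))"
proof -
  obtain k :: nat where k: "real k < \<beta>" "fst (sigma u) = \<beta> * fst u - real k"
    using hat_step_side_map[OF valid_side[OF assms]] sigma_props(2)[OF assms]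
    by (auto simp: hat_step_def)
  then have "fst u = (fst (sigma u) + real k) / \<beta>" using beta_gt_1 by (simp add: field_simps)
  then show thesis using that[OF k(1)] pt_side[OF assms] sigma_props(3)[OF assms] by simp
qed

lemma finite_sigma_fibre: "finite {u \<in> topspace X. sigma u = w}"
proof -
  have "{u \<in> topspace X. sigma u = w} \<subseteq>
      (\<lambda>k. pt ((fst w + real k) / \<beta>) (side w)) ` {k. real k < \<beta>}"
    by (auto elim: sigma_fibre)
  then show ?thesis using finite_digits finite_surj by blast
qed

lemma L_eq_zero_outside: "w \<notin> topspace X \<Longrightarrow> L f w = 0"
proof -
  assume "w \<notin> topspace X"
  then have "{u \<in> topspace X. sigma u = w} = {}" using sigma_props(1) by auto
  then show ?thesis unfolding L_def transfer_op_def by (simp only: sum.empty)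
qed

text \<open>Here \<beta> x is \<open>digit x\<close> plus \<open>left_map \<beta> x\<close>, so
  integer parts are compared first. The tie k = digit + 1, t = 0, left limit 1 does no harm, because
  a left side has t > 0.\<close>

lemma digits_below:
  fixes k :: nat
  assumes "valid t e" "0 < x"
  shows "t + real k < \<beta> * x \<or> t + real k = \<beta> * x \<and> e < 0 \<longleftrightarrow>
    k < digit x \<or> k = digit x \<and> (t < left_map \<beta> x \<or> t = left_map \<beta> x \<and> e < 0)"
proof -
  let ?l = "left_map \<beta> x" and ?m = "digit x"
  have t: "0 \<le> t" "t \<le> 1" "e < 0 \<Longrightarrow> 0 < t"
    using assms(1) by (auto simp: valid_def)
  have l: "0 < ?l" "?l \<le> 1" by (rule left_map_bounds)+
  note eq = left_map_plus_digit[OF assms(2), symmetric]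
  consider "k < ?m" | "k = ?m" | "?m < k" by linarith
  then show ?thesis
  proof cases
    case 1
    then have "real k \<le> real ?m - 1" by simp
    then show ?thesis using 1 t l unfolding eq by linarith
  next
    case 3
    then have "real ?m + 1 \<le> real k" by simp
    then show ?thesis using 3 t l unfolding eq by fastforce
  qed (auto simp: eq)
qed

lemma L_cut_fun:
  assumes "x \<in> D" "0 < x"
  shows "L (cut_fun x) = (\<lambda>u. int (digit x) * cut_fun 1 u + cut_fun (left_map \<beta> x) u)"
proof
  fix w
  show "L (cut_fun x) w = int (digit x) * cut_fun 1 w + cut_fun (left_map \<beta> x) w"
  proof (cases "w \<in> topspace X")
    case False
    then show ?thesis using cut_subset by (auto simp: L_eq_zero_outside cut_fun_def indicator_def)
  next
    case w: True
    define t e where "t = fst w" and "e = side w"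
    have v: "valid t e" using valid_side[OF w] by (simp add: t_def e_def)
    let ?A = "{u \<in> topspace X. sigma u = w}"
    let ?\<rho> = "\<lambda>k::nat. pt ((t + real k) / \<beta>) e"
    let ?K = "{k::nat. t + real k < \<beta> * x \<or> t + real k = \<beta> * x \<and> e < 0}"
    have x1: "x \<le> 1" using assms D_bounds by blast
    \<comment> \<open>Each branch contributes at most one preimage of w, so the preimages inside the
      cut are counted by branch numbers.\<close>
    have "?A \<inter> cut x = ?\<rho> ` ?K"
    proof (intro equalityI subsetI)
      fix u assume u: "u \<in> ?A \<inter> cut x"
      then obtain k :: nat where k: "u = ?\<rho> k"
        using sigma_fibre[of u] unfolding t_def e_def by blast
      have "side u = e" using u sigma_props(3)[of u] by (auto simp: e_def)
      then have "(t + real k) / \<beta> < x \<or> (t + real k) / \<beta> = x \<and> e < 0"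
        using u k by (auto simp: mem_cut_iff)
      then have "k \<in> ?K" using beta_gt_1 by (auto simp: field_simps)
      then show "u \<in> ?\<rho> ` ?K" using k by blast
    next
      fix u assume "u \<in> ?\<rho> ` ?K"
      then obtain k where k: "u = ?\<rho> k" "k \<in> ?K" by blast
      then have less: "(t + real k) / \<beta> < x \<or> (t + real k) / \<beta> = x \<and> e < 0"
        using beta_gt_1 by (auto simp: field_simps)
      then have less1: "(t + real k) / \<beta> < 1 \<or> (t + real k) / \<beta> = 1 \<and> e < 0"
        using x1 by auto
      note y = inverse_branch_valid[OF v less1]
      have u: "u \<in> topspace X" "fst u = (t + real k) / \<beta>" "side u = e"
        using pt_in_X[OF y(1)] side_pt[OF y(1)] by (simp_all add: k)
      have "sigma u = w"
        using sigma_props[OF u(1)] u y(2) w by (intro X_eqI) (auto simp: t_def e_def)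
      then show "u \<in> ?A \<inter> cut x" using u less by (auto simp: mem_cut_iff)
    qed
    moreover have "inj_on ?\<rho> ?K" using beta_gt_1 by (auto simp: inj_on_def pt_def)
    ultimately have "card (?A \<inter> cut x) = card ?K" by (simp add: card_image)
    also have "?K = {..<digit x} \<union> (if w \<in> cut (left_map \<beta> x) then {digit x} else {})"
      using w unfolding digits_below[OF v assms(2)] by (auto simp: mem_cut_iff t_def e_def)
    also have "card \<dots> = digit x + (if w \<in> cut (left_map \<beta> x) then 1 else 0)"
      by simp
    finally have card: "card (?A \<inter> cut x) = digit x + (if w \<in> cut (left_map \<beta> x) then 1 else 0)" .
    have "L (cut_fun x) w = (\<Sum>u\<in>?A. indicator (cut x) u)"
      by (simp add: L_def transfer_op_def cut_fun_def)
    also have "\<dots> = (\<Sum>u\<in>?A \<inter> cut x. 1)"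
      using finite_sigma_fibre by (intro sum.mono_neutral_cong_right) (auto simp: indicator_def)
    also have "\<dots> = int (card (?A \<inter> cut x))" by simp
    also have "\<dots> = int (digit x) * cut_fun 1 w + cut_fun (left_map \<beta> x) w"
      unfolding card using w by (simp add: cut_fun_def cut_ge_one)
    finally show ?thesis .
  qed
qed

lemma L_in_cut_span: "f \<in> cut_span \<Longrightarrow> L f \<in> cut_span"
proof (induction rule: cut_span.induct)
  case zero
  then show ?case by (simp add: L_zero cut_span.zero)
next
  case (add f x c)
  have "left_map \<beta> x \<in> D" using add left_map_in_D_iff D_bounds by blast
  then have "(\<lambda>u. L f u + c * (int (digit x) * cut_fun 1 u + 1 * cut_fun (left_map \<beta> x) u)) \<in> cut_span"
    using add one_in_D by (intro cut_span_add cut_span_scale cut_fun_in_span)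
  then show ?case by (simp add: L_add L_scale L_cut_fun[OF add.hyps(2,3)])
qed

text \<open>The segment up to x / \<beta> lies on the first branch, which maps it bijectively onto
  the segment up to x.\<close>

lemma L_surj_cut_span:
  assumes "f \<in> cut_span"
  shows "\<exists>g\<in>cut_span. L g = f"
  using assms
proof (induction rule: cut_span.induct)
  case zero
  then show ?case using L_zero cut_span.zero by blast
next
  case (add f x c)
  then obtain g where g: "g \<in> cut_span" "L g = f" by blast
  have x: "0 < x" "x \<le> 1" using add D_bounds by auto
  then have "x / \<beta> \<le> 1" using beta_gt_1 by simp
  then have xD: "x / \<beta> \<in> D" "0 < x / \<beta>"
    using inverse_branch_in_D[of x 0] add beta_gt_1 by auto
  have "\<lceil>x\<rceil> = 1" using x by (intro ceiling_unique) auto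
  then have "L (cut_fun (x / \<beta>)) = cut_fun x"
    using L_cut_fun[OF xD] beta_gt_1 by (simp add: digit_def left_map_def)
  then have "L (\<lambda>u. g u + c * cut_fun (x / \<beta>) u) = (\<lambda>u. f u + c * cut_fun x u)"
    by (simp add: L_add L_scale g)
  then show ?case using cut_span.add[OF g(1) xD] by blast
qed

section \<open>Integration\<close>

definition J :: "(real \<times> int \<Rightarrow> int) \<Rightarrow> real" where
  "J = lebesgue_int (beta_map \<beta>) (beta_partition \<beta>)"

lemma J_altdef: "J f = (LINT x:{0..1} - D|lborel. real_of_int (f (x, 0)))"
  unfolding J_def lebesgue_int_def I0_def D_def ..

lemma D_null: "D \<in> null_sets lborel"
  using countable_D by (auto simp: null_sets_def emeasure_lborel_countable sets.countable)

lemma J_cut_fun_aux: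
  assumes "x \<in> D"
  shows "set_integrable lborel ({0..1} - D) (\<lambda>y. real_of_int (cut_fun x (y, 0)))"
    and "(LINT y:{0..1} - D|lborel. real_of_int (cut_fun x (y, 0))) = x"
proof -
  have x: "0 \<le> x" "x \<le> 1" using assms D_bounds by auto
  have eq: "indicator ({0..1} - D) y *\<^sub>R real_of_int (cut_fun x (y, 0)) = indicator ({0..<x} - D) y" for y
  proof (cases "y \<in> {0..1} - D")
    case True
    then have "y \<noteq> x" using assms by auto
    then have "(y, 0) \<in> cut x \<longleftrightarrow> y < x" using True pt_zero_in_X[of y] by (auto simp: mem_cut_iff)
    then show ?thesis using True by (auto simp: cut_fun_def indicator_def)
  qed (use x in \<open>auto simp: indicator_def\<close>)
  have D: "D \<in> sets lborel" using D_null by auto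
  then have m: "{0..<x} - D \<in> sets lborel" by auto
  have "emeasure lborel ({0..<x} - D) = emeasure lborel {0..<x}"
    using D_null by (intro emeasure_Diff_null_set) auto
  then have em: "emeasure lborel ({0..<x} - D) = ennreal x" using x by simp
  show "set_integrable lborel ({0..1} - D) (\<lambda>y. real_of_int (cut_fun x (y, 0)))"
    unfolding set_integrable_def eq using m em by (simp add: integrable_indicator_iff)
  show "(LINT y:{0..1} - D|lborel. real_of_int (cut_fun x (y, 0))) = x"
    unfolding set_lebesgue_integral_def eq using m em x by (simp add: measure_def)
qed

lemma J_integrable:
  "f \<in> cut_span \<Longrightarrow> set_integrable lborel ({0..1} - D) (\<lambda>y. real_of_int (f (y, 0)))"
proof (induction rule: cut_span.induct)
  case zero
  then show ?case by (simp add: set_integrable_def)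
next
  case (add f x c)
  show ?case using add J_cut_fun_aux(1)[OF add.hyps(2)]
    by (auto intro!: set_integral_add)
qed

lemma J_cut_fun: "x \<in> D \<Longrightarrow> J (cut_fun x) = x"
  by (simp add: J_altdef J_cut_fun_aux)

lemma J_add: "f \<in> cut_span \<Longrightarrow> g \<in> cut_span \<Longrightarrow> J (\<lambda>u. f u + g u) = J f + J g"
  using J_integrable[of f] J_integrable[of g] by (simp add: J_altdef set_integral_add)

lemma J_scale: "J (\<lambda>u. c * f u) = of_int c * J f"
  by (simp add: J_altdef)

lemma J_zero: "J (\<lambda>u. 0) = 0"
  using J_scale[of 0 "\<lambda>u. 0"] by simp

lemma J_nonneg:
  assumes "\<And>u. u \<in> topspace X \<Longrightarrow> 0 \<le> f u"
  shows "0 \<le> J f"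
  unfolding J_altdef set_lebesgue_integral_def
  using assms pt_zero_in_X by (intro Bochner_Integration.integral_nonneg) (auto simp: indicator_def)

text \<open>No change of variables is involved: on a cut function the claim is the identity
  \<open>left_map \<beta> x + digit x = \<beta> * x\<close>.\<close>

lemma J_L: "f \<in> cut_span \<Longrightarrow> J (L f) = \<beta> * J f"
proof (induction rule: cut_span.induct)
  case zero
  then show ?case by (simp add: L_zero J_zero)
next
  case (add f x c)
  have x: "0 < x" "x \<le> 1" using add D_bounds by auto
  then have lD: "left_map \<beta> x \<in> D" using add left_map_in_D_iff by blast
  note sp = cut_fun_in_span[OF one_in_D] cut_fun_in_span[OF lD, of 1, simplified]
    cut_fun_in_span[OF add.hyps(2)]
  have "J (L (cut_fun x)) = \<beta> * x"
    using left_map_plus_digit[OF x(1)]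
    by (simp add: L_cut_fun[OF add.hyps(2,3)] J_add[OF sp(1,2)] J_scale J_cut_fun one_in_D lD)
  moreover have "(\<lambda>u. c * L (cut_fun x) u) \<in> cut_span"
    using sp(3)[of 1] by (auto intro!: cut_span_scale L_in_cut_span)
  ultimately show ?case
    using add.IH J_add[OF L_in_cut_span[OF add.hyps(1)], of "\<lambda>u. c * L (cut_fun x) u"]
      J_add[OF add.hyps(1) sp(3)]
    by (simp add: L_add L_scale J_scale J_cut_fun add.hyps distrib_left)
qed

text \<open>The value at u persists on an interval. Being a nonzero natural number it is at least 1,
  so f dominates the indicator of a segment between two points c < d of \<open>D\<close>, and the
  integral is at least d - c.\<close>

lemma J_pos:
  assumes f: "f \<in> cut_span" and nonneg: "\<And>u. u \<in> topspace X \<Longrightarrow> 0 \<le> f u"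
    and u: "u \<in> topspace X" "f u \<noteq> 0"
  shows "0 < J f"
proof -
  have "openin X {v \<in> topspace X. f v = f u}" "u \<in> {v \<in> topspace X. f v = f u}"
    using cut_span_in_C_int[OF f] u by (auto simp: C_int_iff)
  then obtain a b where ab: "0 \<le> a" "a < b" "b \<le> 1"
    "\<And>v. v \<in> topspace X \<Longrightarrow> a < fst v \<Longrightarrow> fst v < b \<Longrightarrow> v \<in> {v \<in> topspace X. f v = f u}"
    by (rule open_contains_interval) blast
  obtain c where c: "c \<in> D" "a < c" "c < b" using D_dense[OF ab(1-3)] by blast
  obtain d where d: "d \<in> D" "c < d" "d < b" using D_dense[of c b] ab c by auto
  let ?h = "\<lambda>v. f v + ((- 1) * cut_fun d v + 1 * cut_fun c v)"
  have "0 \<le> ?h v" if v: "v \<in> topspace X" for v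
  proof (cases "v \<in> cut d \<and> v \<notin> cut c")
    case True
    then have "a < fst v" "fst v < b" using v c d by (auto simp: mem_cut_iff)
    then have "f v = f u" using ab(4) v by blast
    then show ?thesis using True nonneg[OF u(1)] u(2) by (simp add: cut_fun_def)
  next
    case False
    moreover have "cut c \<subseteq> cut d" using d(2) by (auto simp: cut_def)
    ultimately show ?thesis using nonneg[OF v] by (auto simp: cut_fun_def indicator_def)
  qed
  then have "0 \<le> J ?h" by (rule J_nonneg)
  also have "J ?h = J f + (J (\<lambda>v. (- 1) * cut_fun d v) + J (\<lambda>v. 1 * cut_fun c v))"
    using f c(1) d(1) by (simp only: J_add cut_span_add cut_fun_in_span)
  also have "\<dots> = J f - d + c"
    unfolding J_scale using c(1) d(1) by (simp add: J_cut_fun)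
  finally show ?thesis using d(2) by simp
qed

lemma J_in_laurent_ring: "f \<in> cut_span \<Longrightarrow> J f \<in> laurent_ring \<beta>"
proof (induction rule: cut_span.induct)
  case zero
  then show ?case using laurent_ring_of_int[of 0] by (simp add: J_zero)
next
  case (add f x c)
  then show ?case
    using J_add[OF add.hyps(1) cut_fun_in_span[OF add.hyps(2), of c]] D_subset_laurent_ring
    by (auto simp: J_scale J_cut_fun intro!: laurent_ring_add laurent_ring_of_int_mult)
qed

lemma one_fun_X: "one_fun X = cut_fun 1"
  by (simp add: one_fun_def cut_fun_def cut_ge_one)

end


context beta_transformation
begin

lemma L_sum:
  "L (\<lambda>u. \<Sum>i\<in>A. c i * g i u) = (\<lambda>u. \<Sum>i\<in>A. c i * L (g i) u)"
  by (induction A rule: infinite_finite_induct) (simp_all add: L_zero L_add L_scale)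

lemma L_pow_add: "(L ^^ n) (\<lambda>u. f u + g u) = (\<lambda>u. (L ^^ n) f u + (L ^^ n) g u)"
  by (induction n) (simp_all add: L_add)

lemma L_pow_scale: "(L ^^ n) (\<lambda>u. c * f u) = (\<lambda>u. c * (L ^^ n) f u)"
  by (induction n) (simp_all add: L_scale)

lemma L_pow_sum: "(L ^^ n) (\<lambda>u. \<Sum>i\<in>A. c i * g i u) = (\<lambda>u. \<Sum>i\<in>A. c i * (L ^^ n) (g i) u)"
  by (induction n) (simp_all add: L_sum)

lemma L_pow_in_cut_span: "f \<in> cut_span \<Longrightarrow> (L ^^ n) f \<in> cut_span"
  by (induction n) (simp_all add: L_in_cut_span)

lemma J_L_pow: "f \<in> cut_span \<Longrightarrow> J ((L ^^ n) f) = \<beta> ^ n * J f"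
  by (induction n) (simp_all add: J_L L_pow_in_cut_span)

end

section \<open>Positivity of functions with positive integral\<close>

locale periodic_beta_transformation = beta_transformation +
  assumes finite_orbit: "finite (range orbit)"
begin

text \<open>The target ring is left open: integers serve for values and coefficients, reals for
  integrals, and one duality covers both.\<close>

definition pairing :: "(real \<Rightarrow> int) \<Rightarrow> (real \<Rightarrow> 'b::comm_ring_1) \<Rightarrow> 'b" where
  "pairing c h = (\<Sum>x\<in>range orbit. of_int (c x) * h x)"

definition comb :: "(real \<Rightarrow> int) \<Rightarrow> real \<times> int \<Rightarrow> int" where
  "comb c u = pairing c (\<lambda>x. cut_fun x u)"

text \<open>The matrix of L on the cut functions of the orbit, acting on coefficients;
  \<open>pull\<close> is the transposed action. The constant function is the cut function of 1,
  which is itself an orbit point.\<close>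

definition push :: "(real \<Rightarrow> int) \<Rightarrow> real \<Rightarrow> int" where
  "push c y = pairing c (\<lambda>x. int (digit x) * of_bool (y = 1) + of_bool (y = left_map \<beta> x))"

definition pull :: "(real \<Rightarrow> 'b::comm_ring_1) \<Rightarrow> real \<Rightarrow> 'b" where
  "pull h x = of_nat (digit x) * h 1 + h (left_map \<beta> x)"

lemma one_in_orbit: "1 \<in> range orbit"
  using orbit_0 by (metis rangeI)

lemma left_map_in_orbit: "x \<in> range orbit \<Longrightarrow> left_map \<beta> x \<in> range orbit"
  by (auto simp: orbit_Suc[symmetric])

lemma range_orbit_bounds: "x \<in> range orbit \<Longrightarrow> 0 < x" "x \<in> range orbit \<Longrightarrow> x \<le> 1"
  using orbit_bounds by auto

lemma range_orbit_in_D: "x \<in> range orbit \<Longrightarrow> x \<in> D"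
  using orbit_in_D by auto

text \<open>Exchange of the two summations. With cut values for h this describes L on combinations;
  with the indicator of 1 it extracts the coefficient at 1.\<close>

lemma pairing_push: "pairing (push c) h = pairing c (pull h)"
proof -
  have inner: "(\<Sum>y\<in>range orbit. (of_nat (digit x) * of_bool (y = 1) + of_bool (y = left_map \<beta> x)) * h y)
      = pull h x" if "x \<in> range orbit" for x
  proof -
    have "(\<Sum>y\<in>range orbit. (of_nat (digit x) * of_bool (y = 1) + of_bool (y = left_map \<beta> x)) * h y) =
      (\<Sum>y\<in>range orbit. if y = 1 then of_nat (digit x) * h y else 0) +
      (\<Sum>y\<in>range orbit. if y = left_map \<beta> x then h y else 0)"
      unfolding sum.distrib[symmetric] by (intro sum.cong) (auto simp: distrib_right)
    also have "\<dots> = pull h x"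
      using finite_orbit one_in_orbit left_map_in_orbit[OF that]
      unfolding pull_def sum.delta'[OF finite_orbit] sum.delta[OF finite_orbit] by simp
    finally show ?thesis .
  qed
  have "pairing (push c) h = (\<Sum>y\<in>range orbit. \<Sum>x\<in>range orbit.
      of_int (c x) * ((of_nat (digit x) * of_bool (y = 1) + of_bool (y = left_map \<beta> x)) * h y))"
    unfolding pairing_def push_def by (simp add: sum_distrib_right mult.assoc)
  also have "\<dots> = (\<Sum>x\<in>range orbit. of_int (c x) * (\<Sum>y\<in>range orbit.
      (of_nat (digit x) * of_bool (y = 1) + of_bool (y = left_map \<beta> x)) * h y))"
    by (subst sum.swap) (simp add: sum_distrib_left)
  also have "\<dots> = pairing c (pull h)"
    unfolding pairing_def by (intro sum.cong) (simp_all only: inner)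
  finally show ?thesis .
qed

lemma pairing_push_pow: "pairing ((push ^^ n) c) h = pairing c ((pull ^^ n) h)"
proof (induction n arbitrary: h)
  case (Suc n)
  have "pairing ((push ^^ Suc n) c) h = pairing ((push ^^ n) c) (pull h)"
    by (simp add: pairing_push)
  also have "\<dots> = pairing c ((pull ^^ n) (pull h))" by (rule Suc)
  finally show ?case by (simp add: funpow_swap1)
qed simp

lemma pairing_diff: "pairing (\<lambda>x. c x - d x) h = pairing c h - pairing d h"
  by (simp add: pairing_def sum_subtractf left_diff_distrib)

lemma pairing_delta: "pairing (\<lambda>x. t * of_bool (x = 1)) h = of_int t * h 1"
proof -
  have "pairing (\<lambda>x. t * of_bool (x = 1)) h = (\<Sum>x\<in>range orbit. if x = 1 then of_int t * h x else 0)"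
    unfolding pairing_def by (intro sum.cong) auto
  then show ?thesis using one_in_orbit finite_orbit by (simp add: sum.delta)
qed

lemma comb_in_cut_span: "comb c \<in> cut_span"
proof -
  have "(\<lambda>u. \<Sum>x\<in>A. c x * cut_fun x u) \<in> cut_span" if "A \<subseteq> range orbit" for A
    using finite_subset[OF that finite_orbit] that
    by (induction A rule: finite_induct)
       (auto simp: cut_span.zero intro!: cut_span_add cut_fun_in_span range_orbit_in_D)
  from this[of "range orbit"] show ?thesis by (simp add: comb_def[abs_def] pairing_def)
qed

lemma L_comb: "L (comb c) = comb (push c)"
proof
  fix u
  have "L (comb c) u = (\<Sum>x\<in>range orbit. c x * L (cut_fun x) u)"
    unfolding comb_def pairing_def by (simp add: L_sum)
  also have "\<dots> = pairing c (pull (\<lambda>x. cut_fun x u))"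
    unfolding pairing_def pull_def
    by (intro sum.cong) (auto simp: L_cut_fun range_orbit_in_D range_orbit_bounds)
  finally show "L (comb c) u = comb (push c) u" by (simp add: comb_def pairing_push)
qed

lemma L_pow_comb: "(L ^^ n) (comb c) = comb ((push ^^ n) c)"
  by (induction n) (simp_all add: L_comb)

lemma J_comb: "J (comb c) = pairing c (\<lambda>x. x)"
proof -
  have "J (\<lambda>u. \<Sum>x\<in>A. c x * cut_fun x u) = (\<Sum>x\<in>A. of_int (c x) * x) \<and>
      (\<lambda>u. \<Sum>x\<in>A. c x * cut_fun x u) \<in> cut_span" if "A \<subseteq> range orbit" for A
    using finite_subset[OF that finite_orbit] that
  proof (induction A rule: finite_induct)
    case empty
    then show ?case by (simp add: J_zero cut_span.zero)
  next
    case (insert x A)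
    then have "x \<in> D" using range_orbit_in_D by blast
    then show ?case using insert J_add[OF cut_fun_in_span[of x "c x"]]
      by (auto simp: J_scale J_cut_fun intro!: cut_span_add cut_fun_in_span)
  qed
  from this[of "range orbit"] show ?thesis
    unfolding comb_def pairing_def by simp
qed

lemma pairing_mono:
  fixes h h' :: "real \<Rightarrow> 'b::linordered_idom"
  assumes "\<forall>x\<in>range orbit. 0 \<le> c x" "\<And>x. x \<in> range orbit \<Longrightarrow> h x \<le> h' x"
  shows "pairing c h \<le> pairing c h'"
  unfolding pairing_def using assms by (intro sum_mono mult_left_mono) auto

lemma push_pow_nonneg:
  assumes "\<forall>x\<in>range orbit. 0 \<le> c x"
  shows "\<forall>x\<in>range orbit. 0 \<le> (push ^^ n) c x"
proof (induction n)
  case (Suc n)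
  then show ?case unfolding push_def[abs_def] funpow.simps o_def pairing_def
    by (auto intro!: sum_nonneg)
qed (use assms in simp)

section \<open>Reaching the constant function from every orbit point\<close>

lemma digit_one: "1 \<le> digit 1"
  using beta_gt_1 unfolding digit_def by (simp add: le_nat_iff less_ceiling_iff)

text \<open>Without a positive digit the orbit would be multiplied by \<open>\<beta>\<close> in every step.\<close>

lemma exists_positive_digit:
  assumes "0 < x" "x \<le> 1"
  shows "\<exists>i. 1 \<le> digit ((left_map \<beta> ^^ i) x)"
proof (rule ccontr)
  assume "\<not> ?thesis"
  then have zero: "digit ((left_map \<beta> ^^ i) x) = 0" for i by (auto simp: not_le)
  have "(left_map \<beta> ^^ i) x = \<beta> ^ i * x" for i
  proof (induction i)
    case (Suc i)
    have "0 < (left_map \<beta> ^^ i) x" using left_iterate_bounds[OF assms] by blast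
    from left_map_plus_digit[OF this] Suc zero[of i] show ?case by simp
  qed simp
  then have "\<beta> ^ i * x \<le> 1" for i using left_iterate_bounds[OF assms, of i] by simp
  moreover obtain i where "1 / x < \<beta> ^ i" using real_arch_pow[OF beta_gt_1] by blast
  ultimately show False using assms(1) by (simp add: field_simps not_less[symmetric])
qed

text \<open>The coefficient of the constant function after n transfers of the segment up to x.
  Equivalently, the number of walks of length n from x to 1, where y has one edge to its left limit
  and \<open>digit y\<close> edges to 1.\<close>

definition loop_count :: "nat \<Rightarrow> real \<Rightarrow> int" where
  "loop_count n = (pull ^^ n) (\<lambda>x. of_bool (x = 1))"

lemma loop_count_Suc:
  "loop_count (Suc n) x = int (digit x) * loop_count n 1 + loop_count n (left_map \<beta> x)"
  by (simp add: loop_count_def pull_def)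

lemma loop_count_nonneg: "0 \<le> loop_count n x"
  by (induction n arbitrary: x) (simp_all add: loop_count_Suc, simp add: loop_count_def)

text \<open>The first digit is positive, so 1 carries a loop and a walk can wait there.\<close>

lemma loop_count_one: "1 \<le> loop_count n 1"
proof (induction n)
  case 0
  then show ?case by (simp add: loop_count_def)
next
  case (Suc n)
  have "1 * 1 \<le> int (digit 1) * loop_count n 1"
    using digit_one Suc by (intro mult_mono) auto
  then show ?case using loop_count_nonneg[of n "left_map \<beta> 1"] by (simp add: loop_count_Suc)
qed

text \<open>The walk follows left limits for i steps, uses the positive digit to move to 1, and
  waits there for n steps.\<close>

lemma loop_count_pos:
  assumes "1 \<le> digit ((left_map \<beta> ^^ i) x)"
  shows "1 \<le> loop_count (n + Suc i) x"
  using assms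
proof (induction i arbitrary: x)
  case 0
  have "1 * 1 \<le> int (digit x) * loop_count n 1"
    using 0 loop_count_one[of n] by (intro mult_mono) auto
  then show ?case using loop_count_nonneg[of n "left_map \<beta> x"] by (simp add: loop_count_Suc)
next
  case (Suc i)
  then have "1 \<le> loop_count (n + Suc i) (left_map \<beta> x)" by (simp add: funpow_swap1)
  moreover have "0 \<le> int (digit x) * loop_count (n + Suc i) 1"
    using loop_count_nonneg by simp
  ultimately show ?case using loop_count_Suc[of "n + Suc i" x] by simp
qed

text \<open>Since walks can wait at 1, positivity persists, and the finite orbit admits a common
  length N.\<close>

lemma loop_count_eventually: "\<exists>N. \<forall>x\<in>range orbit. 1 \<le> loop_count N x"
proof -
  have "\<forall>\<^sub>F n in sequentially. \<forall>x\<in>range orbit. 1 \<le> loop_count n x"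
  proof (rule eventually_ball_finite[OF finite_orbit], rule ballI)
    fix x assume x: "x \<in> range orbit"
    obtain i where i: "1 \<le> digit ((left_map \<beta> ^^ i) x)"
      using exists_positive_digit[OF range_orbit_bounds[OF x]] by blast
    show "\<forall>\<^sub>F n in sequentially. 1 \<le> loop_count n x"
      unfolding eventually_sequentially
    proof (intro exI allI impI)
      fix n assume "Suc i \<le> n"
      then show "1 \<le> loop_count n x" using loop_count_pos[OF i, of "n - Suc i"] by simp
    qed
  qed
  then show ?thesis by (auto simp: eventually_sequentially)
qed

lemma push_pow_at_one:
  assumes "\<forall>x\<in>range orbit. 1 \<le> loop_count N x" "\<forall>x\<in>range orbit. 0 \<le> c x"
  shows "pairing c (\<lambda>x. 1) \<le> (push ^^ N) c 1"
proof -
  have "(push ^^ N) c 1 = pairing ((push ^^ N) c) (\<lambda>x. of_bool (x = 1))"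
  proof -
    have "pairing ((push ^^ N) c) (\<lambda>x. of_bool (x = 1)) =
        (\<Sum>x\<in>range orbit. if x = 1 then (push ^^ N) c x else 0)"
      unfolding pairing_def by (intro sum.cong) auto
    then show ?thesis using one_in_orbit finite_orbit by (simp add: sum.delta)
  qed
  also have "\<dots> = pairing c (loop_count N)" by (simp add: pairing_push_pow loop_count_def)
  also have "\<dots> \<ge> pairing c (\<lambda>x. 1)" using assms by (intro pairing_mono) auto
  finally show ?thesis .
qed

section \<open>Shrinking the negative part\<close>

definition mass :: "(real \<Rightarrow> int) \<Rightarrow> real" where
  "mass c = pairing c (\<lambda>x. x)"

lemma mass_push_pow: "mass ((push ^^ n) c) = \<beta> ^ n * mass c"
  unfolding mass_def J_comb[symmetric] L_pow_comb[symmetric] by (rule J_L_pow[OF comb_in_cut_span])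

lemma mass_le_total:
  assumes "\<forall>x\<in>range orbit. 0 \<le> c x"
  shows "mass c \<le> of_int (pairing c (\<lambda>x. 1))"
proof -
  have "mass c \<le> pairing c (\<lambda>x. 1)"
    unfolding mass_def using assms range_orbit_bounds by (intro pairing_mono) auto
  then show ?thesis by (simp add: pairing_def)
qed

text \<open>A Doeblin argument: after \<open>N\<close> steps the positive and the negative part both contain the
  constant function with a multiplicity bounding their mass from above, and the common part
  cancels. Relative to the growth \<open>\<beta> ^ N\<close> of the integral the negative mass shrinks.\<close>

lemma cancel_step:
  assumes N: "\<forall>x\<in>range orbit. 1 \<le> loop_count N x"
    and c: "\<forall>x\<in>range orbit. 0 \<le> c x" and d: "\<forall>x\<in>range orbit. 0 \<le> d x"
    and less: "mass d < mass c"
  shows "\<exists>c' d'. (\<forall>x\<in>range orbit. 0 \<le> c' x) \<and> (\<forall>x\<in>range orbit. 0 \<le> d' x) \<and>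
    (\<lambda>u. comb c' u - comb d' u) = (L ^^ N) (\<lambda>u. comb c u - comb d u) \<and>
    mass c' - mass d' = \<beta> ^ N * (mass c - mass d) \<and> mass d' \<le> (\<beta> ^ N - 1) * mass d"
proof -
  \<comment> \<open>By \<open>push_pow_at_one\<close> both parts contain t copies of the constant
    function after N steps. As orbit points are at most 1 and d has the smaller mass, t is at least
    the mass of d.\<close>
  define t where "t = min (pairing c (\<lambda>x. 1 :: int)) (pairing d (\<lambda>x. 1))"
  define cut_off where "cut_off e = (\<lambda>x. (push ^^ N) e x - t * of_bool (x = 1))" for e
  have t: "mass d \<le> of_int t"
    using mass_le_total[OF c] mass_le_total[OF d] less by (simp add: t_def min_def)
  have nonneg: "\<forall>x\<in>range orbit. 0 \<le> cut_off e x"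
    if "\<forall>x\<in>range orbit. 0 \<le> e x" "t \<le> pairing e (\<lambda>x. 1)" for e
    using push_pow_nonneg[OF that(1)] push_pow_at_one[OF N that(1)] that(2) by (auto simp: cut_off_def)
  have pairing: "pairing (cut_off e) h = pairing ((push ^^ N) e) h - of_int t * h 1"
    for e and h :: "real \<Rightarrow> 'c::comm_ring_1"
    unfolding cut_off_def by (simp only: pairing_diff pairing_delta)
  have mass: "mass (cut_off e) = \<beta> ^ N * mass e - of_int t" for e
    using mass_push_pow[of N e] by (simp add: mass_def pairing)
  show ?thesis
  proof (intro exI conjI)
    show "\<forall>x\<in>range orbit. 0 \<le> cut_off c x" "\<forall>x\<in>range orbit. 0 \<le> cut_off d x"
      using nonneg[OF c] nonneg[OF d] by (simp_all add: t_def)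
    have "(L ^^ N) (\<lambda>u. comb c u + (- 1) * comb d u) =
        (\<lambda>u. comb ((push ^^ N) c) u + (- 1) * comb ((push ^^ N) d) u)"
      by (simp only: L_pow_add L_pow_scale L_pow_comb)
    then show "(\<lambda>u. comb (cut_off c) u - comb (cut_off d) u) = (L ^^ N) (\<lambda>u. comb c u - comb d u)"
      by (simp add: comb_def pairing)
    show "mass (cut_off c) - mass (cut_off d) = \<beta> ^ N * (mass c - mass d)"
      by (simp add: mass algebra_simps)
    show "mass (cut_off d) \<le> (\<beta> ^ N - 1) * mass d"
      using t by (simp add: mass algebra_simps)
  qed
qed

text \<open>The difference of the masses is multiplied by \<beta>^N in each round and stays
  positive, so \<open>cancel_step\<close> applies again.\<close>

lemma cancel_iterate:
  assumes N: "\<forall>x\<in>range orbit. 1 \<le> loop_count N x"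
    and c: "\<forall>x\<in>range orbit. 0 \<le> c x" and d: "\<forall>x\<in>range orbit. 0 \<le> d x"
    and less: "mass d < mass c"
  shows "\<exists>c' d'. (\<forall>x\<in>range orbit. 0 \<le> c' x) \<and> (\<forall>x\<in>range orbit. 0 \<le> d' x) \<and>
    (\<lambda>u. comb c' u - comb d' u) = (L ^^ (N * k)) (\<lambda>u. comb c u - comb d u) \<and>
    mass c' - mass d' = (\<beta> ^ N) ^ k * (mass c - mass d) \<and> mass d' \<le> (\<beta> ^ N - 1) ^ k * mass d"
proof (induction k)
  case 0
  show ?case using c d by (intro exI[of _ c] exI[of _ d]) simp
next
  case (Suc k)
  then obtain c' d' where IH: "\<forall>x\<in>range orbit. 0 \<le> c' x" "\<forall>x\<in>range orbit. 0 \<le> d' x"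
    "(\<lambda>u. comb c' u - comb d' u) = (L ^^ (N * k)) (\<lambda>u. comb c u - comb d u)"
    "mass c' - mass d' = (\<beta> ^ N) ^ k * (mass c - mass d)" "mass d' \<le> (\<beta> ^ N - 1) ^ k * mass d"
    by blast
  have "0 < (\<beta> ^ N) ^ k * (mass c - mass d)" using less beta_gt_1 by simp
  then have "mass d' < mass c'" using IH(4) by simp
  then obtain c'' d'' where step: "\<forall>x\<in>range orbit. 0 \<le> c'' x" "\<forall>x\<in>range orbit. 0 \<le> d'' x"
    "(\<lambda>u. comb c'' u - comb d'' u) = (L ^^ N) (\<lambda>u. comb c' u - comb d' u)"
    "mass c'' - mass d'' = \<beta> ^ N * (mass c' - mass d')" "mass d'' \<le> (\<beta> ^ N - 1) * mass d'"
    using cancel_step[OF N IH(1,2)] by blast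
  have "(\<beta> ^ N - 1) * mass d' \<le> (\<beta> ^ N - 1) * ((\<beta> ^ N - 1) ^ k * mass d)"
    using IH(5) beta_gt_1 by (intro mult_left_mono) auto
  then have "mass d'' \<le> (\<beta> ^ N - 1) ^ Suc k * mass d" using step(5) by simp
  moreover have "(\<lambda>u. comb c'' u - comb d'' u) = (L ^^ (N * Suc k)) (\<lambda>u. comb c u - comb d u)"
    unfolding step(3) IH(3) by (simp add: funpow_add)
  moreover have "mass c'' - mass d'' = (\<beta> ^ N) ^ Suc k * (mass c - mass d)"
    unfolding step(4) IH(4) by simp
  ultimately show ?case using step(1,2) by blast
qed

text \<open>Relative to the growth of the difference, the negative mass decays like (1 -
  \<beta>^(-N))^k. Once it is small, N further steps put the positive part, through its coefficient
  at 1, above the total coefficient of the negative part.\<close>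

lemma comb_diff_eventually_nonneg:
  assumes c: "\<forall>x\<in>range orbit. 0 \<le> c x" and d: "\<forall>x\<in>range orbit. 0 \<le> d x"
    and less: "mass d < mass c"
  shows "\<exists>n. \<forall>u\<in>topspace X. 0 \<le> (L ^^ n) (\<lambda>u. comb c u - comb d u) u"
proof -
  obtain N where N: "\<forall>x\<in>range orbit. 1 \<le> loop_count N x" using loop_count_eventually by blast
  \<comment> \<open>The smallest orbit point turns mass back into coefficients: for nonnegative
    coefficients their sum is at most the mass divided by \<mu>.\<close>
  define \<mu> where "\<mu> = Min (range orbit)"
  have \<mu>: "0 < \<mu>" "\<And>x. x \<in> range orbit \<Longrightarrow> \<mu> \<le> x"
    using finite_orbit range_orbit_bounds Min_in[OF finite_orbit] by (auto simp: \<mu>_def)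
  define \<rho> where "\<rho> = (\<beta> ^ N - 1) / \<beta> ^ N"
  have bN: "1 \<le> \<beta> ^ N" using beta_gt_1 by simp
  then have "\<bar>\<rho>\<bar> < 1" unfolding \<rho>_def by (auto simp: abs_if field_simps)
  then have "(\<lambda>k. \<rho> ^ k * mass d) \<longlonglongrightarrow> 0 * mass d"
    by (intro tendsto_mult LIMSEQ_abs_realpow_zero2 tendsto_const)
  moreover have "0 < \<mu> * (mass c - mass d) / \<beta> ^ N" using \<mu> less bN by simp
  ultimately have "\<forall>\<^sub>F k in sequentially. \<rho> ^ k * mass d < \<mu> * (mass c - mass d) / \<beta> ^ N"
    using order_tendstoD(2) by fastforce
  then obtain k where "\<rho> ^ k * mass d < \<mu> * (mass c - mass d) / \<beta> ^ N"
    by (auto simp: eventually_sequentially)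
  \<comment> \<open>The factor \<beta>^N on the left pays for the N final steps, and \<mu> on the
    right for passing from mass to coefficients.\<close>
  then have k: "\<beta> ^ N * ((\<beta> ^ N - 1) ^ k * mass d) < \<mu> * ((\<beta> ^ N) ^ k * (mass c - mass d))"
  proof -
    have *: "b * p < q * r" if "p / r < q / b" "0 < b" "0 < r" for p q r b :: real
      using that by (simp add: field_simps)
    have "\<rho> ^ k * mass d = (\<beta> ^ N - 1) ^ k * mass d / (\<beta> ^ N) ^ k"
      by (simp add: \<rho>_def power_divide)
    with \<open>\<rho> ^ k * mass d < \<mu> * (mass c - mass d) / \<beta> ^ N\<close>
    have "\<beta> ^ N * ((\<beta> ^ N - 1) ^ k * mass d) < \<mu> * (mass c - mass d) * (\<beta> ^ N) ^ k"
      using bN by (intro *) auto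
    then show ?thesis by (simp only: mult.assoc mult.commute[of "(\<beta> ^ N) ^ k"])
  qed
  obtain c' d' where nn: "\<forall>x\<in>range orbit. 0 \<le> c' x" "\<forall>x\<in>range orbit. 0 \<le> d' x"
    and eq: "(\<lambda>u. comb c' u - comb d' u) = (L ^^ (N * k)) (\<lambda>u. comb c u - comb d u)"
    and mass: "mass c' - mass d' = (\<beta> ^ N) ^ k * (mass c - mass d)" "mass d' \<le> (\<beta> ^ N - 1) ^ k * mass d"
    using cancel_iterate[OF N c d less] by blast
  have "0 \<le> (L ^^ (N + N * k)) (\<lambda>u. comb c u - comb d u) u" if u: "u \<in> topspace X" for u
  proof -
    have pos: "0 \<le> mass d'" unfolding mass_def pairing_def using nn(2) range_orbit_bounds
      by (intro sum_nonneg mult_nonneg_nonneg) (auto intro: less_imp_le)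
    have "mass c' \<le> of_int (pairing c' (\<lambda>x. 1))" by (rule mass_le_total[OF nn(1)])
    also have "\<dots> \<le> of_int ((push ^^ N) c' 1)"
      using push_pow_at_one[OF N nn(1)] by simp
    also have "(push ^^ N) c' 1 \<le> comb ((push ^^ N) c') u"
    proof -
      have "(push ^^ N) c' 1 = (push ^^ N) c' 1 * cut_fun 1 u"
        using u by (simp add: cut_fun_def cut_ge_one)
      also have "\<dots> \<le> (\<Sum>x\<in>range orbit. (push ^^ N) c' x * cut_fun x u)"
        using push_pow_nonneg[OF nn(1), of N] finite_orbit one_in_orbit
        by (intro member_le_sum) (auto simp: cut_fun_def)
      finally show ?thesis by (simp add: comb_def pairing_def)
    qed
    finally have lower: "mass c' \<le> of_int (comb ((push ^^ N) c') u)" by simp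
    have "comb ((push ^^ N) d') u \<le> pairing ((push ^^ N) d') (\<lambda>x. 1)"
      unfolding comb_def using push_pow_nonneg[OF nn(2)]
      by (intro pairing_mono) (auto simp: cut_fun_def indicator_def)
    then have "\<mu> * of_int (comb ((push ^^ N) d') u) \<le> \<mu> * of_int (pairing ((push ^^ N) d') (\<lambda>x. 1))"
      using \<mu>(1) by simp
    also have "\<dots> = pairing ((push ^^ N) d') (\<lambda>x. \<mu>)"
      by (simp add: pairing_def sum_distrib_left mult.commute)
    also have "\<dots> \<le> mass ((push ^^ N) d')"
      unfolding mass_def using push_pow_nonneg[OF nn(2)] \<mu> by (intro pairing_mono) auto
    also have "\<dots> = \<beta> ^ N * mass d'" by (rule mass_push_pow)
    also have "\<dots> \<le> \<beta> ^ N * ((\<beta> ^ N - 1) ^ k * mass d)" using mass(2) bN by simp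
    also have "\<dots> \<le> \<mu> * mass c'"
    proof -
      have "(\<beta> ^ N) ^ k * (mass c - mass d) \<le> mass c'" using mass(1) pos by simp
      then have "\<mu> * ((\<beta> ^ N) ^ k * (mass c - mass d)) \<le> \<mu> * mass c'" using \<mu>(1) by simp
      with k show ?thesis by simp
    qed
    also have "\<dots> \<le> \<mu> * of_int (comb ((push ^^ N) c') u)" using lower \<mu>(1) by simp
    finally have "comb ((push ^^ N) d') u \<le> comb ((push ^^ N) c') u" using \<mu>(1) by simp
    moreover have "(L ^^ (N + N * k)) (\<lambda>u. comb c u - comb d u) =
        (\<lambda>u. comb ((push ^^ N) c') u - comb ((push ^^ N) d') u)"
    proof -
      have "(L ^^ (N + N * k)) (\<lambda>u. comb c u - comb d u) = (L ^^ N) (\<lambda>u. comb c' u + (- 1) * comb d' u)"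
        unfolding funpow_add o_apply eq[symmetric] by simp
      also have "\<dots> = (\<lambda>u. comb ((push ^^ N) c') u + (- 1) * comb ((push ^^ N) d') u)"
        by (simp only: L_pow_add L_pow_scale L_pow_comb)
      finally show ?thesis by simp
    qed
    ultimately show ?thesis by simp
  qed
  then show ?thesis by blast
qed

section \<open>Reduction of arbitrary functions to combinations over the orbit\<close>

lemma cut_fun_in_combs:
  assumes "x \<in> range orbit"
  shows "cut_fun x = comb (\<lambda>y. of_bool (y = x))"
proof
  fix u
  have "comb (\<lambda>y. of_bool (y = x)) u = (\<Sum>y\<in>range orbit. if y = x then cut_fun y u else 0)"
    unfolding comb_def pairing_def by (intro sum.cong) auto
  then show "cut_fun x u = comb (\<lambda>y. of_bool (y = x)) u"
    using assms finite_orbit by (simp add: sum.delta)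
qed

lemma comb_add: "comb (\<lambda>x. c x + d x) u = comb c u + comb d u"
  by (simp add: comb_def pairing_def sum.distrib distrib_right)

lemma comb_scale: "comb (\<lambda>x. k * c x) u = k * comb c u"
  by (simp add: comb_def pairing_def sum_distrib_left mult.assoc)

lemma L_pow_cut_fun:
  assumes "x \<in> D" "0 < x"
  shows "\<exists>c. (L ^^ n) (cut_fun x) = (\<lambda>u. comb c u + cut_fun ((left_map \<beta> ^^ n) x) u)"
proof (induction n)
  case 0
  show ?case by (intro exI[of _ "\<lambda>_. 0"]) (simp add: comb_def pairing_def)
next
  case (Suc n)
  then obtain c where c: "(L ^^ n) (cut_fun x) = (\<lambda>u. comb c u + cut_fun ((left_map \<beta> ^^ n) x) u)"
    by blast
  let ?y = "(left_map \<beta> ^^ n) x"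
  have "?y \<in> D \<and> 0 < ?y \<and> ?y \<le> 1"
  proof (induction n)
    case (Suc n)
    then show ?case using left_map_bounds left_map_in_D_iff by auto
  qed (use assms D_bounds in auto)
  then have y: "?y \<in> D" "0 < ?y" by auto
  have "(L ^^ Suc n) (cut_fun x) = (\<lambda>u. comb (push c) u + L (cut_fun ?y) u)"
    by (simp add: c L_add L_comb)
  also have "\<dots> = (\<lambda>u. comb (push c) u + int (digit ?y) * comb (\<lambda>y. of_bool (y = 1)) u +
      cut_fun (left_map \<beta> ?y) u)"
    unfolding L_cut_fun[OF y] cut_fun_in_combs[OF one_in_orbit] by (simp add: add.assoc)
  also have "\<dots> = (\<lambda>u. comb (\<lambda>x. push c x + int (digit ?y) * of_bool (x = 1)) u +
      cut_fun ((left_map \<beta> ^^ Suc n) x) u)"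
    by (simp add: comb_add comb_scale)
  finally show ?case by blast
qed

lemma cut_span_eventually_comb:
  assumes "f \<in> cut_span"
  shows "\<exists>n c. (L ^^ n) f = comb c"
  using assms
proof (induction rule: cut_span.induct)
  case zero
  show ?case by (intro exI[of _ 0] exI[of _ "\<lambda>_. 0"]) (simp add: comb_def pairing_def)
next
  case (add f x k)
  then obtain n c where f: "(L ^^ n) f = comb c" by blast
  obtain m j where mj: "(left_map \<beta> ^^ m) x = orbit j" using D_enters_orbit add by blast
  obtain d0 where "(L ^^ m) (cut_fun x) = (\<lambda>u. comb d0 u + cut_fun ((left_map \<beta> ^^ m) x) u)"
    using L_pow_cut_fun[OF add.hyps(2,3)] by blast
  then have "(L ^^ m) (cut_fun x) = comb (\<lambda>y. d0 y + of_bool (y = orbit j))"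
    by (simp add: mj cut_fun_in_combs fun_eq_iff comb_add)
  then obtain d where x: "(L ^^ m) (cut_fun x) = comb d" by blast
  \<comment> \<open>The two summands enter the combinations after different numbers of steps; extra
    steps do no harm, as combinations are mapped to combinations.\<close>
  have "(L ^^ (m + n)) (\<lambda>u. f u + k * cut_fun x u) =
      (\<lambda>u. (L ^^ (m + n)) f u + k * (L ^^ (n + m)) (cut_fun x) u)"
    by (simp only: L_pow_add L_pow_scale add.commute)
  also have "\<dots> = comb (\<lambda>y. (push ^^ m) c y + k * (push ^^ n) d y)"
  proof -
    have "(L ^^ (m + n)) f = comb ((push ^^ m) c)" by (simp add: funpow_add f L_pow_comb)
    moreover have "(L ^^ (n + m)) (cut_fun x) = comb ((push ^^ n) d)"
      by (simp add: funpow_add x L_pow_comb)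
    ultimately show ?thesis by (simp add: fun_eq_iff comb_add comb_scale)
  qed
  finally show ?case by blast
qed

lemma J_pos_eventually_nonneg:
  assumes f: "f \<in> cut_span" and pos: "0 < J f"
  shows "\<exists>n. \<forall>u\<in>topspace X. 0 \<le> (L ^^ n) f u"
proof -
  obtain n c where n: "(L ^^ n) f = comb c" using cut_span_eventually_comb[OF f] by blast
  define c1 c2 where "c1 = (\<lambda>x. max 0 (c x))" and "c2 = (\<lambda>x. max 0 (- c x))"
  have c: "c = (\<lambda>x. c1 x - c2 x)" by (auto simp: c1_def c2_def)
  have eq: "comb c = (\<lambda>u. comb c1 u - comb c2 u)"
    by (rule ext) (simp add: c comb_def pairing_diff)
  have "mass c = \<beta> ^ n * J f" unfolding mass_def J_comb[symmetric] n[symmetric] by (rule J_L_pow[OF f])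
  moreover have "mass c = mass c1 - mass c2" by (simp add: c mass_def pairing_diff)
  moreover have "0 < \<beta> ^ n * J f" using pos beta_gt_1 by simp
  ultimately have "mass c2 < mass c1" by simp
  then obtain m where "\<forall>u\<in>topspace X. 0 \<le> (L ^^ m) (\<lambda>u. comb c1 u - comb c2 u) u"
    using comb_diff_eventually_nonneg[of c1 c2] by (auto simp: c1_def c2_def)
  then have "\<forall>u\<in>topspace X. 0 \<le> (L ^^ (m + n)) f u"
    by (simp add: funpow_add n eq)
  then show ?thesis by blast
qed

end


section \<open>The minimal polynomial\<close>

lemma poly_act_extend:
  assumes "degree p \<le> n"
  shows "poly_act T p f = (\<lambda>u. \<Sum>i\<le>n. coeff p i * (T ^^ i) f u)"
  unfolding poly_act_def using assms
  by (intro ext sum.mono_neutral_left) (auto simp: coeff_eq_0)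

lemma poly_act_diff: "poly_act T (p - r) f = (\<lambda>u. poly_act T p f u - poly_act T r f u)"
proof -
  define n where "n = max (degree p) (degree r)"
  have "degree (p - r) \<le> n" "degree p \<le> n" "degree r \<le> n"
    by (simp_all add: n_def degree_diff_le)
  from this[THEN poly_act_extend, of T f] show ?thesis
    by (simp add: left_diff_distrib sum_subtractf)
qed

lemma poly_act_smult: "poly_act T (Polynomial.smult c p) f = (\<lambda>u. c * poly_act T p f u)"
  by (rule ext) (simp add: poly_act_extend[OF degree_smult_le] poly_act_def sum_distrib_left mult.assoc)

lemma degree_lessI:
  assumes "degree p \<le> n" "coeff p n = 0" "0 < n"
  shows "degree p < n"
proof (rule ccontr)
  assume "\<not> ?thesis"
  then have "degree p = n" using assms(1) by simp
  then have "p = 0" using assms(2) by (simp add: leading_coeff_0_iff[symmetric] del: leading_coeff_0_iff)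
  with \<open>degree p = n\<close> assms(3) show False by simp
qed

lemma poly_act_const: "poly_act T [:c:] f = (\<lambda>u. c * f u)"
  by (simp add: poly_act_def)

context beta_transformation
begin

lemma poly_act_pCons_zero: "poly_act L (pCons 0 p) f = L (poly_act L p f)"
proof -
  have "degree (pCons 0 p) \<le> Suc (degree p)" by (rule degree_pCons_le)
  then have "poly_act L (pCons 0 p) f =
      (\<lambda>u. \<Sum>i\<le>Suc (degree p). coeff (pCons 0 p) i * (L ^^ i) f u)"
    by (rule poly_act_extend)
  also have "\<dots> = (\<lambda>u. \<Sum>i\<le>degree p. coeff p i * L ((L ^^ i) f) u)"
    by (rule ext) (subst sum.atMost_Suc_shift, simp)
  also have "\<dots> = L (poly_act L p f)"
    unfolding poly_act_def by (rule L_sum[symmetric])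
  finally show ?thesis .
qed

lemma poly_act_commute: "poly_act L p (poly_act L r f) = poly_act L r (poly_act L p f)"
proof
  fix u
  have "poly_act L p (poly_act L r f) u =
      (\<Sum>i\<le>degree p. \<Sum>j\<le>degree r. coeff p i * (coeff r j * (L ^^ (i + j)) f u))"
    by (simp add: poly_act_def L_pow_sum sum_distrib_left funpow_add)
  also have "\<dots> = (\<Sum>j\<le>degree r. \<Sum>i\<le>degree p. coeff r j * (coeff p i * (L ^^ (j + i)) f u))"
    by (subst sum.swap) (simp add: ac_simps)
  also have "\<dots> = poly_act L r (poly_act L p f) u"
    by (simp add: poly_act_def L_pow_sum sum_distrib_left funpow_add)
  finally show "poly_act L p (poly_act L r f) u = poly_act L r (poly_act L p f) u" .
qed

text \<open>Polynomials in L commute, so what kills the generator kills the module; conversely the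
  generator belongs to the module through the polynomial 1.\<close>

lemma annihilates_cyclic_iff:
  "annihilates p L (cyclic_module L f) \<longleftrightarrow> poly_act L p f = (\<lambda>u. 0)"
proof
  assume "annihilates p L (cyclic_module L f)"
  moreover have "poly_act L [:1:] f = f" by (simp add: poly_act_const)
  then have "f \<in> cyclic_module L f" unfolding cyclic_module_def by (intro CollectI exI[of _ "[:1:]"]) simp
  ultimately show "poly_act L p f = (\<lambda>u. 0)" by (simp add: annihilates_def)
next
  assume "poly_act L p f = (\<lambda>u. 0)"
  moreover have "poly_act L r (\<lambda>u. 0) = (\<lambda>u. 0)" for r
  proof -
    have "(L ^^ i) (\<lambda>u. 0) = (\<lambda>u. 0)" for i by (induction i) (simp_all add: L_zero)
    then show ?thesis by (simp add: poly_act_def)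
  qed
  ultimately have "poly_act L p (poly_act L r f) = (\<lambda>u. 0)" for r
    by (subst poly_act_commute) simp
  then show "annihilates p L (cyclic_module L f)"
    by (auto simp: annihilates_def cyclic_module_def)
qed

text \<open>Obtained by solving the transfer formula of the n-th orbit segment for the next one, so
  that this polynomial in L produces the segment from the constant function.\<close>

fun orbit_poly :: "nat \<Rightarrow> int poly" where
  "orbit_poly 0 = 1"
| "orbit_poly (Suc n) = pCons 0 (orbit_poly n) - [:int (digit (orbit n)):]"

lemma degree_orbit_poly_le: "degree (orbit_poly n) \<le> n"
proof (induction n)
  case (Suc n)
  then show ?case by (auto intro!: degree_diff_le intro: order_trans[OF degree_pCons_le])
qed simp

lemma coeff_orbit_poly: "coeff (orbit_poly n) n = 1"
  by (induction n) (simp_all add: coeff_pCons)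

lemma degree_orbit_poly: "degree (orbit_poly n) = n"
  using degree_orbit_poly_le[of n] le_degree[of "orbit_poly n" n] by (simp add: coeff_orbit_poly)

lemma poly_act_orbit_poly: "poly_act L (orbit_poly n) (cut_fun 1) = cut_fun (orbit n)"
proof (induction n)
  case 0
  then show ?case using poly_act_const[of L 1 "cut_fun 1"] by (simp add: one_pCons)
next
  case (Suc n)
  have "poly_act L (orbit_poly (Suc n)) (cut_fun 1) =
      (\<lambda>u. L (poly_act L (orbit_poly n) (cut_fun 1)) u - int (digit (orbit n)) * cut_fun 1 u)"
    unfolding orbit_poly.simps poly_act_diff poly_act_pCons_zero poly_act_const ..
  then show ?case
    unfolding Suc L_cut_fun[OF orbit_in_D orbit_bounds(1)] orbit_Suc by simp
qed

text \<open>The jump at \<open>x\<close> singles out the coefficient of \<open>cut_fun x\<close> in a combination of cut functions.\<close>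

definition jump :: "(real \<times> int \<Rightarrow> int) \<Rightarrow> real \<Rightarrow> int" where
  "jump f x = f (pt x (- 1)) - (if x < 1 then f (pt x 1) else 0)"

lemma jump_cut_fun:
  assumes "x \<in> D" "0 < x" "y \<in> D"
  shows "jump (cut_fun y) x = of_bool (y = x)"
proof -
  have "valid x (-1)" using assms D_bounds by (auto simp: valid_def)
  then have "pt x (-1) \<in> cut y \<longleftrightarrow> x \<le> y"
    by (auto simp: mem_cut_iff pt_in_X side_pt)
  then have "cut_fun y (pt x (-1)) = of_bool (x \<le> y)" by (simp add: cut_fun_def indicator_def)
  moreover have "cut_fun y (pt x 1) = of_bool (x < y)" if "x < 1"
  proof -
    have "valid x 1" using assms D_bounds that by (auto simp: valid_def)
    then have "pt x 1 \<in> cut y \<longleftrightarrow> x < y"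
      by (auto simp: mem_cut_iff pt_in_X side_pt)
    then show ?thesis by (simp add: cut_fun_def indicator_def)
  qed
  ultimately show ?thesis using D_bounds(2)[OF assms(3)] D_bounds(2)[OF assms(1)]
    by (auto simp: jump_def)
qed

lemma cut_fun_orbit_independent:
  assumes "inj_on orbit {..d}" "(\<lambda>u. \<Sum>i\<le>d. b i * cut_fun (orbit i) u) = (\<lambda>u. 0)" "j \<le> d"
  shows "b j = 0"
proof -
  have "jump (\<lambda>u. \<Sum>i\<le>d. b i * cut_fun (orbit i) u) (orbit j) =
      (\<Sum>i\<le>d. b i * jump (cut_fun (orbit i)) (orbit j))"
    by (simp add: jump_def sum_subtractf right_diff_distrib)
  also have "\<dots> = (\<Sum>i\<le>d. if i = j then b i else 0)"
    using assms(1,3) orbit_in_D orbit_bounds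
    by (intro sum.cong) (auto simp: jump_cut_fun inj_on_eq_iff)
  also have "\<dots> = b j" using assms(3) by simp
  finally show ?thesis unfolding assms(2) by (simp add: jump_def)
qed

text \<open>The orbit polynomials are monic, one in each degree, so p can be expanded in them; its
  leading coefficient survives as the coefficient of the last segment.\<close>

lemma poly_act_as_cut_funs:
  assumes "degree p \<le> d"
  shows "\<exists>b. poly_act L p (cut_fun 1) = (\<lambda>u. \<Sum>i\<le>d. b i * cut_fun (orbit i) u) \<and> b d = coeff p d"
  using assms
proof (induction d arbitrary: p)
  case 0
  then obtain c where "p = [:c:]" using degree_eq_zeroE by blast
  then show ?case by (intro exI[of _ "\<lambda>_. c"]) (simp add: poly_act_const)
next
  case (Suc d)
  define r where "r = p - Polynomial.smult (coeff p (Suc d)) (orbit_poly (Suc d))"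
  have "degree r \<le> Suc d"
    unfolding r_def using Suc.prems degree_orbit_poly[of "Suc d"]
    by (intro degree_diff_le) (auto intro: order_trans[OF degree_smult_le] simp del: orbit_poly.simps)
  moreover have "coeff r (Suc d) = 0"
    by (simp add: r_def coeff_orbit_poly del: orbit_poly.simps)
  ultimately have "degree r \<le> d" using degree_lessI[of r "Suc d"] by simp
  then obtain b where b: "poly_act L r (cut_fun 1) = (\<lambda>u. \<Sum>i\<le>d. b i * cut_fun (orbit i) u)"
    using Suc.IH by blast
  define b' where "b' = b(Suc d := coeff p (Suc d))"
  have "poly_act L p (cut_fun 1) u = (\<Sum>i\<le>Suc d. b' i * cut_fun (orbit i) u)" for u
  proof -
    have "poly_act L r (cut_fun 1) u =
        poly_act L p (cut_fun 1) u - coeff p (Suc d) * cut_fun (orbit (Suc d)) u"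
      by (simp add: r_def poly_act_diff poly_act_smult poly_act_orbit_poly del: orbit_poly.simps)
    then have "poly_act L p (cut_fun 1) u =
        (\<Sum>i\<le>d. b i * cut_fun (orbit i) u) + coeff p (Suc d) * cut_fun (orbit (Suc d)) u"
      by (simp add: b)
    also have "(\<Sum>i\<le>d. b i * cut_fun (orbit i) u) = (\<Sum>i\<le>d. b' i * cut_fun (orbit i) u)"
      by (intro sum.cong) (auto simp: b'_def)
    finally show ?thesis by (simp add: b'_def)
  qed
  then show ?case by (intro exI[of _ b']) (auto simp: b'_def)
qed

end

context periodic_beta_transformation
begin

text \<open>The index r is the first one at which an earlier value recurs; j is the length of the
  preperiod.\<close>

lemma orbit_period:
  obtains r j where "0 < r" "inj_on orbit {..<r}" "j < r" "orbit r = orbit j"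
proof -
  let ?P = "\<lambda>n. \<exists>j<n. orbit n = orbit j"
  have "\<not> inj orbit" using finite_orbit finite_imageD[of orbit UNIV] by auto
  then obtain i k where "i \<noteq> k" "orbit i = orbit k" unfolding inj_on_def by blast
  then have "?P i \<or> ?P k" by (cases i k rule: linorder_cases) auto
  then have "\<exists>n. ?P n" by blast
  then have P: "?P (LEAST n. ?P n)" by (rule LeastI_ex)
  then obtain j where j: "j < (LEAST n. ?P n)" "orbit (LEAST n. ?P n) = orbit j" by blast
  have not_P: "\<not> ?P i" if "i < (LEAST n. ?P n)" for i
    using that by (rule not_less_Least)
  have "inj_on orbit {..<(LEAST n. ?P n)}"
  proof (rule inj_onI)
    fix i k assume ik: "i \<in> {..<(LEAST n. ?P n)}" "k \<in> {..<(LEAST n. ?P n)}"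
      and eq: "orbit i = orbit k"
    show "i = k"
    proof (cases i k rule: linorder_cases)
      case less
      then have "?P k" using eq[symmetric] by blast
      with not_P[of k] ik(2) show ?thesis by simp
    next
      case greater
      then have "?P i" using eq by blast
      with not_P[of i] ik(1) show ?thesis by simp
    qed
  qed
  then show thesis using that[of "LEAST n. ?P n" j] j by simp
qed

text \<open>An explicit monic candidate is the difference of the orbit polynomials of r and j, as
  both produce the same segment. In degrees below r the independence of segments excludes
  annihilators, and two candidates of degree r would have an annihilating difference of smaller
  degree. This makes the definite description in \<open>minimal_poly\<close> meaningful.\<close>

lemma minimal_poly_props:
  defines "m \<equiv> minimal_poly L (cyclic_module L (one_fun X))"
  shows "poly_act L m (one_fun X) = (\<lambda>u. 0)"
    and "p \<noteq> 0 \<Longrightarrow> poly_act L p (one_fun X) = (\<lambda>u. 0) \<Longrightarrow> degree m \<le> degree p"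
proof -
  obtain r j where r: "0 < r" "inj_on orbit {..<r}" "j < r" "orbit r = orbit j"
    by (rule orbit_period)
  have lower: "r \<le> degree p" if p: "p \<noteq> 0" "poly_act L p (cut_fun 1) = (\<lambda>u. 0)" for p
  proof (rule ccontr)
    assume "\<not> r \<le> degree p"
    then have inj: "inj_on orbit {..degree p}" using r(2) by (auto intro: inj_on_subset)
    obtain b where "poly_act L p (cut_fun 1) = (\<lambda>u. \<Sum>i\<le>degree p. b i * cut_fun (orbit i) u)"
        "b (degree p) = coeff p (degree p)"
      using poly_act_as_cut_funs by blast
    with cut_fun_orbit_independent[OF inj, of b "degree p"] p show False by simp
  qed
  let ?m = "orbit_poly r - orbit_poly j"
  have coeff: "coeff ?m r = 1"
    using r(3) coeff_orbit_poly[of r] degree_orbit_poly[of j] by (simp add: coeff_eq_0)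
  have "degree ?m \<le> r"
    using r(3) by (intro degree_diff_le) (auto simp: degree_orbit_poly)
  with coeff have deg: "degree ?m = r" using le_degree[of ?m r] by simp
  let ?Q = "\<lambda>m. lead_coeff m = 1 \<and> annihilates m L (cyclic_module L (one_fun X)) \<and>
     (\<forall>p. p \<noteq> 0 \<and> annihilates p L (cyclic_module L (one_fun X)) \<longrightarrow> degree m \<le> degree p)"
  have ex: "?Q ?m"
    using coeff deg lower r(4)
    by (simp add: annihilates_cyclic_iff one_fun_X poly_act_diff poly_act_orbit_poly)
  have unique: "m' = ?m" if m': "?Q m'" for m'
  proof (rule ccontr)
    assume ne: "m' \<noteq> ?m"
    have "?m \<noteq> 0" "m' \<noteq> 0" using coeff m' by auto
    then have "degree m' \<le> degree ?m" "degree ?m \<le> degree m'" using ex m' by blast+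
    then have eq: "degree m' = r" using deg by simp
    have "degree (m' - ?m) \<le> r" by (rule degree_diff_le) (use eq deg in simp_all)
    moreover have "coeff m' r = 1" using m' eq by blast
    then have "coeff (m' - ?m) r = 0" using coeff by simp
    ultimately have "degree (m' - ?m) < r" using r(1) by (rule degree_lessI)
    moreover have "poly_act L (m' - ?m) (cut_fun 1) = (\<lambda>u. 0)"
      using ex m' by (simp add: annihilates_cyclic_iff one_fun_X poly_act_diff[of L m' ?m])
    ultimately show False using lower[of "m' - ?m"] ne by simp
  qed
  have "?Q m" unfolding m_def minimal_poly_def by (rule theI[of ?Q, OF ex unique])
  then show "poly_act L m (one_fun X) = (\<lambda>u. 0)"
    and "p \<noteq> 0 \<Longrightarrow> poly_act L p (one_fun X) = (\<lambda>u. 0) \<Longrightarrow> degree m \<le> degree p"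
    by (simp_all add: annihilates_cyclic_iff)
qed

context
  fixes q :: nat and a :: "nat \<Rightarrow> int"
  assumes min_poly: "minimal_poly L (cyclic_module L (one_fun X)) =
    monom 1 q - (\<Sum>i<q. monom (a i) (q - 1 - i))"
begin

lemma coeff_min_poly:
  "coeff (monom 1 q - (\<Sum>i<q. monom (a i) (q - 1 - i))) k =
    (if k = q then 1 else if k < q then - a (q - 1 - k) else 0)"
proof -
  have "(\<Sum>i<q. coeff (monom (a i) (q - 1 - i)) k) = (if k < q then a (q - 1 - k) else 0)"
  proof (cases "k < q")
    case True
    have "(\<Sum>i<q. coeff (monom (a i) (q - 1 - i)) k) = (\<Sum>i<q. if i = q - 1 - k then a i else 0)"
      using True by (intro sum.cong) auto
    then show ?thesis using True by simp
  next
    case False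
    then show ?thesis by (auto intro!: sum.neutral)
  qed
  then show ?thesis by (simp add: coeff_sum)
qed

lemma degree_min_poly: "degree (monom 1 q - (\<Sum>i<q. monom (a i) (q - 1 - i))) = q"
proof (rule antisym)
  show "degree (monom 1 q - (\<Sum>i<q. monom (a i) (q - 1 - i))) \<le> q"
    by (rule degree_le) (simp only: coeff_min_poly, simp)
  show "q \<le> degree (monom 1 q - (\<Sum>i<q. monom (a i) (q - 1 - i)))"
    by (rule le_degree) (simp only: coeff_min_poly, simp)
qed

lemma recurrence:
  "(L ^^ q) (one_fun X) = (\<lambda>u. \<Sum>i<q. a (q - 1 - i) * (L ^^ i) (one_fun X) u)"
proof
  fix u
  let ?f = "\<lambda>i. (L ^^ i) (one_fun X) u"
  have "(\<Sum>i\<le>q. (if i = q then 1 else if i < q then - a (q - 1 - i) else 0) * ?f i) = 0"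
    using fun_cong[OF minimal_poly_props(1), of u]
    unfolding min_poly poly_act_def degree_min_poly coeff_min_poly .
  also have "{..q} = insert q {..<q}" by auto
  finally have "?f q + (\<Sum>i<q. (if i = q then 1 else if i < q then - a (q - 1 - i) else 0) * ?f i) = 0"
    by simp
  also have "(\<Sum>i<q. (if i = q then 1 else if i < q then - a (q - 1 - i) else 0) * ?f i) =
      (\<Sum>i<q. - (a (q - 1 - i) * ?f i))" by (intro sum.cong) auto
  finally show "?f q = (\<Sum>i<q. a (q - 1 - i) * ?f i)" by (simp add: sum_negf)
qed

text \<open>A relation among the first q powers would be a nonzero annihilating polynomial of degree
  below q.\<close>

lemma powers_independent:
  assumes "(\<lambda>u. \<Sum>i<q. z i * (L ^^ i) (one_fun X) u) = (\<lambda>u. 0)" "i < q"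
  shows "z i = 0"
proof (rule ccontr)
  assume "z i \<noteq> 0"
  define p where "p = (\<Sum>i<q. monom (z i) i)"
  have coeff: "coeff p k = (if k < q then z k else 0)" for k
    by (simp add: p_def coeff_sum)
  have "p \<noteq> 0" using coeff[of i] assms(2) \<open>z i \<noteq> 0\<close> by auto
  have deg: "degree p < q"
  proof -
    have "degree p \<le> q - 1" by (rule degree_le) (auto simp: coeff)
    with assms(2) show ?thesis by simp
  qed
  have "poly_act L p (one_fun X) = (\<lambda>u. \<Sum>i\<le>q - 1. coeff p i * (L ^^ i) (one_fun X) u)"
    using deg by (intro poly_act_extend) simp
  also have "{..q - 1} = {..<q}" using assms(2) by auto
  also have "(\<lambda>u. \<Sum>i<q. coeff p i * (L ^^ i) (one_fun X) u) = (\<lambda>u. 0)"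
    unfolding assms(1)[symmetric] by (intro ext sum.cong) (auto simp: coeff)
  finally have "q \<le> degree p"
    using minimal_poly_props(2)[OF \<open>p \<noteq> 0\<close>] unfolding min_poly degree_min_poly by simp
  with deg show False by simp
qed

section \<open>Reduction to the first q powers\<close>

definition power_combs :: "(real \<times> int \<Rightarrow> int) set" where
  "power_combs = {f. \<exists>z. f = (\<lambda>u. \<Sum>i<q. z i * (L ^^ i) (one_fun X) u)}"

lemma power_combs_add: "f \<in> power_combs \<Longrightarrow> g \<in> power_combs \<Longrightarrow> (\<lambda>u. f u + g u) \<in> power_combs"
proof -
  assume "f \<in> power_combs" "g \<in> power_combs"
  then obtain z w where "f = (\<lambda>u. \<Sum>i<q. z i * (L ^^ i) (one_fun X) u)"
    "g = (\<lambda>u. \<Sum>i<q. w i * (L ^^ i) (one_fun X) u)" by (auto simp: power_combs_def)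
  then have "(\<lambda>u. f u + g u) = (\<lambda>u. \<Sum>i<q. (z i + w i) * (L ^^ i) (one_fun X) u)"
    by (simp add: sum.distrib distrib_right)
  then show ?thesis unfolding power_combs_def by (intro CollectI exI[of _ "\<lambda>i. z i + w i"])
qed

lemma power_combs_scale: "f \<in> power_combs \<Longrightarrow> (\<lambda>u. c * f u) \<in> power_combs"
proof -
  assume "f \<in> power_combs"
  then obtain z where "f = (\<lambda>u. \<Sum>i<q. z i * (L ^^ i) (one_fun X) u)" by (auto simp: power_combs_def)
  then have "(\<lambda>u. c * f u) = (\<lambda>u. \<Sum>i<q. (c * z i) * (L ^^ i) (one_fun X) u)"
    by (simp add: sum_distrib_left mult.assoc)
  then show ?thesis unfolding power_combs_def by (intro CollectI exI[of _ "\<lambda>i. c * z i"])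
qed

lemma power_combs_sum:
  assumes "finite A" "\<And>x. x \<in> A \<Longrightarrow> g x \<in> power_combs"
  shows "(\<lambda>u. \<Sum>x\<in>A. c x * g x u) \<in> power_combs"
  using assms
proof (induction A rule: finite_induct)
  case empty
  show ?case unfolding power_combs_def by (intro CollectI exI[of _ "\<lambda>_. 0"]) simp
next
  case (insert x A)
  then show ?case using power_combs_add[OF power_combs_scale] by simp
qed

lemma L_pow_one_in_power_combs: "(L ^^ n) (one_fun X) \<in> power_combs"
proof (induction n rule: less_induct)
  case (less n)
  show ?case
  proof (cases "n < q")
    case True
    have "(L ^^ n) (one_fun X) = (\<lambda>u. \<Sum>i<q. of_bool (i = n) * (L ^^ i) (one_fun X) u)"
    proof
      fix u
      have "(\<Sum>i<q. of_bool (i = n) * (L ^^ i) (one_fun X) u) =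
          (\<Sum>i<q. if i = n then (L ^^ i) (one_fun X) u else 0)"
        by (intro sum.cong) auto
      then show "(L ^^ n) (one_fun X) u = (\<Sum>i<q. of_bool (i = n) * (L ^^ i) (one_fun X) u)"
        using True by simp
    qed
    then show ?thesis unfolding power_combs_def by (intro CollectI exI[of _ "\<lambda>i. of_bool (i = n)"])
  next
    case False
    then have "(L ^^ n) (one_fun X) = (L ^^ (n - q)) ((L ^^ q) (one_fun X))"
      by (metis funpow_add le_add_diff_inverse2 not_less o_apply)
    also have "\<dots> = (\<lambda>u. \<Sum>i<q. a (q - 1 - i) * (L ^^ (n - q + i)) (one_fun X) u)"
      unfolding recurrence L_pow_sum by (simp add: funpow_add)
    also have "\<dots> \<in> power_combs"
      using False less by (intro power_combs_sum) auto
    finally show ?thesis .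
  qed
qed

text \<open>Orbit segments are polynomials in L applied to 1, and the recurrence lowers every power
  below q.\<close>

lemma comb_in_power_combs: "comb c \<in> power_combs"
proof -
  have "cut_fun (orbit n) \<in> power_combs" for n
    unfolding poly_act_orbit_poly[symmetric] poly_act_def one_fun_X[symmetric]
    by (intro power_combs_sum L_pow_one_in_power_combs) simp
  then have "(\<lambda>u. \<Sum>x\<in>range orbit. c x * cut_fun x u) \<in> power_combs"
    using finite_orbit by (intro power_combs_sum) auto
  then show ?thesis by (simp add: comb_def[abs_def] pairing_def)
qed

lemma eventually_power_comb:
  assumes "f \<in> cut_span"
  shows "\<exists>n z. (L ^^ n) f = (\<lambda>u. \<Sum>i<q. z i * (L ^^ i) (one_fun X) u)"
proof -
  obtain n c where "(L ^^ n) f = comb c" using cut_span_eventually_comb[OF assms] by blast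
  then have "(L ^^ n) f \<in> power_combs" using comb_in_power_combs by simp
  then show ?thesis unfolding power_combs_def by blast
qed

end

end


section \<open>The dimension group as an inductive limit\<close>

text \<open>Separates the algebra of the quotient from the geometry of the interval: what follows
  relies on T being onto, on the cyclic module being free and eventually absorbing, and on the
  positivity of J.\<close>

locale cyclic_dimension_group =
  fixes X :: "'a topology" and \<sigma> :: "'a \<Rightarrow> 'a" and \<beta> :: real and q :: nat and a :: "nat \<Rightarrow> int"
    and T :: "('a \<Rightarrow> int) \<Rightarrow> 'a \<Rightarrow> int" and J :: "('a \<Rightarrow> int) \<Rightarrow> real"
  defines "T \<equiv> transfer_op X \<sigma>"
  assumes beta_pos: "0 < \<beta>"
    and T_closed: "f \<in> C_int X \<Longrightarrow> T f \<in> C_int X"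
    and T_surj: "f \<in> C_int X \<Longrightarrow> \<exists>g\<in>C_int X. T g = f"
    and one_closed: "one_fun X \<in> C_int X"
    and recurrence: "(T ^^ q) (one_fun X) = (\<lambda>u. \<Sum>i<q. a (q - 1 - i) * (T ^^ i) (one_fun X) u)"
    and independent: "(\<lambda>u. \<Sum>i<q. z i * (T ^^ i) (one_fun X) u) = (\<lambda>u. 0) \<Longrightarrow> i < q \<Longrightarrow> z i = 0"
    and generated: "f \<in> C_int X \<Longrightarrow>
      \<exists>n z. (T ^^ n) f = (\<lambda>u. \<Sum>i<q. z i * (T ^^ i) (one_fun X) u)"
    and J_add: "f \<in> C_int X \<Longrightarrow> g \<in> C_int X \<Longrightarrow> J (\<lambda>u. f u + g u) = J f + J g"
    and J_scale: "f \<in> C_int X \<Longrightarrow> J (\<lambda>u. c * f u) = of_int c * J f"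
    and J_T: "f \<in> C_int X \<Longrightarrow> J (T f) = \<beta> * J f"
    and J_one: "J (one_fun X) = 1"
    and J_nonneg: "f \<in> C_int X \<Longrightarrow> (\<And>u. u \<in> topspace X \<Longrightarrow> 0 \<le> f u) \<Longrightarrow> 0 \<le> J f"
    and J_strict: "f \<in> C_int X \<Longrightarrow> (\<And>u. u \<in> topspace X \<Longrightarrow> 0 \<le> f u) \<Longrightarrow> J f = 0 \<Longrightarrow> f = (\<lambda>u. 0)"
    and J_pos: "f \<in> C_int X \<Longrightarrow> 0 < J f \<Longrightarrow> \<exists>n. \<forall>u\<in>topspace X. 0 \<le> (T ^^ n) f u"
    and J_laurent: "f \<in> C_int X \<Longrightarrow> J f \<in> laurent_ring \<beta>"
begin

abbreviation "cls \<equiv> dg_class X \<sigma>"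
abbreviation "G \<equiv> DG X \<sigma>"
abbreviation "B \<equiv> companion q a"

lemma T_pow_add: "(T ^^ n) (\<lambda>u. f u + g u) = (\<lambda>u. (T ^^ n) f u + (T ^^ n) g u)"
  by (induction n) (simp_all add: T_def transfer_op_add)

lemma T_pow_scale: "(T ^^ n) (\<lambda>u. c * f u) = (\<lambda>u. c * (T ^^ n) f u)"
  by (induction n) (simp_all add: T_def transfer_op_scale)

lemma T_pow_zero: "(T ^^ n) (\<lambda>u. 0) = (\<lambda>u. 0)"
  using T_pow_scale[of n 0 "\<lambda>u. 0"] by simp

lemma T_sum: "T (\<lambda>u. \<Sum>i\<in>A. c i * g i u) = (\<lambda>u. \<Sum>i\<in>A. c i * T (g i) u)"
proof (induction A rule: infinite_finite_induct)
  case (insert x A)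
  then show ?case
    using T_pow_add[of 1 "\<lambda>u. c x * g x u" "\<lambda>u. \<Sum>i\<in>A. c i * g i u"] T_pow_scale[of 1 "c x" "g x"]
    by simp
qed (use T_pow_zero[of 1] in simp_all)

lemma T_pow_closed: "f \<in> C_int X \<Longrightarrow> (T ^^ n) f \<in> C_int X"
  by (induction n) (simp_all add: T_closed)

lemma T_pow_surj: "f \<in> C_int X \<Longrightarrow> \<exists>g\<in>C_int X. (T ^^ n) g = f"
proof (induction n arbitrary: f)
  case (Suc n)
  obtain g where "g \<in> C_int X" "T g = f" using T_surj[OF Suc.prems] by blast
  moreover obtain h where "h \<in> C_int X" "(T ^^ n) h = g" using Suc.IH[OF calculation(1)] by blast
  ultimately show ?case by auto
qed auto

lemma J_T_pow: "f \<in> C_int X \<Longrightarrow> J ((T ^^ n) f) = \<beta> ^ n * J f"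
  by (induction n) (simp_all add: J_T T_pow_closed)

lemma J_zero: "J (\<lambda>u. 0) = 0"
  using J_scale[OF C_int_zero, of 0] by simp

lemma C_int_uminus: "f \<in> C_int X \<Longrightarrow> (\<lambda>u. - f u) \<in> C_int X"
  using C_int_scale[of f X "- 1"] by simp

lemma J_uminus: "f \<in> C_int X \<Longrightarrow> J (\<lambda>u. - f u) = - J f"
  using J_scale[of f "- 1"] by simp

lemma dg_rel_iff: "(f, g) \<in> dg_rel X \<sigma> \<longleftrightarrow> f \<in> C_int X \<and> g \<in> C_int X \<and> (\<exists>n. (T ^^ n) f = (T ^^ n) g)"
  by (simp add: dg_rel_def T_def)

lemma T_pow_eq_mono: "(T ^^ n) f = (T ^^ n) g \<Longrightarrow> (T ^^ (k + n)) f = (T ^^ (k + n)) g"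
  by (simp add: funpow_add)

lemma equiv_dg_rel: "equiv (C_int X) (dg_rel X \<sigma>)"
proof (rule equivI)
  show "dg_rel X \<sigma> \<subseteq> C_int X \<times> C_int X" by (auto simp: dg_rel_iff)
  show "refl_on (C_int X) (dg_rel X \<sigma>)" by (auto simp: refl_on_def dg_rel_iff)
  show "sym (dg_rel X \<sigma>)" by (auto simp: sym_def dg_rel_iff) metis
  show "trans (dg_rel X \<sigma>)"
  proof (rule transI)
    fix f g h assume "(f, g) \<in> dg_rel X \<sigma>" "(g, h) \<in> dg_rel X \<sigma>"
    then obtain n m where nm: "f \<in> C_int X" "h \<in> C_int X" "(T ^^ n) f = (T ^^ n) g" "(T ^^ m) g = (T ^^ m) h"
      by (auto simp: dg_rel_iff)
    have "(T ^^ (m + n)) f = (T ^^ (m + n)) h"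
      using T_pow_eq_mono[OF nm(3), of m] T_pow_eq_mono[OF nm(4), of n] by (simp add: add.commute)
    with nm show "(f, h) \<in> dg_rel X \<sigma>" by (auto simp: dg_rel_iff)
  qed
qed

lemma cls_eq_iff:
  "f \<in> C_int X \<Longrightarrow> g \<in> C_int X \<Longrightarrow> cls f = cls g \<longleftrightarrow> (\<exists>n. (T ^^ n) f = (T ^^ n) g)"
  unfolding dg_class_def using eq_equiv_class_iff[OF equiv_dg_rel, of f g] by (simp add: dg_rel_iff)

lemma cls_eqI: "f \<in> C_int X \<Longrightarrow> g \<in> C_int X \<Longrightarrow> (T ^^ n) f = (T ^^ n) g \<Longrightarrow> cls f = cls g"
  using cls_eq_iff by blast

lemma mem_cls_iff:
  assumes "f \<in> C_int X"
  shows "g \<in> cls f \<longleftrightarrow> g \<in> C_int X \<and> cls g = cls f"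
proof -
  have "g \<in> cls f \<longleftrightarrow> g \<in> C_int X \<and> (\<exists>n. (T ^^ n) f = (T ^^ n) g)"
    using assms by (simp add: dg_class_def dg_rel_iff)
  also have "\<dots> \<longleftrightarrow> g \<in> C_int X \<and> cls f = cls g" using cls_eq_iff[OF assms] by blast
  finally show ?thesis by (simp only: eq_commute[of "cls f"])
qed

lemma carrier_G: "carrier G = cls ` C_int X"
  by (auto simp: DG_def dg_class_def quotient_def)

lemma cls_closed: "f \<in> C_int X \<Longrightarrow> cls f \<in> carrier G"
  by (simp add: carrier_G)

lemma mult_cls:
  assumes "f \<in> C_int X" "g \<in> C_int X"
  shows "cls f \<otimes>\<^bsub>G\<^esub> cls g = cls (\<lambda>u. f u + g u)"
proof -
  have eq: "cls (\<lambda>u. f' u + g' u) = cls (\<lambda>u. f u + g u)" if "f' \<in> cls f" "g' \<in> cls g" for f' g'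
  proof -
    have C: "f' \<in> C_int X" "g' \<in> C_int X" and "cls f' = cls f" "cls g' = cls g"
      using that assms by (simp_all add: mem_cls_iff)
    then obtain n m where nm: "(T ^^ n) f' = (T ^^ n) f" "(T ^^ m) g' = (T ^^ m) g"
      using assms cls_eq_iff by meson
    have "(T ^^ (m + n)) f' = (T ^^ (m + n)) f" "(T ^^ (m + n)) g' = (T ^^ (m + n)) g"
      using T_pow_eq_mono[OF nm(1), of m] T_pow_eq_mono[OF nm(2), of n] by (simp_all add: add.commute)
    then have "(T ^^ (m + n)) (\<lambda>u. f' u + g' u) = (T ^^ (m + n)) (\<lambda>u. f u + g u)"
      unfolding T_pow_add by simp
    then show ?thesis using C assms by (intro cls_eqI C_int_add)
  qed
  have "cls f \<otimes>\<^bsub>G\<^esub> cls g = (\<Union>f'\<in>cls f. \<Union>g'\<in>cls g. cls (\<lambda>u. f' u + g' u))"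
    by (simp add: DG_def)
  also have "\<dots> = (\<Union>f'\<in>cls f. \<Union>g'\<in>cls g. cls (\<lambda>u. f u + g u))"
    by (simp only: eq cong: SUP_cong)
  also have "\<dots> = cls (\<lambda>u. f u + g u)"
    using assms mem_cls_iff by auto
  finally show ?thesis .
qed

lemma one_G: "\<one>\<^bsub>G\<^esub> = cls (\<lambda>u. 0)"
  by (simp add: DG_def)

lemma group_G: "group G"
proof (rule groupI)
  show "\<one>\<^bsub>G\<^esub> \<in> carrier G" by (simp add: one_G cls_closed C_int_zero)
next
  fix x y assume "x \<in> carrier G" "y \<in> carrier G"
  then show "x \<otimes>\<^bsub>G\<^esub> y \<in> carrier G" by (auto simp: carrier_G mult_cls C_int_add)
next
  fix x y z assume "x \<in> carrier G" "y \<in> carrier G" "z \<in> carrier G"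
  then show "x \<otimes>\<^bsub>G\<^esub> y \<otimes>\<^bsub>G\<^esub> z = x \<otimes>\<^bsub>G\<^esub> (y \<otimes>\<^bsub>G\<^esub> z)"
    by (auto simp: carrier_G mult_cls C_int_add add.assoc)
next
  fix x assume "x \<in> carrier G"
  then show "\<one>\<^bsub>G\<^esub> \<otimes>\<^bsub>G\<^esub> x = x" by (auto simp: carrier_G one_G mult_cls C_int_zero)
next
  fix x assume "x \<in> carrier G"
  then obtain f where "f \<in> C_int X" "x = cls f" by (auto simp: carrier_G)
  then show "\<exists>y\<in>carrier G. y \<otimes>\<^bsub>G\<^esub> x = \<one>\<^bsub>G\<^esub>"
    by (intro bexI[of _ "cls (\<lambda>u. - f u)"]) (simp_all add: one_G mult_cls C_int_uminus cls_closed)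
qed

lemma inv_cls: "f \<in> C_int X \<Longrightarrow> inv\<^bsub>G\<^esub> (cls f) = cls (\<lambda>u. - f u)"
  using group.inv_equality[OF group_G, of "cls (\<lambda>u. - f u)" "cls f"]
  by (simp add: one_G mult_cls C_int_uminus cls_closed)

subsection \<open>The isomorphism\<close>

text \<open>Identifies row vectors with elements of the cyclic module, in the basis of the first q
  powers of T at 1.\<close>

definition Z :: "int mat \<Rightarrow> 'a \<Rightarrow> int" where
  "Z v = (\<lambda>u. \<Sum>i<q. v $$ (0, i) * (T ^^ i) (one_fun X) u)"

lemma B_carrier: "B \<in> carrier_mat q q"
  by (simp add: companion_def)

text \<open>Row i of the companion matrix holds the coordinates of the power i + 1: a shift by one
  place, or the recurrence in the last row.\<close>

lemma Z_mult:
  assumes v: "v \<in> carrier_mat 1 q"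
  shows "Z (v * B) = T (Z v)"
proof
  fix u
  let ?f = "\<lambda>i. (T ^^ i) (one_fun X) u"
  have row: "(\<Sum>j<q. B $$ (i, j) * ?f j) = ?f (Suc i)" if i: "i < q" for i
  proof (cases "i = q - 1")
    case True
    then have "?f (Suc i) = (T ^^ q) (one_fun X) u" using i by simp
    also have "\<dots> = (\<Sum>j<q. a (q - 1 - j) * ?f j)" by (subst recurrence) simp
    also have "\<dots> = (\<Sum>j<q. B $$ (i, j) * ?f j)"
      using True i by (intro sum.cong) (auto simp: companion_def)
    finally show ?thesis by simp
  next
    case False
    have "(\<Sum>j<q. B $$ (i, j) * ?f j) = (\<Sum>j<q. if j = Suc i then ?f j else 0)"
      using False i by (intro sum.cong) (auto simp: companion_def)
    then show ?thesis using False i by simp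
  qed
  have "(v * B) $$ (0, j) = (\<Sum>i<q. v $$ (0, i) * B $$ (i, j))" if "j < q" for j
    using v that by (simp add: companion_def scalar_prod_def lessThan_atLeast0)
  then have "Z (v * B) u = (\<Sum>j<q. \<Sum>i<q. v $$ (0, i) * (B $$ (i, j) * ?f j))"
    by (simp add: Z_def sum_distrib_right mult.assoc)
  also have "\<dots> = (\<Sum>i<q. v $$ (0, i) * (\<Sum>j<q. B $$ (i, j) * ?f j))"
    by (subst sum.swap) (simp add: sum_distrib_left)
  also have "\<dots> = (\<Sum>i<q. v $$ (0, i) * T ((T ^^ i) (one_fun X)) u)"
    by (intro sum.cong) (simp_all add: row)
  also have "\<dots> = T (Z v) u" by (simp add: Z_def T_sum)
  finally show "Z (v * B) u = T (Z v) u" .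
qed

lemma mult_B_pow_carrier: "v \<in> carrier_mat 1 q \<Longrightarrow> v * B ^\<^sub>m k \<in> carrier_mat 1 q"
  using pow_carrier_mat[OF B_carrier] mult_carrier_mat by blast

lemma Z_mult_pow:
  assumes v: "v \<in> carrier_mat 1 q"
  shows "Z (v * B ^\<^sub>m k) = (T ^^ k) (Z v)"
proof (induction k)
  case 0
  then show ?case using v B_carrier by simp
next
  case (Suc k)
  have "v * B ^\<^sub>m Suc k = v * B ^\<^sub>m k * B"
    using assoc_mult_mat[OF v pow_carrier_mat[OF B_carrier] B_carrier] by simp
  then show ?case using Z_mult[OF mult_B_pow_carrier[OF v]] Suc by simp
qed

lemma Z_add:
  "v \<in> carrier_mat 1 q \<Longrightarrow> w \<in> carrier_mat 1 q \<Longrightarrow> Z (v + w) = (\<lambda>u. Z v u + Z w u)"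
  by (rule ext) (simp add: Z_def sum.distrib[symmetric] distrib_right)

lemma Z_inj:
  assumes "v \<in> carrier_mat 1 q" "w \<in> carrier_mat 1 q" "Z v = Z w"
  shows "v = w"
proof (rule eq_matI)
  have "(\<lambda>u. \<Sum>i<q. (v $$ (0, i) - w $$ (0, i)) * (T ^^ i) (one_fun X) u) = (\<lambda>u. Z v u - Z w u)"
    by (rule ext) (simp add: Z_def left_diff_distrib sum_subtractf)
  also have "\<dots> = (\<lambda>u. 0)" using assms(3) by simp
  finally have "v $$ (0, i) = w $$ (0, i)" if "i < q" for i
    using independent[of "\<lambda>i. v $$ (0, i) - w $$ (0, i)" i] that by simp
  then show "v $$ (i, j) = w $$ (i, j)" if "i < dim_row w" "j < dim_col w" for i j
    using that assms by simp
qed (use assms in auto)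

lemma Z_closed: "Z v \<in> C_int X"
proof -
  have "(\<lambda>u. \<Sum>i\<in>A. v $$ (0, i) * (T ^^ i) (one_fun X) u) \<in> C_int X" if "finite A" for A
    using that
    by (induction A rule: finite_induct)
       (auto intro!: C_int_zero C_int_add C_int_scale T_pow_closed one_closed)
  then show ?thesis by (simp add: Z_def)
qed

lemma Z_generated: "f \<in> C_int X \<Longrightarrow> \<exists>n. \<exists>v\<in>carrier_mat 1 q. (T ^^ n) f = Z v"
proof -
  assume "f \<in> C_int X"
  then obtain n z where "(T ^^ n) f = (\<lambda>u. \<Sum>i<q. z i * (T ^^ i) (one_fun X) u)"
    using generated by blast
  then have "(T ^^ n) f = Z (mat 1 q (\<lambda>(i, j). z j))" by (simp add: Z_def)
  then show ?thesis by (intro exI[of _ n] bexI[of _ "mat 1 q (\<lambda>(i, j). z j)"]) auto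
qed

text \<open>A pair (v, n) stands for a preimage of \<open>Z v\<close> under T^n. Lifting both pairs
  to a common level turns the relation of the limit into equality of some iterate of f and g, by
  injectivity of \<open>Z\<close>.\<close>

lemma lim_rel_iff_cls:
  assumes f: "f \<in> C_int X" "(T ^^ n) f = Z v" "v \<in> carrier_mat 1 q"
    and g: "g \<in> C_int X" "(T ^^ m) g = Z w" "w \<in> carrier_mat 1 q"
  shows "((v, n), (w, m)) \<in> lim_rel q B \<longleftrightarrow> cls f = cls g"
proof -
  have "v * B ^\<^sub>m (m + k) = w * B ^\<^sub>m (n + k) \<longleftrightarrow> (T ^^ (k + n + m)) f = (T ^^ (k + n + m)) g" for k
  proof -
    have "v * B ^\<^sub>m (m + k) = w * B ^\<^sub>m (n + k) \<longleftrightarrow> Z (v * B ^\<^sub>m (m + k)) = Z (w * B ^\<^sub>m (n + k))"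
      using Z_inj f(3) g(3) mult_B_pow_carrier by metis
    also have "Z (v * B ^\<^sub>m (m + k)) = (T ^^ (m + k + n)) f"
      unfolding Z_mult_pow[OF f(3)] f(2)[symmetric] by (simp add: funpow_add)
    also have "Z (w * B ^\<^sub>m (n + k)) = (T ^^ (n + k + m)) g"
      unfolding Z_mult_pow[OF g(3)] g(2)[symmetric] by (simp add: funpow_add)
    finally show ?thesis by (simp add: ac_simps)
  qed
  then have "((v, n), (w, m)) \<in> lim_rel q B \<longleftrightarrow> (\<exists>k. (T ^^ (k + n + m)) f = (T ^^ (k + n + m)) g)"
    using f(3) g(3) by (simp add: lim_rel_def)
  also have "\<dots> \<longleftrightarrow> cls f = cls g"
  proof
    assume "cls f = cls g"
    then obtain j where "(T ^^ j) f = (T ^^ j) g" using f g cls_eq_iff by meson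
    then have "(T ^^ (n + m + j)) f = (T ^^ (n + m + j)) g" by (rule T_pow_eq_mono)
    then show "\<exists>k. (T ^^ (k + n + m)) f = (T ^^ (k + n + m)) g"
      by (intro exI[of _ j]) (simp add: ac_simps)
  next
    assume "\<exists>k. (T ^^ (k + n + m)) f = (T ^^ (k + n + m)) g"
    then show "cls f = cls g" using f g cls_eqI by meson
  qed
  finally show ?thesis .
qed

text \<open>Collecting all representing pairs at once avoids a choice of level and vector; by
  \<open>phi_cls\<close> the result is literally a class of the limit.\<close>

definition \<phi> :: "('a \<Rightarrow> int) set \<Rightarrow> (int mat \<times> nat) set" where
  "\<phi> u = {(v, n). v \<in> carrier_mat 1 q \<and> (\<exists>g\<in>u. (T ^^ n) g = Z v)}"

lemma phi_cls:
  assumes f: "f \<in> C_int X" "(T ^^ n) f = Z v" "v \<in> carrier_mat 1 q"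
  shows "\<phi> (cls f) = lim_class q B v n"
proof (intro equalityI subsetI)
  fix x assume "x \<in> \<phi> (cls f)"
  then obtain w m g where x: "x = (w, m)" "w \<in> carrier_mat 1 q" "g \<in> cls f" "(T ^^ m) g = Z w"
    by (auto simp: \<phi>_def)
  then have "g \<in> C_int X" "cls g = cls f" using f by (simp_all add: mem_cls_iff)
  then show "x \<in> lim_class q B v n"
    using lim_rel_iff_cls[OF f, of g m w] x by (simp add: lim_class_def)
next
  fix x assume "x \<in> lim_class q B v n"
  then obtain w m where x: "x = (w, m)" "((v, n), (w, m)) \<in> lim_rel q B"
    by (cases x) (auto simp: lim_class_def)
  then have w: "w \<in> carrier_mat 1 q" by (simp add: lim_rel_def)
  \<comment> \<open>Surjectivity of T realizes the given pair by a function.\<close>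
  obtain g where g: "g \<in> C_int X" "(T ^^ m) g = Z w" using T_pow_surj[OF Z_closed] by blast
  then have "cls f = cls g" using lim_rel_iff_cls[OF f g w] x by simp
  then have "g \<in> cls f" using f g by (simp add: mem_cls_iff)
  with g w show "x \<in> \<phi> (cls f)" by (auto simp: \<phi>_def x)
qed

lemma ex_cls_of_lim_class:
  assumes "v \<in> carrier_mat 1 q"
  obtains f where "f \<in> C_int X" "(T ^^ n) f = Z v" "\<phi> (cls f) = lim_class q B v n"
  using T_pow_surj[OF Z_closed, of n v] phi_cls[OF _ _ assms] by blast

lemma carrier_ind_limit:
  "carrier (ind_limit q B) = {lim_class q B v n | v n. v \<in> carrier_mat 1 q}"
  by (auto simp: ind_limit_def quotient_def lim_class_def)

lemma phi_closed: "u \<in> carrier G \<Longrightarrow> \<phi> u \<in> carrier (ind_limit q B)"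
  unfolding carrier_G carrier_ind_limit using Z_generated phi_cls by blast

lemma phi_mult:
  assumes "u \<in> carrier G" "v \<in> carrier G"
  shows "\<phi> (u \<otimes>\<^bsub>G\<^esub> v) = \<phi> u \<otimes>\<^bsub>ind_limit q B\<^esub> \<phi> v"
proof -
  obtain f g where f: "f \<in> C_int X" "u = cls f" and g: "g \<in> C_int X" "v = cls g"
    using assms by (auto simp: carrier_G)
  have eq: "lim_class q B (v1 * B ^\<^sub>m n2 + v2 * B ^\<^sub>m n1) (n1 + n2) = \<phi> (u \<otimes>\<^bsub>G\<^esub> v)"
    if mem: "(v1, n1) \<in> \<phi> u" "(v2, n2) \<in> \<phi> v" for v1 n1 v2 n2
  proof -
    obtain f' g' where v: "v1 \<in> carrier_mat 1 q" "v2 \<in> carrier_mat 1 q"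
      and f': "f' \<in> cls f" "(T ^^ n1) f' = Z v1" and g': "g' \<in> cls g" "(T ^^ n2) g' = Z v2"
      using mem by (auto simp: \<phi>_def f g)
    have C: "f' \<in> C_int X" "g' \<in> C_int X" and "u = cls f'" "v = cls g'"
      using f' g' f g by (simp_all add: mem_cls_iff)
    then have "u \<otimes>\<^bsub>G\<^esub> v = cls (\<lambda>x. f' x + g' x)" by (simp add: mult_cls)
    moreover have "(T ^^ (n1 + n2)) (\<lambda>x. f' x + g' x) = Z (v1 * B ^\<^sub>m n2 + v2 * B ^\<^sub>m n1)"
    proof -
      have "(T ^^ (n2 + n1)) f' = Z (v1 * B ^\<^sub>m n2)" "(T ^^ (n1 + n2)) g' = Z (v2 * B ^\<^sub>m n1)"
        unfolding Z_mult_pow[OF v(1)] Z_mult_pow[OF v(2)] using f' g' by (simp_all add: funpow_add)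
      then show ?thesis
        unfolding T_pow_add Z_add[OF mult_B_pow_carrier[OF v(1)] mult_B_pow_carrier[OF v(2)]]
        by (simp add: add.commute)
    qed
    ultimately show ?thesis
      using phi_cls[OF C_int_add[OF C] _ add_carrier_mat[OF mult_B_pow_carrier[OF v(2)]]] by simp
  qed
  \<comment> \<open>The product in the limit is a union over representatives. All its members are
    equal, so it can be evaluated once the index sets are known to be nonempty.\<close>
  have ne: "\<phi> w \<noteq> {}" if w: "w \<in> carrier G" for w
  proof -
    obtain h where h: "h \<in> C_int X" "w = cls h" using w by (auto simp: carrier_G)
    then obtain n z where "z \<in> carrier_mat 1 q" "(T ^^ n) h = Z z" using Z_generated by blast
    moreover have "h \<in> w" using h by (simp add: mem_cls_iff)
    ultimately have "(z, n) \<in> \<phi> w" by (auto simp: \<phi>_def)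
    then show ?thesis by blast
  qed
  have "\<phi> u \<otimes>\<^bsub>ind_limit q B\<^esub> \<phi> v = (\<Union>x\<in>\<phi> u. \<Union>y\<in>\<phi> v. \<phi> (u \<otimes>\<^bsub>G\<^esub> v))"
    unfolding ind_limit_def monoid.simps
    by (intro SUP_cong refl) (auto simp: eq split: prod.splits)
  then show ?thesis using ne[OF assms(1)] ne[OF assms(2)] by simp
qed

lemma phi_inj: "inj_on \<phi> (carrier G)"
proof (rule inj_onI)
  fix u v assume uv: "u \<in> carrier G" "v \<in> carrier G" and eq: "\<phi> u = \<phi> v"
  obtain f g where f: "f \<in> C_int X" "u = cls f" and g: "g \<in> C_int X" "v = cls g"
    using uv by (auto simp: carrier_G)
  obtain n z where z: "z \<in> carrier_mat 1 q" "(T ^^ n) f = Z z" using Z_generated[OF f(1)] by blast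
  have "f \<in> u" using f by (simp add: mem_cls_iff)
  then have "(z, n) \<in> \<phi> v" unfolding eq[symmetric] using z by (auto simp: \<phi>_def)
  then obtain g' where g': "g' \<in> v" "(T ^^ n) g' = Z z" by (auto simp: \<phi>_def)
  then have "g' \<in> C_int X" "cls g' = v" using g by (simp_all add: mem_cls_iff)
  moreover from this have "cls f = cls g'" using f z g' by (intro cls_eqI[of f g' n]) auto
  ultimately show "u = v" using f by simp
qed

lemma phi_iso: "\<phi> \<in> iso G (ind_limit q B)"
proof -
  have "\<phi> ` carrier G = carrier (ind_limit q B)"
  proof (intro equalityI subsetI)
    fix x assume "x \<in> carrier (ind_limit q B)"
    then obtain v n where "v \<in> carrier_mat 1 q" "x = lim_class q B v n"
      unfolding carrier_ind_limit by blast
    then show "x \<in> \<phi> ` carrier G" using ex_cls_of_lim_class[of v n] cls_closed by (metis imageI)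
  qed (use phi_closed in blast)
  then show ?thesis
    using phi_inj phi_mult phi_closed by (auto simp: iso_def hom_def bij_betw_def)
qed

subsection \<open>The state and the order\<close>

definition \<omega> :: "('a \<Rightarrow> int) set \<Rightarrow> real" where
  "\<omega> = (\<lambda>u\<in>carrier G. J (SOME f. f \<in> u))"

lemma J_cong_cls:
  assumes "f \<in> C_int X" "g \<in> C_int X" "cls f = cls g"
  shows "J f = J g"
proof -
  obtain n where "(T ^^ n) f = (T ^^ n) g" using assms cls_eq_iff by meson
  then have "\<beta> ^ n * J f = \<beta> ^ n * J g" using J_T_pow assms by metis
  then show ?thesis using beta_pos by simp
qed

lemma omega_cls:
  assumes "f \<in> C_int X"
  shows "\<omega> (cls f) = J f"
proof -
  have "f \<in> cls f" using assms by (simp add: mem_cls_iff)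
  then have "(SOME g. g \<in> cls f) \<in> cls f" by (rule someI[where P = "\<lambda>g. g \<in> cls f"])
  then show ?thesis
    using assms J_cong_cls[of "SOME g. g \<in> cls f" f] by (simp add: \<omega>_def cls_closed mem_cls_iff)
qed

text \<open>A nonnegative function with integral 0 vanishes, so the kernel of the state meets the
  cone in 0 alone. This is what makes the order strict.\<close>

lemma cls_eq_zeroI:
  assumes "f \<in> C_int X" "\<forall>u\<in>topspace X. 0 \<le> (T ^^ n) f u" "J f = 0"
  shows "cls f = cls (\<lambda>u. 0)"
proof -
  have "J ((T ^^ n) f) = 0" using assms by (simp add: J_T_pow)
  then have "(T ^^ n) f = (\<lambda>u. 0)" using J_strict[OF T_pow_closed[OF assms(1)]] assms(2) by blast
  then show ?thesis using assms(1) C_int_zero T_pow_zero by (intro cls_eqI[of f _ n]) simp_all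
qed

lemma mem_dg_cone:
  "u \<in> dg_cone X \<sigma> \<longleftrightarrow> (\<exists>f\<in>C_int X. u = cls f \<and> (\<exists>n. \<forall>x\<in>topspace X. 0 \<le> (T ^^ n) f x))"
  by (auto simp: dg_cone_def T_def)

lemma dg_cone_nonneg:
  assumes "f \<in> C_int X" "\<forall>u\<in>topspace X. 0 \<le> (T ^^ n) f u"
  shows "0 \<le> J f"
proof -
  have "0 \<le> J ((T ^^ n) f)" using J_nonneg[OF T_pow_closed[OF assms(1)]] assms(2) by blast
  then have "0 \<le> \<beta> ^ n * J f" using assms(1) by (simp add: J_T_pow)
  then show ?thesis using zero_less_power[OF beta_pos, of n] by (simp add: zero_le_mult_iff)
qed

lemma cls_in_dg_cone_iff:
  assumes h: "h \<in> C_int X"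
  shows "cls h \<in> dg_cone X \<sigma> \<longleftrightarrow> 0 < J h \<or> cls h = cls (\<lambda>u. 0)"
proof
  assume "cls h \<in> dg_cone X \<sigma>"
  then obtain f n where f: "f \<in> C_int X" "cls h = cls f" "\<forall>x\<in>topspace X. 0 \<le> (T ^^ n) f x"
    by (auto simp: mem_dg_cone)
  then have "J h = J f" using J_cong_cls h by blast
  with dg_cone_nonneg[OF f(1,3)] cls_eq_zeroI[OF f(1,3)] f(2)
  show "0 < J h \<or> cls h = cls (\<lambda>u. 0)" by force
next
  assume "0 < J h \<or> cls h = cls (\<lambda>u. 0)"
  then show "cls h \<in> dg_cone X \<sigma>"
  proof
    assume "0 < J h"
    then show ?thesis using J_pos[OF h] h by (auto simp: mem_dg_cone)
  next
    assume "cls h = cls (\<lambda>u. 0)"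
    then show ?thesis using C_int_zero by (auto simp: mem_dg_cone intro!: bexI[of _ "\<lambda>u. 0"] exI[of _ 0])
  qed
qed

lemma order_iff:
  assumes "u \<in> carrier G" "v \<in> carrier G"
  shows "dg_le X \<sigma> u v \<longleftrightarrow> \<omega> u < \<omega> v \<or> u = v"
proof -
  obtain f g where f: "f \<in> C_int X" "u = cls f" and g: "g \<in> C_int X" "v = cls g"
    using assms by (auto simp: carrier_G)
  let ?h = "\<lambda>x. g x + - f x"
  have h: "?h \<in> C_int X" using f g by (intro C_int_add C_int_uminus)
  have "v \<otimes>\<^bsub>G\<^esub> inv\<^bsub>G\<^esub> u = cls ?h" using f g by (simp add: inv_cls mult_cls C_int_uminus)
  then have "dg_le X \<sigma> u v \<longleftrightarrow> 0 < J ?h \<or> cls ?h = cls (\<lambda>x. 0)"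
    using cls_in_dg_cone_iff[OF h] by (simp add: dg_le_def)
  moreover have "J ?h = \<omega> v - \<omega> u"
    using f g J_add[OF g(1) C_int_uminus[OF f(1)]] by (simp add: J_uminus omega_cls)
  moreover have "cls ?h = cls (\<lambda>x. 0) \<longleftrightarrow> u = v"
  proof -
    have "(T ^^ n) ?h = (\<lambda>x. (T ^^ n) g x - (T ^^ n) f x)" for n
      using T_pow_add[of n g "\<lambda>x. - 1 * f x"] T_pow_scale[of n "- 1" f] by simp
    then have "(T ^^ n) ?h = (T ^^ n) (\<lambda>x. 0) \<longleftrightarrow> (T ^^ n) f = (T ^^ n) g" for n
      by (auto simp: T_pow_zero fun_eq_iff)
    then show ?thesis using f g cls_eq_iff[OF h C_int_zero] cls_eq_iff[OF f(1) g(1)] by simp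
  qed
  ultimately show ?thesis by simp
qed

lemma omega_state: "\<omega> \<in> states X \<sigma>"
  unfolding states_def
proof (intro CollectI conjI ballI)
  show "\<omega> \<in> extensional (carrier G)" by (simp add: \<omega>_def)
  show "\<omega> (cls (one_fun X)) = 1" by (simp add: omega_cls one_closed J_one)
  fix u v assume "u \<in> carrier G" "v \<in> carrier G"
  then show "\<omega> (u \<otimes>\<^bsub>G\<^esub> v) = \<omega> u + \<omega> v"
    by (auto simp: carrier_G mult_cls omega_cls C_int_add J_add)
next
  fix u assume "u \<in> dg_cone X \<sigma>"
  then show "0 \<le> \<omega> u" using dg_cone_nonneg by (auto simp: mem_dg_cone omega_cls)
qed

text \<open>A state is monotone, so it is squeezed between rational approximations of the integral.\<close>

lemma state_unique:
  assumes "\<eta> \<in> states X \<sigma>"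
  shows "\<eta> = \<omega>"
proof (rule extensionalityI)
  show "\<eta> \<in> extensional (carrier G)" using assms by (simp add: states_def)
  show "\<omega> \<in> extensional (carrier G)" by (simp add: \<omega>_def)
  define W where "W f = \<eta> (cls f)" for f
  have W_add: "W (\<lambda>u. f u + g u) = W f + W g" if "f \<in> C_int X" "g \<in> C_int X" for f g
    using assms that by (simp add: states_def W_def mult_cls[symmetric] cls_closed)
  have W_zero: "W (\<lambda>u. 0) = 0" using W_add[OF C_int_zero C_int_zero] by simp
  have W_uminus: "W (\<lambda>u. - f u) = - W f" if "f \<in> C_int X" for f
    using W_add[OF that C_int_uminus[OF that]] W_zero by simp
  have W_nat: "W (\<lambda>u. int n * f u) = real n * W f" if "f \<in> C_int X" for f n
  proof (induction n)
    case (Suc n)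
    have "W (\<lambda>u. int n * f u + f u) = real n * W f + W f"
      using W_add[OF C_int_scale[OF that] that] Suc by simp
    then show ?case by (simp add: algebra_simps)
  qed (simp add: W_zero)
  have W_int: "W (\<lambda>u. c * f u) = of_int c * W f" if "f \<in> C_int X" for f c
  proof (cases c)
    case (nonneg n)
    then show ?thesis using W_nat[OF that] by simp
  next
    case (neg n)
    then have "(\<lambda>u. c * f u) = (\<lambda>u. - (int (Suc n) * f u))" by (simp only: mult_minus_left)
    then show ?thesis using W_nat[OF that, of "Suc n"] W_uminus[OF C_int_scale[OF that, of "int (Suc n)"]]
      by (simp only: neg of_int_minus of_int_of_nat_eq mult_minus_left)
  qed
  have W_pos: "0 \<le> W f" if "f \<in> C_int X" "0 < J f" for f
    using assms that cls_in_dg_cone_iff[OF that(1)] by (simp add: states_def W_def)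
  have W_one: "W (one_fun X) = 1" using assms by (simp add: states_def W_def)
  have le: "W f \<le> J f" if f: "f \<in> C_int X" for f
  proof (rule ccontr)
    assume "\<not> W f \<le> J f"
    then obtain n where n: "1 < real n * (W f - J f)" using reals_Archimedean3[of "W f - J f"] by auto
    \<comment> \<open>The integer p exceeds n J f by at most 1, so p - n f has positive integral and
      \<open>W\<close> is nonnegative on it. Hence n W f \<le> p \<le> n J f + 1, against the choice
      of n.\<close>
    define p where "p = \<lfloor>real n * J f\<rfloor> + 1"
    let ?h = "\<lambda>u. p * one_fun X u + (- int n) * f u"
    have h: "?h \<in> C_int X" using f one_closed by (intro C_int_add C_int_scale)
    have p: "real n * J f < of_int p" "of_int p \<le> real n * J f + 1" unfolding p_def by linarith+
    have "J ?h = of_int p - real n * J f"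
      using J_add[OF C_int_scale[OF one_closed] C_int_scale[OF f], of p "- int n"]
      by (simp only: J_scale[OF f] J_scale[OF one_closed] J_one)
    then have "0 \<le> W ?h" using W_pos[OF h] p by simp
    also have "W ?h = of_int p - real n * W f"
      using W_add[OF C_int_scale[OF one_closed] C_int_scale[OF f], of p "- int n"]
      by (simp only: W_int[OF f] W_int[OF one_closed] W_one)
    finally show False using n p by (simp add: algebra_simps)
  qed
  fix u assume "u \<in> carrier G"
  then obtain f where f: "f \<in> C_int X" "u = cls f" by (auto simp: carrier_G)
  \<comment> \<open>The reverse inequality is the same bound applied to -f.\<close>
  have "W f = J f"
    using le[OF f(1)] le[OF C_int_uminus[OF f(1)]] W_uminus[OF f(1)] J_uminus[OF f(1)] by simp
  then show "\<eta> u = \<omega> u" using f by (simp add: W_def omega_cls)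
qed

lemma J_Z: "v \<in> carrier_mat 1 q \<Longrightarrow> J (Z v) = (\<Sum>i<q. of_int (v $$ (0, i)) * \<beta> ^ i)"
proof -
  have "J (\<lambda>u. \<Sum>i\<in>A. v $$ (0, i) * (T ^^ i) (one_fun X) u) = (\<Sum>i\<in>A. of_int (v $$ (0, i)) * \<beta> ^ i) \<and>
      (\<lambda>u. \<Sum>i\<in>A. v $$ (0, i) * (T ^^ i) (one_fun X) u) \<in> C_int X" if "finite A" for A
    using that
  proof (induction A rule: finite_induct)
    case empty
    then show ?case by (simp add: J_zero C_int_zero)
  next
    case (insert i A)
    have "(T ^^ i) (one_fun X) \<in> C_int X" by (rule T_pow_closed[OF one_closed])
    then show ?case using insert J_add[OF C_int_scale[of "(T ^^ i) (one_fun X)" X "v $$ (0, i)"]]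
      by (simp add: J_scale J_T_pow one_closed J_one C_int_add C_int_scale)
  qed
  then show ?thesis by (simp add: Z_def)
qed

lemma omega_lim_class:
  assumes v: "v \<in> carrier_mat 1 q"
  shows "\<omega> (inv_into (carrier G) \<phi> (lim_class q B v n)) =
    \<beta> powi (- int n) * (\<Sum>i<q. of_int (v $$ (0, i)) * \<beta> ^ i)"
proof -
  obtain f where f: "f \<in> C_int X" "(T ^^ n) f = Z v" "\<phi> (cls f) = lim_class q B v n"
    using ex_cls_of_lim_class[OF v] by blast
  have "inv_into (carrier G) \<phi> (lim_class q B v n) = cls f"
    unfolding f(3)[symmetric] by (rule inv_into_f_f[OF phi_inj cls_closed[OF f(1)]])
  then have "\<omega> (inv_into (carrier G) \<phi> (lim_class q B v n)) = J f" using f by (simp add: omega_cls)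
  moreover have "\<beta> ^ n * J f = (\<Sum>i<q. of_int (v $$ (0, i)) * \<beta> ^ i)"
    using J_T_pow[OF f(1), of n] f(2) J_Z[OF v] by simp
  then have "J f = \<beta> powi (- int n) * (\<Sum>i<q. of_int (v $$ (0, i)) * \<beta> ^ i)"
    using beta_pos by (simp add: power_int_minus field_simps)
  ultimately show ?thesis by simp
qed

lemma omega_range: "\<omega> ` carrier G = laurent_ring \<beta>"
proof (intro equalityI subsetI)
  fix x assume "x \<in> \<omega> ` carrier G"
  then show "x \<in> laurent_ring \<beta>" using J_laurent by (auto simp: carrier_G omega_cls)
next
  \<comment> \<open>Negative powers of \<beta> are integrals of preimages of the constant function
    under iterates of T.\<close>
  have power: "\<exists>g\<in>C_int X. J g = \<beta> powi k" for k
  proof (cases k)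
    case (nonneg n)
    then show ?thesis using J_T_pow[OF one_closed, of n] T_pow_closed[OF one_closed, of n] J_one
      by (intro bexI[of _ "(T ^^ n) (one_fun X)"]) auto
  next
    case (neg n)
    obtain g where g: "g \<in> C_int X" "(T ^^ Suc n) g = one_fun X" using T_pow_surj[OF one_closed] by blast
    then have "\<beta> ^ Suc n * J g = 1" using J_T_pow[OF g(1), of "Suc n"] J_one by simp
    then have "J g = \<beta> powi k"
      using beta_pos unfolding neg by (simp add: power_int_minus field_simps del: power_Suc of_nat_Suc)
    with g(1) show ?thesis by blast
  qed
  have sums: "\<exists>g\<in>C_int X. J g = (\<Sum>k\<in>A. of_int (c k) * \<beta> powi k)" if "finite A" for A c
    using that
  proof (induction A rule: finite_induct)
    case empty
    then show ?case using J_zero C_int_zero by auto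
  next
    case (insert k A)
    then obtain g where g: "g \<in> C_int X" "J g = (\<Sum>k\<in>A. of_int (c k) * \<beta> powi k)" by blast
    obtain h where h: "h \<in> C_int X" "J h = \<beta> powi k" using power by blast
    have "J (\<lambda>u. c k * h u + g u) = (\<Sum>k\<in>insert k A. of_int (c k) * \<beta> powi k)"
      using insert g h J_add[OF C_int_scale[OF h(1), of "c k"] g(1)] by (simp add: J_scale)
    then show ?case using C_int_add[OF C_int_scale[OF h(1), of "c k"] g(1)] by blast
  qed
  fix x assume "x \<in> laurent_ring \<beta>"
  then obtain g where "g \<in> C_int X" "J g = x" using sums by (auto simp: laurent_ring_finite_iff)
  then show "x \<in> \<omega> ` carrier G" by (auto simp: carrier_G omega_cls intro!: image_eqI[of _ _ "cls g"])
qed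

theorem dimension_group_structure:
  "\<exists>\<omega> \<phi>. \<phi> \<in> iso G (ind_limit q B) \<and> states X \<sigma> = {\<omega>} \<and>
    (\<forall>f\<in>C_int X. \<omega> (cls f) = J f) \<and>
    (\<forall>z\<in>carrier_mat 1 q. \<forall>n. \<omega> (inv_into (carrier G) \<phi> (lim_class q B z n)) =
       \<beta> powi (- int n) * (\<Sum>i<q. real_of_int (z $$ (0, i)) * \<beta> ^ i)) \<and>
    (\<forall>u\<in>carrier G. \<forall>v\<in>carrier G. dg_le X \<sigma> u v \<longleftrightarrow> \<omega> u < \<omega> v \<or> u = v) \<and>
    \<omega> ` carrier G = laurent_ring \<beta>"
proof (intro exI[of _ \<omega>] exI[of _ \<phi>] conjI ballI allI)
  show "states X \<sigma> = {\<omega>}" using omega_state state_unique by blast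
qed (fact phi_iso omega_range | rule omega_cls omega_lim_class order_iff; assumption)+

end

theorem proposition10p3:
  fixes \<beta> :: real and q :: nat and a :: "nat \<Rightarrow> int"
    and \<tau> :: "real \<Rightarrow> real" and P :: "real set"
    and X :: "(real \<times> int) topology" and \<sigma> :: "real \<times> int \<Rightarrow> real \<times> int"
    and L :: "(real \<times> int \<Rightarrow> int) \<Rightarrow> (real \<times> int \<Rightarrow> int)" and M :: "(real \<times> int \<Rightarrow> int) set"
    and B :: "int mat"
  defines "\<tau> \<equiv> beta_map \<beta>" and "P \<equiv> beta_partition \<beta>"
    and "X \<equiv> split_interval \<tau> P" and "\<sigma> \<equiv> local_homeo \<tau> P"
    and "L \<equiv> transfer_op X \<sigma>" and "M \<equiv> cyclic_module L (one_fun X)"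
    and "B \<equiv> companion q a"
  assumes "\<beta> > 1"
    and "eventually_periodic \<tau> 1"
    and "minimal_poly L M = monom 1 q - (\<Sum>i<q. monom (a i) (q - 1 - i))"
  shows "\<exists>\<omega> \<phi>.
      \<phi> \<in> iso (DG X \<sigma>) (ind_limit q B) \<and>
      states X \<sigma> = {\<omega>} \<and>
      (\<forall>f \<in> C_int X. \<omega> (dg_class X \<sigma> f) = lebesgue_int \<tau> P f) \<and>
      (\<forall>z \<in> carrier_mat 1 q. \<forall>n.
         \<omega> (inv_into (carrier (DG X \<sigma>)) \<phi> (lim_class q B z n)) =
           \<beta> powi (- int n) * (\<Sum>i<q. real_of_int (z $$ (0, i)) * \<beta> ^ i)) \<and>
      (\<forall>u \<in> carrier (DG X \<sigma>). \<forall>v \<in> carrier (DG X \<sigma>).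
         dg_le X \<sigma> u v \<longleftrightarrow> \<omega> u < \<omega> v \<or> u = v) \<and>
      \<omega> ` carrier (DG X \<sigma>) = laurent_ring \<beta>"
proof -
  interpret b: beta_transformation \<beta> by unfold_locales (rule assms)
  interpret b: periodic_beta_transformation \<beta>
    using b.finite_range_orbit assms(9) unfolding \<tau>_def by unfold_locales
  have X: "X = b.X" by (simp add: X_def \<tau>_def P_def b.X_def)
  have \<sigma>: "\<sigma> = b.sigma" by (simp add: \<sigma>_def \<tau>_def P_def b.local_homeo_eq_sigma)
  have L: "L = b.L" by (simp add: L_def X \<sigma> b.L_def)
  have J: "lebesgue_int \<tau> P = b.J" by (simp add: b.J_def \<tau>_def P_def)
  have min_poly: "minimal_poly b.L (cyclic_module b.L (one_fun b.X)) =
      monom 1 q - (\<Sum>i<q. monom (a i) (q - 1 - i))"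
    using assms(10) unfolding M_def L X .
  have J_strict: "f = (\<lambda>u. 0)"
    if f: "f \<in> b.cut_span" "\<And>u. u \<in> topspace b.X \<Longrightarrow> 0 \<le> f u" "b.J f = 0" for f
  proof
    fix u
    show "f u = 0"
    proof (cases "u \<in> topspace b.X")
      case True
      then show ?thesis using b.J_pos[OF f(1,2), of u] f(3) by auto
    next
      case False
      then show ?thesis using b.cut_span_in_C_int[OF f(1)] unfolding C_int_iff by blast
    qed
  qed
  have beta_pos: "0 < \<beta>" using assms(8) by simp
  have one_closed: "one_fun b.X \<in> b.cut_span"
    using b.cut_fun_in_span[OF b.one_in_D, of 1] by (simp add: b.one_fun_X)
  have J_one: "b.J (one_fun b.X) = 1" by (simp add: b.one_fun_X b.J_cut_fun b.one_in_D)
  \<comment> \<open>With continuous functions rewritten as the span of cuts, each locale assumption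
    is one of the facts proved above.\<close>
  have "cyclic_dimension_group b.X b.sigma \<beta> q a b.J"
    by (rule cyclic_dimension_group.intro; (unfold b.L_def[symmetric] b.C_int_eq_cut_span)?;
        rule beta_pos b.L_in_cut_span b.L_surj_cut_span one_closed b.recurrence[OF min_poly]
          b.powers_independent[OF min_poly] b.eventually_power_comb[OF min_poly] b.J_add b.J_scale
          b.J_L J_one b.J_nonneg J_strict b.J_pos_eventually_nonneg b.J_in_laurent_ring; blast?)
  from cyclic_dimension_group.dimension_group_structure[OF this]
  show ?thesis unfolding X \<sigma> B_def J .
qed


end
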